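(* Let $F$ be a finite field of odd order $q$. For a group $G$ let $k_2(G)$ be the number of conjugacy classes of nonidentity involutions of $G$. Then for every $r\ge 1$, $$k_2(B_r(F))=r,\qquad k_2(C_r(F))=\lfloor r/2\rfloor+1.$$ Consequently, for every $r\ge 3$, $$|B_r(F)|=|C_r(F)|\quad\text{and}\quad B_r(F)\not\cong C_r(F).$$
   Context: For a quadratic form $Q$ on a finite-dimensional $F$-vector space with polar form $B(x,y)=Q(x+y)-Q(x)-Q(y)$, a Siegel transformation is a map $x\mapsto x+B(x,u)w-B(x,w)u-Q(w)B(x,u)u$, where $u\ne0$, $Q(u)=0$, $B(u,w)=0$. $B_r(F)$ is the group generated by all Siegel transformations of the form $Q_B(x,y,z)=\sum_{i=1}^r x_iy_i+z^2$ on $F^{2r+1}$, divided by its subgroup of scalar transformations (so $B_r(F)=\mathrm{P}\Omega_{2r+1}(q)$). $C_r(F)=\mathrm{PSp}_{2r}(F)=\mathrm{Sp}_{2r}(F)/Z(\mathrm{Sp}_{2r}(F))$, for the standard nondegenerate alternating form on $F^{2r}$. *)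

theory Defs
  imports
    Jordan_Normal_Form.Matrix
    "HOL-Algebra.Bij"
    "HOL-Algebra.Coset"
    "HOL-Algebra.Generated_Groups"
    "HOL-Algebra.Group_Action"
begin

text \<open>
  The space $F^n$ is \<^term>\<open>carrier_vec n\<close>, with coordinates indexed from 0.  Transformations of
  $F^n$ are elements of \<^term>\<open>BijGroup (carrier_vec n)\<close>, so they are functions made
  \<^const>\<open>undefined\<close> outside $F^n$ and multiplied by composition.
\<close>

definition involutions :: "('g, 'm) monoid_scheme \<Rightarrow> 'g set" where
  "involutions G = {x \<in> carrier G. x \<noteq> \<one>\<^bsub>G\<^esub> \<and> x \<otimes>\<^bsub>G\<^esub> x = \<one>\<^bsub>G\<^esub>}"

definition k2 :: "('g, 'm) monoid_scheme \<Rightarrow> nat" where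
  "k2 G = card (orbits G (involutions G) (\<lambda>g x. g \<otimes>\<^bsub>G\<^esub> x \<otimes>\<^bsub>G\<^esub> inv\<^bsub>G\<^esub> g))"

definition polar_form :: "('a :: field vec \<Rightarrow> 'a) \<Rightarrow> 'a vec \<Rightarrow> 'a vec \<Rightarrow> 'a" where
  "polar_form Q x y = Q (x + y) - Q x - Q y"

definition siegel :: "nat \<Rightarrow> ('a :: field vec \<Rightarrow> 'a) \<Rightarrow> 'a vec \<Rightarrow> 'a vec \<Rightarrow> 'a vec \<Rightarrow> 'a vec" where
  "siegel n Q u w = (\<lambda>x \<in> carrier_vec n.
     x + polar_form Q x u \<cdot>\<^sub>v w - polar_form Q x w \<cdot>\<^sub>v u - (Q w * polar_form Q x u) \<cdot>\<^sub>v u)"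

definition siegel_transformations :: "nat \<Rightarrow> ('a :: field vec \<Rightarrow> 'a) \<Rightarrow> ('a vec \<Rightarrow> 'a vec) set" where
  "siegel_transformations n Q =
     {siegel n Q u w | u w. u \<in> carrier_vec n \<and> w \<in> carrier_vec n \<and>
        u \<noteq> 0\<^sub>v n \<and> Q u = 0 \<and> polar_form Q u w = 0}"

definition scalar_transformations :: "nat \<Rightarrow> ('a :: field vec \<Rightarrow> 'a vec) set" where
  "scalar_transformations n = {\<lambda>x \<in> carrier_vec n. c \<cdot>\<^sub>v x | c. c \<noteq> 0}"

text \<open>
  The coordinates $x_1,\dots,x_r$, $y_1,\dots,y_r$, $z$ of $F^{2r+1}$ have indices $0,\dots,r-1$,
  then $r,\dots,2r-1$, then $2r$.
\<close>

definition Q_B :: "nat \<Rightarrow> 'a :: field vec \<Rightarrow> 'a" where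
  "Q_B r v = (\<Sum>i<r. v $ i * v $ (r + i)) + (v $ (2 * r))\<^sup>2"

definition Omega_group :: "'a :: field itself \<Rightarrow> nat \<Rightarrow> ('a vec \<Rightarrow> 'a vec) monoid" where
  "Omega_group F r = (let S = BijGroup (carrier_vec (2 * r + 1)) in
     S\<lparr>carrier := generate S (siegel_transformations (2 * r + 1) (Q_B r))\<rparr>)"

definition B_group :: "'a :: field itself \<Rightarrow> nat \<Rightarrow> ('a vec \<Rightarrow> 'a vec) set monoid" where
  "B_group F r = (let G = Omega_group F r in
     G Mod (carrier G \<inter> scalar_transformations (2 * r + 1)))"

definition alternating_form :: "nat \<Rightarrow> 'a :: field vec \<Rightarrow> 'a vec \<Rightarrow> 'a" where
  "alternating_form r v w = (\<Sum>i<r. v $ i * w $ (r + i) - v $ (r + i) * w $ i)"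

definition linear_transformations :: "nat \<Rightarrow> ('a :: field vec \<Rightarrow> 'a vec) set" where
  "linear_transformations n = {g \<in> Bij (carrier_vec n).
     (\<forall>x \<in> carrier_vec n. \<forall>y \<in> carrier_vec n. g (x + y) = g x + g y) \<and>
     (\<forall>c. \<forall>x \<in> carrier_vec n. g (c \<cdot>\<^sub>v x) = c \<cdot>\<^sub>v g x)}"

definition Sp_group :: "'a :: field itself \<Rightarrow> nat \<Rightarrow> ('a vec \<Rightarrow> 'a vec) monoid" where
  "Sp_group F r = (BijGroup (carrier_vec (2 * r)))\<lparr>carrier :=
     {g \<in> linear_transformations (2 * r).
        \<forall>x \<in> carrier_vec (2 * r). \<forall>y \<in> carrier_vec (2 * r).
          alternating_form r (g x) (g y) = alternating_form r x y}\<rparr>"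

definition group_center :: "('g, 'm) monoid_scheme \<Rightarrow> 'g set" where
  "group_center G = {z \<in> carrier G. \<forall>g \<in> carrier G. z \<otimes>\<^bsub>G\<^esub> g = g \<otimes>\<^bsub>G\<^esub> z}"

definition C_group :: "'a :: field itself \<Rightarrow> nat \<Rightarrow> ('a vec \<Rightarrow> 'a vec) set monoid" where
  "C_group F r = Sp_group F r Mod group_center (Sp_group F r)"

end

theory Submission
  imports Defs "HOL-Library.Function_Algebras" "HOL-Library.Cardinality"
begin

text \<open>
  Both groups are studied on a finite space with a form \<open>b\<close> satisfying
  \<open>b x y = eps * b y x\<close>, where \<open>eps\<close> is 1 or -1.  Splitting off a
  hyperbolic pair and counting such pairs gives the order of the full isometry group; the recursions
  for $\mathrm{Sp}_{2r}$ and $\mathrm{O}_{2r+1}$ coincide up to the factor 2 at $r = 0$.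

  For $c \ne 0$, counting sign changes on a half system of the sphere $Q = c$ is a character of the
  orthogonal group, which is -1 on the reflection in $v$ iff $Q(v)$ is $c$ times a square.  For $c$
  equal to 1 and to a nonsquare $d$ these two characters replace determinant and spinor norm.  A Siegel
  transformation is a square, so it lies in the kernel of both; conversely reflections generate, and two
  reflections with values of $Q$ in the same square class agree modulo Siegel transformations.  Hence
  $\Omega$ is the common kernel and has index 4.

  An involution in $\Omega$ has a $-1$-eigenspace of even dimension with an orthonormal basis, and
  this dimension determines its class, which gives $r$ classes.  In $\mathrm{PSp}_{2r}$ an involution
  lifts to $g$ with $g^2 = 1$, classified by the unordered pair of dimensions of its eigenspaces, or with
  $g^2 = -1$; the latter form one class because the space splits into hyperbolic planes spanned by
  some $v$ and $g v$.
\<close>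

subsection \<open>Isometries and hyperbolic pairs\<close>

text \<open>For alternating forms, an isometry between spaces of equal size exists because the
  number of isometries is not zero; for quadratic forms it comes from orthogonal bases on which
  \<open>Q\<close> is 1 except perhaps once. Over a finite field a nonzero value Q(v) is either a
  square or d times a square, so exactly one of the two characters is -1 on a given reflection, and
  their product plays the part of the determinant. In odd dimension the map -1 is therefore outside
  Omega, and dividing Omega by scalars changes nothing, whereas Sp loses its center of order 2.
  Since |O| = 2 |Sp|, index 4 on one side and a kernel of order 2 on the other give equal orders.
  The delicate point in counting classes of Omega is that a class of the full isometry group could
  split. It does not: the -1-eigenspace of an involution of Omega has dimension at least 2, so it
  contains vectors with Q equal to 1 and to d, and reflections in these commute with the involution
  while realizing all values of the two characters.\<close>

locale eps_space = vector_space scale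
  for scale :: "'a::{field,finite} \<Rightarrow> 'v::ab_group_add \<Rightarrow> 'v" (infixr "*s" 75) +
  fixes b :: "'v \<Rightarrow> 'v \<Rightarrow> 'a" and eps :: 'a
  assumes b_add: "b (x + y) z = b x z + b y z"
    and b_scale: "b (c *s x) z = c * b x z"
    and b_swap: "b x y = eps * b y x"
    and eps_sq: "eps * eps = 1"
    and two: "(2::'a) \<noteq> 0"
begin

lemma b_add2: "b z (x + y) = b z x + b z y"
  using b_add[of x y z] b_swap[of z "x + y"] b_swap[of z x] b_swap[of z y]
  by (simp add: algebra_simps)

lemma b_scale2: "b z (c *s x) = c * b z x"
  using b_scale[of c x z] b_swap[of z "c *s x"] b_swap[of z x]
  by (simp add: algebra_simps)

lemma b_0 [simp]: "b 0 z = 0" "b z 0 = 0"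
  using b_scale[of 0 0 z] b_scale2[of z 0 0] by simp_all

lemma b_minus [simp]: "b (- x) z = - b x z" "b z (- x) = - b z x"
  using b_scale[of "-1" x z] b_scale2[of z "-1" x] by simp_all

lemma b_diff: "b (x - y) z = b x z - b y z" "b z (x - y) = b z x - b z y"
  using b_add[of x "- y" z] b_add2[of z x "- y"] by simp_all

lemmas b_simps = b_add b_add2 b_scale b_scale2 b_diff

lemma b_zero_swap: "b x y = 0 \<longleftrightarrow> b y x = 0"
  by (metis b_swap mult_zero_right)

lemma eps_eps [simp]: "eps * (eps * x) = x"
  using eps_sq by (metis mult.assoc mult_1)

lemma eps_nz [simp]: "eps \<noteq> 0"
  using eps_sq by auto

lemma half_double: "(1/2::'a) *s (x + x) = x"
  using two by (simp add: scale_right_distrib flip: scale_left_distrib)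

text \<open>Spaces are finite subspaces of one ambient type, so complements and eigenspaces are
  objects of the same kind and inductions can run over \<open>card V\<close>.\<close>

definition ndg :: "'v set \<Rightarrow> bool" where
  "ndg V \<longleftrightarrow> subspace V \<and> finite V \<and> (\<forall>x\<in>V. (\<forall>y\<in>V. b x y = 0) \<longrightarrow> x = 0)"

definition isometry :: "'v set \<Rightarrow> 'v set \<Rightarrow> ('v \<Rightarrow> 'v) \<Rightarrow> bool" where
  "isometry V V' g \<longleftrightarrow> (\<forall>x\<in>V. \<forall>y\<in>V. g (x + y) = g x + g y) \<and> (\<forall>c. \<forall>x\<in>V. g (c *s x) = c *s g x) \<and>
     g ` V = V' \<and> (\<forall>x\<in>V. \<forall>y\<in>V. b (g x) (g y) = b x y)"

text \<open>Extensionality makes each isometry a single function, so that the set can be counted and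
  embedded in \<open>BijGroup V\<close>.\<close>

definition isometries :: "'v set \<Rightarrow> 'v set \<Rightarrow> ('v \<Rightarrow> 'v) set" where
  "isometries V V' = {g \<in> extensional V. isometry V V' g}"

lemma ndgD: "ndg V \<Longrightarrow> subspace V" "ndg V \<Longrightarrow> finite V"
  by (auto simp: ndg_def)

lemma ndg_zeroI: "ndg V \<Longrightarrow> x \<in> V \<Longrightarrow> (\<And>y. y \<in> V \<Longrightarrow> b x y = 0) \<Longrightarrow> x = 0"
  by (auto simp: ndg_def)

lemma ndg_ex_partner:
  assumes "ndg V" "x \<in> V" "x \<noteq> 0" obtains y where "y \<in> V" "b x y = 1"
proof -
  obtain y where y: "y \<in> V" "b x y \<noteq> 0"
    using assms by (auto simp: ndg_def)
  have "(1 / b x y) *s y \<in> V" "b x ((1 / b x y) *s y) = 1"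
    using y assms by (auto simp: b_simps ndgD subspace_scale)
  then show ?thesis using that by blast
qed

lemma isoD:
  assumes "isometry V V' g"
  shows "x \<in> V \<Longrightarrow> y \<in> V \<Longrightarrow> g (x + y) = g x + g y"
    and "x \<in> V \<Longrightarrow> g (c *s x) = c *s g x"
    and "g ` V = V'"
    and "x \<in> V \<Longrightarrow> g x \<in> V'"
    and "x \<in> V \<Longrightarrow> y \<in> V \<Longrightarrow> b (g x) (g y) = b x y"
  using assms by (auto simp: isometry_def)

lemma iso_neg: "isometry V V' g \<Longrightarrow> x \<in> V \<Longrightarrow> g (- x) = - g x"
  using isoD(2)[of V V' g x "-1"] by simp

lemma iso_diff: "isometry V V' g \<Longrightarrow> subspace V \<Longrightarrow> x \<in> V \<Longrightarrow> y \<in> V \<Longrightarrow> g (x - y) = g x - g y"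
  using isoD(1)[of V V' g x "- y"] by (simp add: iso_neg subspace_neg)

lemma iso_zero: "isometry V V' g \<Longrightarrow> subspace V \<Longrightarrow> g 0 = 0"
  using isoD(2)[of V V' g 0 0] by (simp add: subspace_0)

lemma iso_cong: "(\<And>x. x \<in> V \<Longrightarrow> g x = h x) \<Longrightarrow> subspace V \<Longrightarrow> isometry V V' g \<longleftrightarrow> isometry V V' h"
  unfolding isometry_def by (simp add: subspace_add subspace_scale cong: image_cong)

text \<open>A vector sent to 0 is orthogonal to all of V, because the form is preserved.\<close>

lemma iso_inj: assumes "isometry V V' g" "ndg V" shows "inj_on g V"
proof (rule inj_onI)
  fix x y assume xy: "x \<in> V" "y \<in> V" "g x = g y"
  then have d: "x - y \<in> V" "g (x - y) = 0"
    using assms by (auto simp: iso_diff ndgD subspace_diff)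
  have "x - y = 0"
  proof (rule ndg_zeroI[OF assms(2) d(1)])
    fix z assume "z \<in> V"
    then show "b (x - y) z = 0" using isoD(5)[OF assms(1) d(1), of z] d(2) by simp
  qed
  then show "x = y" by simp
qed

lemma iso_bij: "isometry V V' g \<Longrightarrow> ndg V \<Longrightarrow> bij_betw g V V'"
  by (simp add: bij_betw_def iso_inj isoD(3))

lemma iso_card: "isometry V V' g \<Longrightarrow> ndg V \<Longrightarrow> card V' = card V"
  using iso_bij bij_betw_same_card by metis

text \<open>Surjectivity is replaced by a count: a form-preserving linear map on a nondegenerate
  space is injective, hence onto any finite target of the same size that contains its image.\<close>

lemma isoI:
  assumes "ndg V" "finite V'" "card V' = card V"
    and "\<And>x y. x \<in> V \<Longrightarrow> y \<in> V \<Longrightarrow> g (x + y) = g x + g y"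
    and "\<And>c x. x \<in> V \<Longrightarrow> g (c *s x) = c *s g x"
    and "\<And>x. x \<in> V \<Longrightarrow> g x \<in> V'"
    and "\<And>x y. x \<in> V \<Longrightarrow> y \<in> V \<Longrightarrow> b (g x) (g y) = b x y"
  shows "isometry V V' g"
proof -
  have "isometry V (g ` V) g" unfolding isometry_def using assms by auto
  then have "card (g ` V) = card V" using iso_card assms(1) by blast
  then have "g ` V = V'" using assms by (intro card_subset_eq) auto
  then show ?thesis using \<open>isometry V (g ` V) g\<close> by simp
qed

lemma iso_ident: "isometry V V (\<lambda>x. x)" "isometry V V id"
  by (auto simp: isometry_def)

lemma iso_comp: "isometry V V' g \<Longrightarrow> isometry V' V'' h \<Longrightarrow> isometry V V'' (\<lambda>x. h (g x))"
  unfolding isometry_def by (auto simp flip: image_image)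

lemma iso_inv:
  assumes "isometry V V' g" "ndg V" shows "isometry V' V (inv_into V g)"
proof -
  let ?h = "inv_into V g"
  have bij: "bij_betw g V V'" using assms iso_bij by blast
  have h: "?h y \<in> V" "g (?h y) = y" if "y \<in> V'" for y
    using that isoD(3)[OF assms(1)] by (auto simp: inv_into_into f_inv_into_f)
  have h2: "?h (g x) = x" if "x \<in> V" for x
    using that bij by (simp add: bij_betw_def)
  have s: "subspace V" using assms ndgD by blast
  show ?thesis unfolding isometry_def
  proof (intro conjI ballI allI)
    fix x y assume xy: "x \<in> V'" "y \<in> V'"
    have "?h (g (?h x + ?h y)) = ?h x + ?h y"
      using h xy s by (intro h2) (auto simp: subspace_add)
    then show "?h (x + y) = ?h x + ?h y"
      using xy h isoD(1)[OF assms(1)] by simp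
    show "b (?h x) (?h y) = b x y"
      using isoD(5)[OF assms(1), of "?h x" "?h y"] h xy by simp
  next
    fix c x assume x: "x \<in> V'"
    have "?h (g (c *s ?h x)) = c *s ?h x"
      using h x s by (intro h2) (auto simp: subspace_scale)
    then show "?h (c *s x) = c *s ?h x"
      using x h isoD(2)[OF assms(1)] by simp
  next
    show "?h ` V' = V"
      by (rule bij_betw_imp_surj_on[OF bij_betw_inv_into[OF bij]])
  qed
qed

lemma iso_subspace:
  assumes "isometry V V' g" "subspace V" shows "subspace V'"
proof (rule subspaceI)
  show "0 \<in> V'" using assms isoD(4)[OF assms(1), of 0] by (simp add: iso_zero subspace_0)
next
  fix x y assume "x \<in> V'" "y \<in> V'"
  then obtain x' y' where "x' \<in> V" "y' \<in> V" "x = g x'" "y = g y'"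
    using isoD(3)[OF assms(1)] by blast
  then show "x + y \<in> V'"
    using isoD(1,4)[OF assms(1)] assms(2) by (metis subspace_add)
next
  fix c x assume "x \<in> V'"
  then obtain x' where "x' \<in> V" "x = g x'"
    using isoD(3)[OF assms(1)] by blast
  then show "c *s x \<in> V'"
    using isoD(2,4)[OF assms(1)] assms(2) by (metis subspace_scale)
qed

lemma iso_ndg:
  assumes "isometry V V' g" "ndg V" shows "ndg V'"
  unfolding ndg_def
proof (intro conjI ballI impI)
  show "subspace V'" using iso_subspace assms ndgD by blast
  show "finite V'" using assms isoD(3) ndgD by blast
  fix x assume x: "x \<in> V'" "\<forall>y\<in>V'. b x y = 0"
  then obtain x' where x': "x' \<in> V" "x = g x'"
    using isoD(3)[OF assms(1)] by blast
  have "x' = 0"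
    by (rule ndg_zeroI[OF assms(2) x'(1)]) (metis isoD(4,5)[OF assms(1)] x x')
  then show "x = 0" using x' assms iso_zero ndgD by metis
qed

section \<open>Orthogonal complements and splitting off a hyperbolic pair\<close>

definition perp1 :: "'v set \<Rightarrow> 'v \<Rightarrow> 'v set" where
  "perp1 V v = {x \<in> V. b x v = 0}"

definition perp2 :: "'v set \<Rightarrow> 'v \<Rightarrow> 'v \<Rightarrow> 'v set" where
  "perp2 V e f = {x \<in> V. b x e = 0 \<and> b x f = 0}"

definition hyp :: "'v set \<Rightarrow> 'v \<Rightarrow> 'v \<Rightarrow> bool" where
  "hyp V e f \<longleftrightarrow> e \<in> V \<and> f \<in> V \<and> b e e = 0 \<and> b f f = 0 \<and> b e f = 1"

text \<open>Orthogonal projection onto the complement of the plane spanned by e and f. Since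
  \<open>b f e = eps\<close>, the coordinate of x along f is \<open>eps * b x e\<close>; this lets
  one formula serve both signs.\<close>

definition hproj :: "'v \<Rightarrow> 'v \<Rightarrow> 'v \<Rightarrow> 'v" where
  "hproj e f x = x - b x f *s e - (eps * b x e) *s f"

lemma hypD:
  assumes "hyp V e f"
  shows "e \<in> V" "f \<in> V" "b e e = 0" "b f f = 0" "b e f = 1" "b f e = eps"
  using assms b_swap[of f e] by (auto simp: hyp_def)

lemma perp2_swap: "x \<in> perp2 V e f \<Longrightarrow> b e x = 0 \<and> b f x = 0"
  using b_zero_swap by (auto simp: perp2_def)

lemma subspace_perp1: "subspace V \<Longrightarrow> subspace (perp1 V v)"
  unfolding perp1_def by (rule subspaceI) (auto simp: b_simps subspace_0 subspace_add subspace_scale)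

lemma subspace_perp2: "subspace V \<Longrightarrow> subspace (perp2 V e f)"
  unfolding perp2_def by (rule subspaceI) (auto simp: b_simps subspace_0 subspace_add subspace_scale)

lemma hproj_in:
  assumes "hyp V e f" "subspace V" "x \<in> V" shows "hproj e f x \<in> perp2 V e f"
proof -
  have "hproj e f x \<in> V"
    unfolding hproj_def by (intro subspace_diff subspace_scale assms hypD[OF assms(1)])
  then show ?thesis
    by (simp add: perp2_def hproj_def b_simps hypD[OF assms(1)] eps_sq mult.assoc mult.left_commute)
qed

lemma hdecomp: "x = b x f *s e + (eps * b x e) *s f + hproj e f x"
  by (simp add: hproj_def)

lemma hproj_id: "x \<in> perp2 V e f \<Longrightarrow> hproj e f x = x"
  by (simp add: hproj_def perp2_def)

lemma hproj_add: "hproj e f (x + y) = hproj e f x + hproj e f y"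
  by (simp add: hproj_def b_simps algebra_simps)

lemma hproj_scale: "hproj e f (c *s x) = c *s hproj e f x"
  by (simp add: hproj_def b_simps algebra_simps)

lemma b_hdecomp:
  assumes "hyp V e f" "w \<in> perp2 V e f" "w' \<in> perp2 V e f"
  shows "b (a *s e + c *s f + w) (a' *s e + c' *s f + w') = a * c' + eps * c * a' + b w w'"
  using assms hypD[OF assms(1)] perp2_swap[OF assms(2)] perp2_swap[OF assms(3)]
  by (auto simp: b_simps perp2_def algebra_simps)

lemma hyp_coords:
  assumes "hyp V e f" "w \<in> perp2 V e f"
  shows "b (a *s e + c *s f + w) f = a" "eps * b (a *s e + c *s f + w) e = c"
    "hproj e f (a *s e + c *s f + w) = w"
  using assms(2)
  by (simp_all add: b_simps perp2_def hproj_def hypD[OF assms(1)] eps_sq mult.left_commute)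

text \<open>A vector of the complement is orthogonal to e and f anyway, so if it is orthogonal to
  the complement it is orthogonal to all of V.\<close>

lemma ndg_perp2: assumes "ndg V" "hyp V e f" shows "ndg (perp2 V e f)"
  unfolding ndg_def
proof (intro conjI ballI impI)
  show "subspace (perp2 V e f)" "finite (perp2 V e f)"
    using assms ndgD subspace_perp2 by (auto simp: perp2_def)
  fix x assume x: "x \<in> perp2 V e f" "\<forall>y\<in>perp2 V e f. b x y = 0"
  show "x = 0"
  proof (rule ndg_zeroI[OF assms(1)])
    show "x \<in> V" using x by (simp add: perp2_def)
    fix y assume y: "y \<in> V"
    have "b x (hproj e f y) = 0" using x hproj_in[OF assms(2) _ y] assms ndgD by blast
    then show "b x y = 0" using x perp2_swap[OF x(1)]
      by (simp add: hproj_def b_simps perp2_def)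
  qed
qed

lemma hyp_bij:
  assumes "subspace V" "hyp V e f"
  shows "bij_betw (\<lambda>((a, c), w). a *s e + c *s f + w) ((UNIV \<times> UNIV) \<times> perp2 V e f) V"
proof (rule bij_betw_byWitness[where f' = "\<lambda>x. ((b x f, eps * b x e), hproj e f x)"])
  show "\<forall>a\<in>(UNIV \<times> UNIV) \<times> perp2 V e f. ((b ((\<lambda>((a, c), w). a *s e + c *s f + w) a) f,
      eps * b ((\<lambda>((a, c), w). a *s e + c *s f + w) a) e), hproj e f ((\<lambda>((a, c), w). a *s e + c *s f + w) a)) = a"
    using hyp_coords[OF assms(2)] by auto
  show "\<forall>a'\<in>V. (\<lambda>((a, c), w). a *s e + c *s f + w) ((b a' f, eps * b a' e), hproj e f a') = a'"
    using hdecomp by simp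
  show "(\<lambda>((a, c), w). a *s e + c *s f + w) ` ((UNIV \<times> UNIV) \<times> perp2 V e f) \<subseteq> V"
    using assms hypD[OF assms(2)] by (auto simp: perp2_def intro!: subspace_add subspace_scale)
  show "(\<lambda>x. ((b x f, eps * b x e), hproj e f x)) ` V \<subseteq> (UNIV \<times> UNIV) \<times> perp2 V e f"
    using hproj_in assms by auto
qed

lemma card_hyp:
  assumes "subspace V" "hyp V e f"
  shows "card V = CARD('a) * CARD('a) * card (perp2 V e f)"
  using bij_betw_same_card[OF hyp_bij[OF assms]] by (simp add: card_cartesian_product)

text \<open>The extension of h, defined on the complement of (e, f), that sends e to e' and f to
  f'.\<close>

definition hext :: "'v \<Rightarrow> 'v \<Rightarrow> 'v \<Rightarrow> 'v \<Rightarrow> ('v \<Rightarrow> 'v) \<Rightarrow> 'v \<Rightarrow> 'v" where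
  "hext e f e' f' h x = b x f *s e' + (eps * b x e) *s f' + h (hproj e f x)"

lemma hext_simps:
  assumes "hyp V e f" "subspace V" "isometry (perp2 V e f) W' h"
  shows "hext e f e' f' h e = e'" "hext e f e' f' h f = f'"
    "x \<in> perp2 V e f \<Longrightarrow> hext e f e' f' h x = h x"
proof -
  have h0: "h 0 = 0" using iso_zero[OF assms(3)] subspace_perp2 assms by blast
  have "hproj e f e = 0" "hproj e f f = 0"
    using hypD[OF assms(1)] by (auto simp: hproj_def eps_sq)
  then show "hext e f e' f' h e = e'" "hext e f e' f' h f = f'"
    using hypD[OF assms(1)] h0 by (auto simp: hext_def eps_sq)
  show "x \<in> perp2 V e f \<Longrightarrow> hext e f e' f' h x = h x"
    using hproj_id[of x V e f] by (simp add: hext_def perp2_def)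
qed

lemma iso_hext:
  assumes "ndg V" "subspace V'" "hyp V e f" "hyp V' e' f'" "isometry (perp2 V e f) (perp2 V' e' f') h"
  shows "isometry V V' (hext e f e' f' h)"
proof -
  let ?g = "hext e f e' f' h"
  note s = ndgD(1)[OF assms(1)]
  have pin: "hproj e f x \<in> perp2 V e f" if "x \<in> V" for x
    using hproj_in[OF assms(3) s that] .
  have hin: "h (hproj e f x) \<in> perp2 V' e' f'" if "x \<in> V" for x
    using isoD(4)[OF assms(5) pin[OF that]] .
  have W: "ndg (perp2 V e f)" using ndg_perp2 assms by blast
  have W': "ndg (perp2 V' e' f')" using iso_ndg[OF assms(5) W] .
  have cW: "card (perp2 V' e' f') = card (perp2 V e f)" using iso_card[OF assms(5) W] .
  have cV: "card V' = card V" using card_hyp[OF assms(2,4)] card_hyp[OF s assms(3)] cW by simp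
  have "finite V'"
    using bij_betw_finite[OF hyp_bij[OF assms(2,4)]] ndgD(2)[OF W'] by simp
  then show ?thesis
  proof (rule isoI[OF assms(1) _ cV])
    fix x y assume xy: "x \<in> V" "y \<in> V"
    show "?g (x + y) = ?g x + ?g y"
      using isoD(1)[OF assms(5) pin[OF xy(1)] pin[OF xy(2)]]
      by (simp add: hext_def hproj_add b_simps algebra_simps)
    show "b (?g x) (?g y) = b x y"
    proof -
      have "b (?g x) (?g y) = b x f * (eps * b y e) + eps * (eps * b x e) * b y f
          + b (h (hproj e f x)) (h (hproj e f y))"
        unfolding hext_def by (rule b_hdecomp[OF assms(4) hin hin]) (use xy in auto)
      also have "b (h (hproj e f x)) (h (hproj e f y)) = b (hproj e f x) (hproj e f y)"
        using isoD(5)[OF assms(5) pin pin] xy by blast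
      also have "b x f * (eps * b y e) + eps * (eps * b x e) * b y f + b (hproj e f x) (hproj e f y) = b x y"
        using b_hdecomp[OF assms(3) pin pin, of x y "b x f" "eps * b x e" "b y f" "eps * b y e"] xy
          hdecomp[of x f e] hdecomp[of y f e] by simp
      finally show ?thesis .
    qed
  next
    fix c x assume x: "x \<in> V"
    show "?g (c *s x) = c *s ?g x"
      using isoD(2)[OF assms(5) pin[OF x], of c]
      by (simp add: hext_def hproj_scale b_simps algebra_simps)
  next
    fix x assume "x \<in> V"
    then show "?g x \<in> V'" using hin[of x] hypD[OF assms(4)] assms(2) unfolding hext_def
      by (auto simp: perp2_def intro!: subspace_add subspace_scale)
  qed
qed

lemma iso_hyp: "isometry V V' g \<Longrightarrow> hyp V e f \<Longrightarrow> hyp V' (g e) (g f)"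
  using isoD[of V V' g] by (auto simp: hyp_def)

lemma iso_perp2:
  assumes "isometry V V' g" "e \<in> V" "f \<in> V" shows "isometry (perp2 V e f) (perp2 V' (g e) (g f)) g"
proof -
  have "g ` perp2 V e f = perp2 V' (g e) (g f)"
    unfolding perp2_def using assms isoD(3)[OF assms(1)] isoD(5)[OF assms(1)]
    by (auto simp: image_iff)
  then show ?thesis using assms unfolding isometry_def perp2_def by auto
qed

lemma iso_perp1:
  assumes "isometry V V' g" "v \<in> V" shows "isometry (perp1 V v) (perp1 V' (g v)) g"
proof -
  have "g ` perp1 V v = perp1 V' (g v)"
    unfolding perp1_def using assms isoD(3)[OF assms(1)] isoD(5)[OF assms(1)]
    by (auto simp: image_iff)
  then show ?thesis using assms unfolding isometry_def perp1_def by auto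
qed

text \<open>Every isometry arises by \<open>hext\<close> from its values on e, f and the complement;
  this is the inverse direction needed for the count.\<close>

lemma iso_hext_eq:
  assumes "isometry V V' g" "hyp V e f" "subspace V" "x \<in> V"
  shows "g x = hext e f (g e) (g f) g x"
proof -
  note h = hypD[OF assms(2)]
  have p: "hproj e f x \<in> V" using hproj_in[OF assms(2,3,4)] by (simp add: perp2_def)
  have "g (b x f *s e + (eps * b x e) *s f + hproj e f x) = b x f *s g e + (eps * b x e) *s g f + g (hproj e f x)"
    using p h assms isoD(1,2)[OF assms(1)] by (simp add: subspace_add subspace_scale)
  then show ?thesis unfolding hext_def using hdecomp[of x f e] by simp
qed

section \<open>Counting isometries by the image of a hyperbolic pair\<close>

definition hyps :: "'v set \<Rightarrow> ('v \<times> 'v) set" where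
  "hyps V = {(e, f). hyp V e f}"

lemma finite_isos: assumes "finite V" "finite V'" shows "finite (isometries V V')"
proof (rule finite_subset)
  show "isometries V V' \<subseteq> V \<rightarrow>\<^sub>E V'" by (auto simp: isometries_def PiE_def isoD(4))
  show "finite (V \<rightarrow>\<^sub>E V')" using assms by (simp add: finite_PiE)
qed

text \<open>An isometry amounts to the image of (e, f), which may be any hyperbolic pair of the
  target, together with an isometry between the two complements. The fibres over the pairs all have
  n elements by assumption.\<close>

lemma card_isos_step:
  assumes V: "ndg V" "hyp V e f" and V': "ndg V'"
    and n: "\<And>e' f'. hyp V' e' f' \<Longrightarrow> card (isometries (perp2 V e f) (perp2 V' e' f')) = n"
  shows "card (isometries V V') = card (hyps V') * n"
proof -
  let ?W = "perp2 V e f"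
  let ?S = "SIGMA p:hyps V'. isometries ?W (perp2 V' (fst p) (snd p))"
  note s = ndgD(1)[OF V(1)] and s' = ndgD(1)[OF V']
  have WV: "?W \<subseteq> V" by (auto simp: perp2_def)
  note ef = hypD(1,2)[OF V(2)]
  have sW: "subspace ?W" using s subspace_perp2 by blast
  have bij: "bij_betw (\<lambda>g. ((g e, g f), restrict g ?W)) (isometries V V') ?S"
  proof (rule bij_betw_byWitness[where f' = "\<lambda>((e', f'), h). restrict (hext e f e' f' h) V"])
    show "\<forall>g\<in>isometries V V'. (\<lambda>((e', f'), h). restrict (hext e f e' f' h) V) ((g e, g f), restrict g ?W) = g"
    proof
      fix g assume g: "g \<in> isometries V V'"
      have "restrict (hext e f (g e) (g f) (restrict g ?W)) V = g"
      proof (rule extensionalityI[of _ V])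
        show "g \<in> extensional V" using g by (simp add: isometries_def)
        fix x assume x: "x \<in> V"
        show "restrict (hext e f (g e) (g f) (restrict g ?W)) V x = g x"
          using iso_hext_eq[of V V' g, OF _ V(2) s x] g hproj_in[OF V(2) s x] x
          by (simp add: isometries_def hext_def)
      qed simp
      then show "(\<lambda>((e', f'), h). restrict (hext e f e' f' h) V) ((g e, g f), restrict g ?W) = g"
        by simp
    qed
    show "\<forall>a'\<in>?S. (((\<lambda>((e', f'), h). restrict (hext e f e' f' h) V) a' e,
        (\<lambda>((e', f'), h). restrict (hext e f e' f' h) V) a' f),
        restrict ((\<lambda>((e', f'), h). restrict (hext e f e' f' h) V) a') ?W) = a'"
    proof
      fix p assume "p \<in> ?S"
      then obtain e' f' h where p: "p = ((e', f'), h)" and h: "h \<in> isometries ?W (perp2 V' e' f')"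
        by (cases p; cases "fst p") auto
      then have ih: "isometry ?W (perp2 V' e' f') h" by (simp add: isometries_def)
      note hs = hext_simps[OF V(2) s ih, where e' = e' and f' = f']
      have "restrict (restrict (hext e f e' f' h) V) ?W = h"
        using h WV by (intro extensionalityI[of _ ?W]) (auto simp: isometries_def hs)
      then show "(((\<lambda>((e', f'), h). restrict (hext e f e' f' h) V) p e,
        (\<lambda>((e', f'), h). restrict (hext e f e' f' h) V) p f),
        restrict ((\<lambda>((e', f'), h). restrict (hext e f e' f' h) V) p) ?W) = p"
        using ef hs(1,2) by (simp add: p)
    qed
    show "(\<lambda>g. ((g e, g f), restrict g ?W)) ` isometries V V' \<subseteq> ?S"
    proof (rule image_subsetI)
      fix g assume "g \<in> isometries V V'"
      then have g: "isometry V V' g" by (simp add: isometries_def)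
      have "isometry ?W (perp2 V' (g e) (g f)) (restrict g ?W)"
        using iso_perp2[OF g ef] iso_cong[OF _ sW, of "restrict g ?W" g] by simp
      then show "((g e, g f), restrict g ?W) \<in> ?S"
        using iso_hyp[OF g V(2)] by (simp add: hyps_def isometries_def)
    qed
    show "(\<lambda>((e', f'), h). restrict (hext e f e' f' h) V) ` ?S \<subseteq> isometries V V'"
    proof (rule image_subsetI)
      fix p assume "p \<in> ?S"
      then obtain e' f' h where p: "p = ((e', f'), h)" "hyp V' e' f'" "isometry ?W (perp2 V' e' f') h"
        by (cases p; cases "fst p") (auto simp: hyps_def isometries_def)
      have "isometry V V' (restrict (hext e f e' f' h) V)"
        using iso_hext[OF V(1) s' V(2) p(2,3)] iso_cong[OF _ s, of "restrict (hext e f e' f' h) V" "hext e f e' f' h"]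
        by simp
      then show "(\<lambda>((e', f'), h). restrict (hext e f e' f' h) V) p \<in> isometries V V'"
        using p by (simp add: isometries_def)
    qed
  qed
  have fh: "finite (hyps V')"
    by (rule finite_subset[of _ "V' \<times> V'"]) (use ndgD(2)[OF V'] in \<open>auto simp: hyps_def hyp_def\<close>)
  have fin: "\<And>p. finite (isometries ?W (perp2 V' (fst p) (snd p)))"
    by (rule finite_isos) (use ndgD V V' in \<open>auto simp: perp2_def\<close>)
  have "card (isometries V V') = card ?S" using bij bij_betw_same_card by blast
  also have "\<dots> = (\<Sum>p\<in>hyps V'. card (isometries ?W (perp2 V' (fst p) (snd p))))"
    by (rule card_SigmaI) (use fh fin in auto)
  also have "\<dots> = (\<Sum>p\<in>hyps V'. n)"
    by (rule sum.cong) (use n in \<open>auto simp: hyps_def\<close>)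
  finally show ?thesis by simp
qed

text \<open>Translating along a vector y with \<open>b e y = 1\<close> shows that the q level sets
  of the functional \<open>b e\<close> have equal size.\<close>

lemma card_level:
  assumes "ndg V" "e \<in> V" "e \<noteq> 0"
  shows "CARD('a) * card {x \<in> V. b e x = c} = card V"
proof -
  obtain y where y: "y \<in> V" "b e y = 1" using ndg_ex_partner assms by blast
  note s = ndgD(1)[OF assms(1)]
  have "bij_betw (\<lambda>(t, x). x + t *s y) (UNIV \<times> {x \<in> V. b e x = c}) V"
    by (rule bij_betw_byWitness[where f' = "\<lambda>x. (b e x - c, x - (b e x - c) *s y)"])
      (use y s in \<open>auto simp: b_simps subspace_add subspace_scale subspace_diff\<close>)
  then show ?thesis using bij_betw_same_card by (fastforce simp: card_cartesian_product)
qed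

text \<open>The orthogonal sum of two isometries; \<open>p\<close> plays the projection onto A along
  C.\<close>

lemma glue:
  assumes V: "ndg V" and V': "subspace V'" "finite V'" "card V' = card V"
    and p: "\<And>x. x \<in> V \<Longrightarrow> p x \<in> A" "\<And>x. x \<in> V \<Longrightarrow> x - p x \<in> C"
      "\<And>x y. x \<in> V \<Longrightarrow> y \<in> V \<Longrightarrow> p (x + y) = p x + p y" "\<And>c x. x \<in> V \<Longrightarrow> p (c *s x) = c *s p x"
    and h: "isometry A A' h" "A' \<subseteq> V'" and k: "isometry C C' k" "C' \<subseteq> V'"
    and perp: "\<And>x y. x \<in> A \<Longrightarrow> y \<in> C \<Longrightarrow> b x y = 0" and perp': "\<And>x y. x \<in> A' \<Longrightarrow> y \<in> C' \<Longrightarrow> b x y = 0"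
  shows "isometry V V' (\<lambda>x. h (p x) + k (x - p x))"
proof (rule isoI[OF V V'(2,3)])
  fix x y assume xy: "x \<in> V" "y \<in> V"
  have "x + y - p (x + y) = (x - p x) + (y - p y)" using p xy by simp
  then show "h (p (x + y)) + k (x + y - p (x + y)) = h (p x) + k (x - p x) + (h (p y) + k (y - p y))"
    using xy p(1,2) p(3)[OF xy] isoD(1)[OF h(1) p(1,1)] isoD(1)[OF k(1) p(2,2)] by (simp only: ac_simps)
  have hk: "h (p z) \<in> A'" "k (z - p z) \<in> C'" if "z \<in> V" for z
    using isoD(4)[OF h(1)] isoD(4)[OF k(1)] p that by blast+
  have z: "b (h (p x)) (k (y - p y)) = 0" "b (k (x - p x)) (h (p y)) = 0"
    using hk xy perp' b_zero_swap by blast+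
  have z2: "b (p x) (y - p y) = 0" "b (x - p x) (p y) = 0"
    using perp p xy b_zero_swap by blast+
  have "b x y = b (p x + (x - p x)) (p y + (y - p y))" by simp
  also have "\<dots> = b (p x) (p y) + b (x - p x) (y - p y)" using z2 by (simp only: b_add b_add2) simp
  also have "\<dots> = b (h (p x)) (h (p y)) + b (k (x - p x)) (k (y - p y))"
    using isoD(5)[OF h(1)] isoD(5)[OF k(1)] p xy by simp
  finally show "b (h (p x) + k (x - p x)) (h (p y) + k (y - p y)) = b x y"
    using z by (simp only: b_add b_add2) simp
next
  fix c x assume x: "x \<in> V"
  have "c *s x - p (c *s x) = c *s (x - p x)" using p x by (simp add: scale_right_diff_distrib)
  then show "h (p (c *s x)) + k (c *s x - p (c *s x)) = c *s (h (p x) + k (x - p x))"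
    using x p isoD(2)[OF h(1)] isoD(2)[OF k(1)] by (simp add: scale_right_distrib)
next
  fix x assume "x \<in> V"
  then show "h (p x) + k (x - p x) \<in> V'"
    using isoD(4)[OF h(1)] isoD(4)[OF k(1)] p h(2) k(2) V'(1) by (meson subsetD subspace_add)
qed

end

subsection \<open>Squares in finite fields\<close>

text \<open>In characteristic 2 the map x -> x + 1 is an involution without fixed points and would
  split the field into pairs.\<close>

lemma two_nonzero:
  assumes "odd (card (UNIV :: 'a::{field,finite} set))" shows "(2::'a) \<noteq> 0"
proof
  assume z: "(2::'a) = 0"
  have fin: "finite (UNIV :: 'a set)" by simp
  \<comment> \<open>Stated for every set stable under adding 1, so that the induction can remove one
    pair at a time.\<close>
  have "even (card A)" if "A \<subseteq> UNIV" "\<And>x. x \<in> A \<Longrightarrow> x + 1 \<in> A" for A :: "'a set"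
  proof -
    have "finite A" by simp
    then show ?thesis using that(2)
    proof (induction A rule: finite_psubset_induct)
      case (psubset A)
      show ?case
      proof (cases "A = {}")
        case False
        then obtain x where x: "x \<in> A" by blast
        have ne: "x \<noteq> x + 1" by simp
        have xx: "(y + 1) + 1 = y" for y :: 'a using z by (simp add: add.assoc)
        have "even (card (A - {x, x + 1}))"
        proof (rule psubset.IH)
          show "A - {x, x + 1} \<subset> A" using x by blast
          fix y assume "y \<in> A - {x, x + 1}"
          then show "y + 1 \<in> A - {x, x + 1}" using psubset.prems[of y] xx[of x] xx[of y] by auto
        qed
        moreover have "card (A - {x, x + 1}) + 2 = card A"
          using x psubset.prems[of x] ne card_Diff_subset[of "{x, x+1}" A] card_mono[of A "{x, x + 1}"] by simp
        ultimately show ?thesis by (metis even_add even_numeral)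
      qed simp
    qed
  qed
  then show False using assms by blast
qed

lemma card_UNIV_gt_1: "1 < CARD('a::{field,finite})"
proof -
  have "card {0, 1 :: 'a} \<le> card (UNIV :: 'a set)" by (rule card_mono) auto
  then show ?thesis by simp
qed

text \<open>Every fibre of squaring on the nonzero elements is a pair {y, -y} of distinct
  elements.\<close>

lemma card_nonzero_squares:
  assumes "(2::'a::{field,finite}) \<noteq> 0"
  shows "2 * card ((\<lambda>x::'a. x\<^sup>2) ` (UNIV - {0})) = CARD('a) - 1"
proof -
  let ?T = "(\<lambda>x::'a. x\<^sup>2) ` (UNIV - {0})"
  have "card (UNIV - {0::'a}) = card (\<Union>s\<in>?T. {x. x\<^sup>2 = s})"
    by (rule arg_cong[where f = card]) auto
  also have "\<dots> = (\<Sum>s\<in>?T. card {x. x\<^sup>2 = s})"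
    by (rule card_UN_disjoint) auto
  also have "\<dots> = (\<Sum>s\<in>?T. 2)"
  proof (rule sum.cong)
    fix s assume "s \<in> ?T"
    then obtain y where y: "y \<noteq> 0" "s = y\<^sup>2" by blast
    then have "{x. x\<^sup>2 = s} = {y, - y}" by (auto simp: power2_eq_iff)
    moreover have "y \<noteq> - y" using y assms by (metis add_eq_0_iff mult_2 mult_eq_0_iff)
    ultimately show "card {x. x\<^sup>2 = s} = 2" by simp
  qed simp
  finally show ?thesis by (simp add: card_Diff_subset)
qed

lemma nonsquare_exists:
  assumes "(2::'a::{field,finite}) \<noteq> 0" obtains d :: "'a::{field,finite}" where "d \<noteq> 0" "\<And>x. x\<^sup>2 \<noteq> d"
proof -
  let ?T = "(\<lambda>x::'a. x\<^sup>2) ` (UNIV - {0})"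
  have "card ?T < card (UNIV - {0::'a})"
    using card_nonzero_squares[OF assms] card_UNIV_gt_1[where 'a = 'a] by (simp add: card_Diff_subset)
  then have "\<not> UNIV - {0} \<subseteq> ?T" by (meson card_mono finite leD)
  then obtain d where d: "d \<noteq> 0" "d \<notin> ?T" by blast
  have "x\<^sup>2 \<noteq> d" for x using d by (cases "x = 0") auto
  then show ?thesis using that d by blast
qed

text \<open>The nonzero squares and their multiples by the nonsquare d are disjoint sets of (q-1)/2
  elements each, so they exhaust the nonzero elements.\<close>

lemma nonsquare_ratio:
  fixes d e :: "'a::{field,finite}"
  assumes "(2::'a) \<noteq> 0" "d \<noteq> 0" "e \<noteq> 0" "\<And>x. x\<^sup>2 \<noteq> d" "\<And>x. x\<^sup>2 \<noteq> e"
  obtains t where "t \<noteq> 0" "e = d * t\<^sup>2"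
proof -
  let ?T = "(\<lambda>x::'a. x\<^sup>2) ` (UNIV - {0})"
  let ?D = "(\<lambda>t. d * t) ` ?T"
  have c: "card ?D = card ?T" using assms(2) by (intro card_image) (simp add: inj_on_def)
  have disj: "?T \<inter> ?D = {}"
  proof -
    have False if "x \<noteq> 0" "y \<noteq> 0" "x\<^sup>2 = d * y\<^sup>2" for x y :: 'a
      using that assms(4)[of "x / y"] by (simp add: power_divide)
    then show ?thesis by auto
  qed
  have "card (?T \<union> ?D) = card ?T + card ?D" using disj by (intro card_Un_disjoint) auto
  then have "card (?T \<union> ?D) = card (UNIV - {0::'a})"
    using c card_nonzero_squares[OF assms(1)] by (simp add: card_Diff_subset)
  moreover have "?T \<union> ?D \<subseteq> UNIV - {0}" using assms(2) by auto
  ultimately have "?T \<union> ?D = UNIV - {0}" by (intro card_subset_eq) auto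
  then have "e \<in> ?T \<union> ?D" using assms(3) by blast
  then show ?thesis using assms(5) that by auto
qed

text \<open>Pigeonhole: the values \<alpha> x^2 and the values c - \<beta> y^2 form two sets of
  (q+1)/2 elements in a field of q elements, so they meet.\<close>

lemma binary_form_represents:
  fixes \<alpha> \<beta> c :: "'a::{field,finite}"
  assumes "(2::'a) \<noteq> 0" "\<alpha> \<noteq> 0" "\<beta> \<noteq> 0"
  obtains x y where "\<alpha> * x\<^sup>2 + \<beta> * y\<^sup>2 = c"
proof -
  let ?S = "range (\<lambda>x::'a. x\<^sup>2)"
  let ?A = "(\<lambda>s. \<alpha> * s) ` ?S" and ?B = "(\<lambda>s. c - \<beta> * s) ` ?S"
  have "?S = insert 0 ((\<lambda>x::'a. x\<^sup>2) ` (UNIV - {0}))" by force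
  then have "card ?S = Suc (card ((\<lambda>x::'a. x\<^sup>2) ` (UNIV - {0})))"
    by (simp only: card_insert_if finite) auto
  then have S: "2 * card ?S = CARD('a) + 1"
    using card_nonzero_squares[OF assms(1)] card_UNIV_gt_1[where 'a = 'a] by linarith
  have "card ?A = card ?S" "card ?B = card ?S"
    using assms by (intro card_image; simp add: inj_on_def)+
  then have "\<not> card (?A \<union> ?B) = card ?A + card ?B"
    using S card_mono[of UNIV "?A \<union> ?B"] by simp
  then have "?A \<inter> ?B \<noteq> {}" using card_Un_disjoint[of ?A ?B] by auto
  then obtain x y where "\<alpha> * x\<^sup>2 = c - \<beta> * y\<^sup>2" by fast
  then show ?thesis using that[of x y] by simp
qed

subsection \<open>Involutive isometries\<close>

context eps_space begin

definition mneg :: "'v set \<Rightarrow> ('v \<Rightarrow> 'v) \<Rightarrow> 'v set" where "mneg V g = {x \<in> V. g x = - x}"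
definition mfix :: "'v set \<Rightarrow> ('v \<Rightarrow> 'v) \<Rightarrow> 'v set" where "mfix V g = {x \<in> V. g x = x}"

text \<open>Passing from g to -g exchanges the eigenspaces; facts about fixed spaces are obtained
  this way from facts about -1-eigenspaces.\<close>

lemma mfix_mneg: "mfix V g = mneg V (\<lambda>x. - g x)"
  by (auto simp: mfix_def mneg_def)

lemma iso_uminus: assumes "isometry V V' g" "subspace V'" shows "isometry V V' (\<lambda>x. - g x)"
proof -
  have "uminus ` V' = V'"
  proof (intro equalityI subsetI)
    show "x \<in> uminus ` V'" if "x \<in> V'" for x
      using subspace_neg[OF assms(2) that] by (metis image_eqI minus_minus)
  qed (use subspace_neg[OF assms(2)] in auto)
  then have "(\<lambda>x. - g x) ` V = V'" using isoD(3)[OF assms(1)] by (metis image_image)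
  then show ?thesis using isoD[OF assms(1)] by (simp add: isometry_def)
qed

lemma subspace_mneg: assumes "isometry V V g" "subspace V" shows "subspace (mneg V g)"
  using assms isoD[OF assms(1)] unfolding mneg_def
  by (intro subspaceI) (auto simp: subspace_0 subspace_add subspace_scale iso_zero)

lemma two_cancel: "x = - x \<Longrightarrow> x = (0 :: 'v)"
  using half_double[of x] by (metis add.right_inverse scale_zero_right)

lemma two_cancel_F: "x = - x \<Longrightarrow> x = (0 :: 'a)"
  using two by (metis add_eq_0_iff mult_2 mult_eq_0_iff)

text \<open>Applying g to both arguments changes the sign of \<open>b x y\<close> and preserves its
  value.\<close>

lemma mneg_perp_mfix:
  assumes "isometry V V g" "x \<in> mneg V g" "y \<in> mfix V g" shows "b x y = 0"
  using assms isoD(5)[OF assms(1), of x y] two_cancel_F[of "b x y"] by (auto simp: mneg_def mfix_def)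

text \<open>The idempotent (1 - g)/2, which projects onto the -1-eigenspace when g is an
  involution.\<close>

definition nproj :: "('v \<Rightarrow> 'v) \<Rightarrow> 'v \<Rightarrow> 'v" where "nproj g x = (1/2) *s (x - g x)"

lemma nproj:
  assumes "isometry V V g" "subspace V" "\<forall>x\<in>V. g (g x) = x" "x \<in> V"
  shows "nproj g x \<in> mneg V g" "x - nproj g x \<in> mfix V g"
proof -
  have gx: "g x \<in> V" using isoD(4)[OF assms(1,4)] .
  show "nproj g x \<in> mneg V g" unfolding mneg_def nproj_def
    using gx assms isoD(2)[OF assms(1), of "x - g x" "1/2"] iso_diff[OF assms(1,2,4) gx]
    by (simp add: subspace_diff subspace_scale algebra_simps)
  have "x - nproj g x = (1/2) *s (x + x) - (1/2) *s (x - g x)"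
    by (simp add: half_double nproj_def)
  also have "\<dots> = (1/2) *s (x + g x)" by (simp flip: scale_right_diff_distrib)
  finally have e: "x - nproj g x = (1/2) *s (x + g x)" .
  show "x - nproj g x \<in> mfix V g" unfolding e mfix_def
    using gx assms isoD(2)[OF assms(1), of "x + g x" "1/2"] isoD(1)[OF assms(1,4) gx]
    by (simp add: subspace_add subspace_scale add.commute)
qed

lemma nproj_add: "isometry V V g \<Longrightarrow> x \<in> V \<Longrightarrow> y \<in> V \<Longrightarrow> nproj g (x + y) = nproj g x + nproj g y"
  by (simp add: nproj_def isoD algebra_simps)

lemma nproj_scale: "isometry V V g \<Longrightarrow> x \<in> V \<Longrightarrow> nproj g (c *s x) = c *s nproj g x"
  by (simp add: nproj_def isoD algebra_simps)

lemma ndg_mneg: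
  assumes "isometry V V g" "ndg V" "\<forall>x\<in>V. g (g x) = x" shows "ndg (mneg V g)"
  unfolding ndg_def
proof (intro conjI ballI impI)
  show "subspace (mneg V g)" using subspace_mneg assms ndgD by blast
  show "finite (mneg V g)" using assms ndgD by (auto simp: mneg_def)
  fix x assume x: "x \<in> mneg V g" "\<forall>y\<in>mneg V g. b x y = 0"
  show "x = 0"
  proof (rule ndg_zeroI[OF assms(2)])
    show "x \<in> V" using x by (simp add: mneg_def)
    fix y assume y: "y \<in> V"
    note p = nproj[OF assms(1) ndgD(1)[OF assms(2)] assms(3) y]
    have "b x y = b x (nproj g y) + b x (y - nproj g y)" by (simp flip: b_add2)
    then show "b x y = 0" using x p mneg_perp_mfix[OF assms(1) x(1) p(2)] by simp
  qed
qed

lemma ndg_mfix: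
  assumes "isometry V V g" "ndg V" "\<forall>x\<in>V. g (g x) = x" shows "ndg (mfix V g)"
  unfolding mfix_mneg
proof (rule ndg_mneg[OF iso_uminus[OF assms(1) ndgD(1)[OF assms(2)]] assms(2)])
  show "\<forall>x\<in>V. - g (- g x) = x"
    using assms iso_neg[OF assms(1)] isoD(4)[OF assms(1)] by simp
qed

lemma card_mneg_mfix:
  assumes "isometry V V g" "ndg V" "\<forall>x\<in>V. g (g x) = x"
  shows "card V = card (mneg V g) * card (mfix V g)"
proof -
  note s = ndgD(1)[OF assms(2)]
  have "bij_betw (\<lambda>(x, y). x + y) (mneg V g \<times> mfix V g) V"
  proof (rule bij_betw_byWitness[where f' = "\<lambda>x. (nproj g x, x - nproj g x)"])
    show "\<forall>a\<in>mneg V g \<times> mfix V g. (nproj g ((\<lambda>(x, y). x + y) a), (\<lambda>(x, y). x + y) a - nproj g ((\<lambda>(x, y). x + y) a)) = a"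
    proof clarify
      fix x y assume "x \<in> mneg V g" "y \<in> mfix V g"
      then have "nproj g (x + y) = x"
        using nproj_add[OF assms(1), of x y] half_double by (auto simp: mneg_def mfix_def nproj_def)
      then show "nproj g (x + y) = x \<and> x + y - nproj g (x + y) = y" by simp
    qed
    show "\<forall>a'\<in>V. (\<lambda>(x, y). x + y) (nproj g a', a' - nproj g a') = a'" by simp
    show "(\<lambda>(x, y). x + y) ` (mneg V g \<times> mfix V g) \<subseteq> V"
      using s by (auto simp: mneg_def mfix_def subspace_add)
    show "(\<lambda>x. (nproj g x, x - nproj g x)) ` V \<subseteq> mneg V g \<times> mfix V g"
      using nproj[OF assms(1) s assms(3)] by auto
  qed
  then show ?thesis using bij_betw_same_card by (fastforce simp: card_cartesian_product)
qed

text \<open>Conjugating an involution reduces to matching its two eigenspaces separately: they are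
  orthogonal, so isometries between them glue, and the glued map commutes with the sign
  changes.\<close>

lemma iso_intertwine:
  assumes V: "ndg V" and V': "ndg V'" "card V' = card V"
    and g: "isometry V V g" "\<forall>x\<in>V. g (g x) = x"
    and h: "isometry (mneg V g) (mneg V' g') h" and k: "isometry (mfix V g) (mfix V' g') k"
    and g': "isometry V' V' g'"
  obtains H where "isometry V V' H" "\<And>x. x \<in> V \<Longrightarrow> H (g x) = g' (H x)"
    "\<And>x. x \<in> mneg V g \<Longrightarrow> H x = h x" "\<And>x. x \<in> mfix V g \<Longrightarrow> H x = k x"
proof -
  let ?H = "\<lambda>x. h (nproj g x) + k (x - nproj g x)"
  note s = ndgD(1)[OF V]
  note p = nproj[OF g(1) s g(2)]
  have iH: "isometry V V' ?H"
    by (rule glue[OF V ndgD(1)[OF V'(1)] ndgD(2)[OF V'(1)] V'(2) p nproj_add[OF g(1)] nproj_scale[OF g(1)] h _ k])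
      (use mneg_perp_mfix[OF g(1)] mneg_perp_mfix[OF g'] in \<open>auto simp: mneg_def mfix_def\<close>)
  have H1: "?H x = h x" if "x \<in> mneg V g" for x
  proof -
    have "nproj g x = x" using that half_double by (simp add: nproj_def mneg_def)
    moreover have "k 0 = 0" using iso_zero[OF k] ndg_mfix[OF g(1) V g(2)] ndgD by blast
    ultimately show ?thesis by simp
  qed
  have H2: "?H x = k x" if "x \<in> mfix V g" for x
  proof -
    have "nproj g x = 0" using that by (simp add: nproj_def mfix_def)
    moreover have "h 0 = 0" using iso_zero[OF h] ndg_mneg[OF g(1) V g(2)] ndgD by blast
    ultimately show ?thesis by simp
  qed
  have "?H (g x) = g' (?H x)" if x: "x \<in> V" for x
  proof -
    let ?p = "nproj g x"
    have pV: "?p \<in> V" "x - ?p \<in> V" using p[OF x] by (auto simp: mneg_def mfix_def)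
    have hk: "?H ?p \<in> V'" "?H (x - ?p) \<in> V'" using isoD(4)[OF iH] pV by blast+
    have hn: "g' (?H ?p) = - ?H ?p"
      using H1[OF p(1)[OF x]] isoD(4)[OF h p(1)[OF x]] by (simp add: mneg_def)
    have kn: "g' (?H (x - ?p)) = ?H (x - ?p)"
      using H2[OF p(2)[OF x]] isoD(4)[OF k p(2)[OF x]] by (simp add: mfix_def)
    have gp: "g ?p = - ?p" "g (x - ?p) = x - ?p" using p[OF x] by (auto simp: mneg_def mfix_def)
    have "g x = g (?p + (x - ?p))" by simp
    also have "\<dots> = - ?p + (x - ?p)"
      using isoD(1)[OF g(1) pV] gp by (simp only:)
    finally have "?H (g x) = ?H (- ?p + (x - ?p))" by simp
    also have "\<dots> = - ?H ?p + ?H (x - ?p)"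
      using isoD(1)[OF iH subspace_neg[OF s pV(1)] pV(2)] iso_neg[OF iH pV(1)] by simp
    also have "\<dots> = g' (?H ?p + ?H (x - ?p))"
      using isoD(1)[OF g' hk] hn kn by simp
    also have "?H ?p + ?H (x - ?p) = ?H (?p + (x - ?p))"
      using isoD(1)[OF iH pV] by simp
    finally show ?thesis by simp
  qed
  then show ?thesis using that iH H1 H2 by blast
qed

lemma iso_eqI_hyp:
  assumes "isometry V V' g" "isometry V V' h" "hyp V e f" "subspace V" "g e = h e" "g f = h f"
    "\<And>w. w \<in> perp2 V e f \<Longrightarrow> g w = h w" "x \<in> V"
  shows "g x = h x"
  using iso_hext_eq[OF assms(1,3,4,8)] iso_hext_eq[OF assms(2,3,4,8)] assms(5-7) hproj_in[OF assms(3,4,8)]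
  by (simp add: hext_def)

end

subsection \<open>Symplectic spaces\<close>

locale symp_space = eps_space scale b "-1" for scale :: "'a::{field,finite} \<Rightarrow> 'v::ab_group_add \<Rightarrow> 'v" (infixr "*s" 75) and b
begin

text \<open>Skew symmetry gives an alternating form because 2 is invertible; hence every vector is
  isotropic and can start a hyperbolic pair.\<close>

lemma b_self [simp]: "b x x = 0"
  using b_swap[of x x] two_cancel_F by (metis mult_minus1)

lemma ex_hyp:
  assumes "ndg V" "e \<in> V" "e \<noteq> 0" obtains f where "hyp V e f"
  using ndg_ex_partner[OF assms] assms that by (auto simp: hyp_def)

lemma card_perp2_less:
  assumes "ndg V" "hyp V e f" shows "card (perp2 V e f) < card V"
proof -
  have "e \<notin> perp2 V e f" using hypD[OF assms(2)] by (simp add: perp2_def)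
  then have "perp2 V e f \<subset> V" using hypD(1)[OF assms(2)] by (auto simp: perp2_def)
  then show ?thesis using ndgD(2)[OF assms(1)] psubset_card_mono by blast
qed

lemma card_ndg: assumes "ndg V" obtains k where "card V = CARD('a) ^ (2 * k)"
  using assms
proof (induction "card V" arbitrary: V thesis rule: less_induct)
  case less
  show ?case
  proof (cases "V = {0}")
    case True then show ?thesis using less(2)[of 0] by simp
  next
    case False
    then obtain e where "e \<in> V" "e \<noteq> 0" using less(3) ndgD subspace_0 by blast
    then obtain f where h: "hyp V e f" using ex_hyp less(3) by blast
    obtain k where "card (perp2 V e f) = CARD('a) ^ (2 * k)"
      using less(1)[OF card_perp2_less[OF less(3) h] _ ndg_perp2[OF less(3) h]] by blast
    then show ?thesis using card_hyp[OF ndgD(1)[OF less(3)] h] less(2)[of "Suc k"] by simp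
  qed
qed

lemma card_1_zero: assumes "ndg V" "card V = 1" shows "V = {0}"
  using assms subspace_0[OF ndgD(1)[OF assms(1)]] by (metis card_1_singletonE singletonD)

lemma ex_hyp_card:
  assumes "ndg V" "card V = CARD('a) ^ (2 * Suc k)"
  obtains e f where "hyp V e f" "card (perp2 V e f) = CARD('a) ^ (2 * k)"
proof -
  have "V \<noteq> {0}"
  proof
    assume "V = {0}"
    then have "CARD('a) ^ (2 * Suc k) = 1" using assms(2) by simp
    then show False
      using one_less_power[OF card_UNIV_gt_1[where 'a = 'a], of "2 * Suc k"] by simp
  qed
  then obtain e where "e \<in> V" "e \<noteq> 0"
    using subspace_0[OF ndgD(1)[OF assms(1)]] by blast
  then obtain f where h: "hyp V e f" using ex_hyp assms by blast
  then have "card (perp2 V e f) = CARD('a) ^ (2 * k)"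
    using card_hyp[OF ndgD(1)[OF assms(1)] h] assms(2) card_UNIV_gt_1[where 'a = 'a] by simp
  then show ?thesis using that h by blast
qed

lemma card_perp2:
  assumes "ndg V" "card V = CARD('a) ^ (2 * Suc k)" "hyp V e f"
  shows "card (perp2 V e f) = CARD('a) ^ (2 * k)"
  using card_hyp[OF ndgD(1)[OF assms(1)] assms(3)] assms(2) card_UNIV_gt_1[where 'a = 'a] by simp

text \<open>For e any nonzero vector is allowed, and f then ranges over the affine hyperplane
  \<open>b e f = 1\<close>.\<close>

lemma card_hyps:
  assumes "ndg V" "card V = CARD('a) ^ (2 * Suc k)"
  shows "card (hyps V) = (CARD('a) ^ (2 * k + 2) - 1) * CARD('a) ^ (2 * k + 1)"
proof -
  have "hyps V = (SIGMA e:V - {0}. {f \<in> V. b e f = 1})"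
    by (auto simp: hyps_def hyp_def)
  then have "card (hyps V) = (\<Sum>e\<in>V - {0}. card {f \<in> V. b e f = 1})"
    using ndgD(2)[OF assms(1)] by (simp add: card_SigmaI)
  also have "\<dots> = (\<Sum>e\<in>V - {0}. CARD('a) ^ (2 * k + 1))"
  proof (rule sum.cong)
    fix e assume "e \<in> V - {0}"
    then have "CARD('a) * card {f \<in> V. b e f = 1} = CARD('a) * CARD('a) ^ (2 * k + 1)"
      using card_level[OF assms(1), of e 1] assms(2) by simp
    then show "card {f \<in> V. b e f = 1} = CARD('a) ^ (2 * k + 1)"
      using card_UNIV_gt_1[where 'a = 'a] by simp
  qed simp
  also have "\<dots> = (CARD('a) ^ (2 * k + 2) - 1) * CARD('a) ^ (2 * k + 1)"
    using assms subspace_0[OF ndgD(1)[OF assms(1)]] by (simp add: card_Diff_subset)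
  finally show ?thesis .
qed

theorem card_isos:
  assumes "ndg V" "ndg V'" "card V = CARD('a) ^ (2 * k)" "card V' = CARD('a) ^ (2 * k)"
  shows "card (isometries V V') = (\<Prod>i<k. (CARD('a) ^ (2 * i + 2) - 1) * CARD('a) ^ (2 * i + 1))"
  using assms
proof (induction k arbitrary: V V')
  case 0
  then have V: "V = {0}" "V' = {0}" using card_1_zero by auto
  have "isometries V V' = {\<lambda>x\<in>{0}. 0}"
    unfolding V isometries_def by (auto simp: isometry_def fun_eq_iff extensional_def)
  then show ?case by simp
next
  case (Suc k)
  obtain e f where ef: "hyp V e f" "card (perp2 V e f) = CARD('a) ^ (2 * k)"
    using ex_hyp_card[OF Suc(2,4)] by blast
  let ?n = "\<Prod>i<k. (CARD('a) ^ (2 * i + 2) - 1) * CARD('a) ^ (2 * i + 1)"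
  have "card (isometries V V') = card (hyps V') * ?n"
  proof (rule card_isos_step[OF Suc(2) ef(1) Suc(3)])
    fix e' f' assume h: "hyp V' e' f'"
    show "card (isometries (perp2 V e f) (perp2 V' e' f')) = ?n"
      by (rule Suc.IH[OF ndg_perp2[OF Suc(2) ef(1)] ndg_perp2[OF Suc(3) h] ef(2) card_perp2[OF Suc(3,5) h]])
  qed
  then show ?case using card_hyps[OF Suc(3,5)] by simp
qed

text \<open>All factors in the count of isometries are positive, so the set of isometries is not
  empty.\<close>

lemma iso_exists:
  assumes "ndg V" "ndg V'" "card V' = card V" obtains h where "isometry V V' h"
proof -
  obtain k where k: "card V = CARD('a) ^ (2 * k)" using card_ndg[OF assms(1)] .
  have "(CARD('a) ^ (2 * i + 2) - 1) * CARD('a) ^ (2 * i + 1) \<noteq> 0" for i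
    using one_less_power[OF card_UNIV_gt_1[where 'a = 'a], of "2 * i + 2"] by simp
  then have "card (isometries V V') \<noteq> 0"
    unfolding card_isos[OF assms(1,2) k k[folded assms(3)]] by simp
  then have "isometries V V' \<noteq> {}" by auto
  then show ?thesis using that by (auto simp: isometries_def)
qed

lemma conj_involutions:
  assumes "ndg V" and g: "isometry V V g" "\<forall>x\<in>V. g (g x) = x"
    and g': "isometry V V g'" "\<forall>x\<in>V. g' (g' x) = x"
    and c: "card (mneg V g') = card (mneg V g)"
  obtains h where "isometry V V h" "\<And>x. x \<in> V \<Longrightarrow> h (g x) = g' (h x)"
proof -
  note n = ndg_mneg[OF g(1) assms(1) g(2)] ndg_mneg[OF g'(1) assms(1) g'(2)]
  note m = ndg_mfix[OF g(1) assms(1) g(2)] ndg_mfix[OF g'(1) assms(1) g'(2)]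
  have "card (mneg V g) \<noteq> 0" using ndgD(2)[OF n(1)] subspace_0[OF ndgD(1)[OF n(1)]] by auto
  then have "card (mfix V g') = card (mfix V g)"
    using card_mneg_mfix[OF g(1) assms(1) g(2)] card_mneg_mfix[OF g'(1) assms(1) g'(2)] c by simp
  then obtain h k where hk: "isometry (mneg V g) (mneg V g') h" "isometry (mfix V g) (mfix V g') k"
    using iso_exists n m c by metis
  show ?thesis
    by (rule iso_intertwine[OF assms(1,1) refl g hk g'(1)]) (rule that)
qed

text \<open>If (e, f) is hyperbolic then so is (-e, -f) with the same complement, so k hyperbolic
  planes can be negated one after the other.\<close>

lemma ex_involution:
  assumes "ndg V" "card V = CARD('a) ^ (2 * r)" "k \<le> r"
  obtains g where "isometry V V g" "\<forall>x\<in>V. g (g x) = x" "card (mneg V g) = CARD('a) ^ (2 * k)"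
  using assms
proof (induction k arbitrary: V r thesis)
  case 0
  have "mneg V (\<lambda>x. x) = {0}" using two_cancel subspace_0[OF ndgD(1)[OF 0(2)]] by (auto simp: mneg_def)
  then show ?case using 0(1)[of "\<lambda>x. x"] by (simp add: iso_ident)
next
  case (Suc k)
  obtain r' where r: "r = Suc r'" using Suc(5) by (cases r) auto
  obtain e f where ef: "hyp V e f" "card (perp2 V e f) = CARD('a) ^ (2 * r')"
    using ex_hyp_card Suc(3,4) r by blast
  let ?W = "perp2 V e f"
  obtain g where g: "isometry ?W ?W g" "\<forall>x\<in>?W. g (g x) = x" "card (mneg ?W g) = CARD('a) ^ (2 * k)"
    using Suc.IH[OF _ ndg_perp2[OF Suc(3) ef(1)] ef(2)] Suc(5) r by auto
  note s = ndgD(1)[OF Suc(3)]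
  have h': "hyp V (- e) (- f)" using ef(1) s by (auto simp: hyp_def subspace_neg)
  have W': "perp2 V (- e) (- f) = ?W" by (auto simp: perp2_def)
  let ?G = "hext e f (- e) (- f) g"
  note hs = hext_simps[OF ef(1) s g(1), where e' = "- e" and f' = "- f"]
  have iG: "isometry V V ?G" by (rule iso_hext[OF Suc(3) s ef(1) h']) (simp add: W' g(1))
  have GG: "\<forall>x\<in>V. ?G (?G x) = x"
  proof (intro ballI, rule iso_eqI_hyp[OF iso_comp[OF iG iG] iso_ident(1) ef(1) s])
    show "?G (?G e) = e" "?G (?G f) = f"
      using iso_neg[OF iG] hs(1,2) hypD[OF ef(1)] by simp_all
    show "?G (?G w) = w" if "w \<in> ?W" for w
      using hs(3) that isoD(4)[OF g(1) that] g(2) by simp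
  qed
  have m: "hyp (mneg V ?G) e f" using ef(1) hs by (auto simp: hyp_def mneg_def)
  have "perp2 (mneg V ?G) e f = mneg ?W g" using hs(3) by (auto simp: mneg_def perp2_def)
  then have "card (mneg V ?G) = CARD('a) ^ (2 * Suc k)"
    using card_hyp[OF subspace_mneg[OF iG s] m] g(3) by simp
  then show ?case using Suc(2) iG GG by blast
qed

text \<open>For an alternating form (f, -e) is again a hyperbolic pair, so e -> f -> -e is an
  isometry of the plane with square -1.\<close>

lemma ex_complex_structure:
  assumes "ndg V" obtains g where "isometry V V g" "\<forall>x\<in>V. g (g x) = - x"
  using assms
proof (induction "card V" arbitrary: V thesis rule: less_induct)
  case less
  show ?case
  proof (cases "V = {0}")
    case True then show ?thesis using less(2)[of "\<lambda>x. x"] iso_ident by simp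
  next
    case False
    then obtain e where "e \<in> V" "e \<noteq> 0" using less(3) ndgD subspace_0 by blast
    then obtain f where h: "hyp V e f" using ex_hyp less(3) by blast
    let ?W = "perp2 V e f"
    obtain g where g: "isometry ?W ?W g" "\<forall>x\<in>?W. g (g x) = - x"
      using less(1)[OF card_perp2_less[OF less(3) h] _ ndg_perp2[OF less(3) h]] by blast
    note s = ndgD(1)[OF less(3)]
    have h': "hyp V f (- e)" using h s hypD[OF h] by (auto simp: hyp_def subspace_neg)
    have W': "perp2 V f (- e) = ?W" by (auto simp: perp2_def)
    let ?G = "hext e f f (- e) g"
    note hs = hext_simps[OF h s g(1), where e' = "f" and f' = "- e"]
    have iG: "isometry V V ?G" by (rule iso_hext[OF less(3) s h h']) (simp add: W' g(1))
    have "\<forall>x\<in>V. ?G (?G x) = - x"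
    proof (intro ballI, rule iso_eqI_hyp[OF iso_comp[OF iG iG] iso_uminus[OF iso_ident(1) s] h s])
      show "?G (?G e) = - e" "?G (?G f) = - f"
        using iso_neg[OF iG] hs(1,2) hypD[OF h] by simp_all
      show "?G (?G w) = - w" if "w \<in> ?W" for w
        using hs(3) that isoD(4)[OF g(1) that] g(2) by simp
    qed
    then show ?thesis using less(2) iG by blast
  qed
qed

text \<open>Because g^2 = -1, the bilinear form \<open>b x (g y)\<close> is symmetric. It is
  nonzero, so it has a nonzero value on its diagonal; the binary form on the span of v and g v can
  then be normalized to take the value 1.\<close>

lemma ex_complex_hyp:
  assumes "ndg V" "V \<noteq> {0}" and g: "isometry V V g" "\<forall>x\<in>V. g (g x) = - x"
  obtains v where "hyp V v (g v)"
proof -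
  note s = ndgD(1)[OF assms(1)]
  have "\<exists>v\<in>V. b v (g v) \<noteq> 0"
  proof (rule ccontr)
    assume "\<not> ?thesis"
    then have z: "b v (g v) = 0" if "v \<in> V" for v using that by blast
    \<comment> \<open>Polarization: a symmetric form that vanishes on the diagonal vanishes
      identically, which contradicts nondegeneracy since g is onto.\<close>
    have "b x (g y) = 0" if x: "x \<in> V" and y: "y \<in> V" for x y
    proof -
      have gy: "g y \<in> V" using isoD(4)[OF g(1) y] .
      have "b y (g x) = b (g y) (g (g x))" using isoD(5)[OF g(1) y isoD(4)[OF g(1) x]] by simp
      also have "\<dots> = b x (g y)" using bspec[OF g(2) x] b_swap[of "g y" x] by simp
      finally have sym: "b y (g x) = b x (g y)" .
      have "0 = b (x + y) (g (x + y))" using z subspace_add[OF s x y] by simp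
      also have "\<dots> = b x (g y) + b x (g y)"
        using isoD(1)[OF g(1) x y] z[OF x] z[OF y] sym by (simp add: b_simps)
      finally show ?thesis using two_cancel_F[of "b x (g y)"] by (simp add: eq_neg_iff_add_eq_0)
    qed
    then have "b x y = 0" if "x \<in> V" "y \<in> V" for x y
      using that isoD(3)[OF g(1)] by (metis imageE)
    then have "x = 0" if "x \<in> V" for x using ndg_zeroI[OF assms(1) that] that by blast
    then show False using assms(2) subspace_0[OF s] by blast
  qed
  then obtain v where v: "v \<in> V" "b v (g v) \<noteq> 0" by blast
  have gv: "g v \<in> V" using isoD(4)[OF g(1) v(1)] .
  \<comment> \<open>On s v + t g v the form \<open>b w (g w)\<close> takes the value
    \<open>b v (g v)\<close> times s^2 + t^2, and such a binary form represents 1 over a finite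
    field.\<close>
  obtain s1 t1 where st: "b v (g v) * s1\<^sup>2 + b v (g v) * t1\<^sup>2 = 1"
    using binary_form_represents[OF two v(2) v(2)] by blast
  let ?w = "s1 *s v + t1 *s g v"
  have w: "?w \<in> V" using v gv s by (simp add: subspace_add subspace_scale)
  have gw: "g ?w = s1 *s g v + t1 *s (- v)"
    using isoD(1)[OF g(1) subspace_scale[OF s v(1)] subspace_scale[OF s gv]] isoD(2)[OF g(1)] v(1) gv bspec[OF g(2) v(1)]
    by simp
  have "b ?w (g ?w) = 1" unfolding gw using st b_swap[of "g v" v]
    by (simp add: b_simps power2_eq_square algebra_simps)
  then have "hyp V ?w (g ?w)" using w isoD(4)[OF g(1) w] by (simp add: hyp_def)
  then show ?thesis using that by blast
qed

text \<open>The plane spanned by v and g v is stable under g, and so is its complement; matching (v,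
  g v) with (v', g' v') intertwines on the planes, and induction handles the complements.\<close>

lemma conj_complex:
  assumes "ndg V" "ndg V'" "card V' = card V"
    and g: "isometry V V g" "\<forall>x\<in>V. g (g x) = - x"
    and g': "isometry V' V' g'" "\<forall>x\<in>V'. g' (g' x) = - x"
  obtains h where "isometry V V' h" "\<And>x. x \<in> V \<Longrightarrow> h (g x) = g' (h x)"
  using assms
proof (induction "card V" arbitrary: V V' thesis rule: less_induct)
  case less
  note s = ndgD(1)[OF less(3)] and s' = ndgD(1)[OF less(4)]
  show ?case
  proof (cases "V = {0}")
    case True
    then have V': "V' = {0}" using card_1_zero[OF less(4)] less(5) by simp
    show ?thesis
      using less(2)[of "\<lambda>x. x"] iso_ident iso_zero[OF less(6) s] iso_zero[OF less(8) s'] True V' by simp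
  next
    case False
    then have False': "V' \<noteq> {0}" using card_1_zero[OF less(3)] less(5) by auto
    obtain v where h: "hyp V v (g v)" using ex_complex_hyp[OF less(3) False less(6,7)] by blast
    obtain v' where h': "hyp V' v' (g' v')" using ex_complex_hyp[OF less(4) False' less(8,9)] by blast
    let ?W = "perp2 V v (g v)" and ?W' = "perp2 V' v' (g' v')"
    have "perp2 V (g v) (g (g v)) = ?W" using bspec[OF less(7) hypD(1)[OF h]] by (auto simp: perp2_def)
    then have gW: "isometry ?W ?W g" using iso_perp2[OF less(6) hypD(1,2)[OF h]] by simp
    have "perp2 V' (g' v') (g' (g' v')) = ?W'" using bspec[OF less(9) hypD(1)[OF h']] by (auto simp: perp2_def)
    then have gW': "isometry ?W' ?W' g'" using iso_perp2[OF less(8) hypD(1,2)[OF h']] by simp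
    have c: "card ?W' = card ?W"
      using card_hyp[OF s h] card_hyp[OF s' h'] less(5) card_UNIV_gt_1[where 'a = 'a] by simp
    obtain k where k: "isometry ?W ?W' k" "\<And>x. x \<in> ?W \<Longrightarrow> k (g x) = g' (k x)"
    proof (rule less(1)[OF card_perp2_less[OF less(3) h] _ ndg_perp2[OF less(3) h] ndg_perp2[OF less(4) h'] c gW _ gW'])
      show "\<forall>x\<in>?W. g (g x) = - x" "\<forall>x\<in>?W'. g' (g' x) = - x"
        using less(7,9) by (auto simp: perp2_def)
    qed blast
    let ?H = "hext v (g v) v' (g' v') k"
    note hs = hext_simps[OF h s k(1), where e' = v' and f' = "g' v'"]
    have iH: "isometry V V' ?H" by (rule iso_hext[OF less(3) s' h h' k(1)])
    have "?H (g x) = g' (?H x)" if "x \<in> V" for x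
    proof (rule iso_eqI_hyp[OF iso_comp[OF less(6) iH] iso_comp[OF iH less(8)] h s _ _ _ that])
      show "?H (g v) = g' (?H v)" using hs by simp
      show "?H (g (g v)) = g' (?H (g v))"
        using hs bspec[OF less(7) hypD(1)[OF h]] bspec[OF less(9) hypD(1)[OF h']] iso_neg[OF iH hypD(1)[OF h]] by simp
      show "?H (g w) = g' (?H w)" if "w \<in> ?W" for w
        using hs(3) isoD(4)[OF gW] k(2) that by simp
    qed
    then show ?thesis using less(2) iH by blast
  qed
qed

section \<open>Transvections and central isometries\<close>

lemma iso_transvection:
  assumes "ndg V" "u \<in> V" shows "isometry V V (\<lambda>x. x + b x u *s u)"
proof (rule isoI[OF assms(1) ndgD(2)[OF assms(1)] refl])
  show "b (x + b x u *s u) (y + b y u *s u) = b x y" for x y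
    using b_swap[of u y] by (simp add: b_simps)
qed (use assms ndgD(1)[OF assms(1)] in \<open>auto simp: b_simps algebra_simps subspace_add subspace_scale\<close>)

text \<open>A vector on which \<open>z\<close> commutes with its transvection is an eigenvector of \<open>z\<close>.\<close>

lemma central_isometry:
  assumes "ndg V" and z: "isometry V V z"
    and comm: "\<And>g x. isometry V V g \<Longrightarrow> x \<in> V \<Longrightarrow> z (g x) = g (z x)"
  shows "(\<forall>x\<in>V. z x = x) \<or> (\<forall>x\<in>V. z x = - x)"
proof -
  note s = ndgD(1)[OF assms(1)]
  have pm: "z u = u \<or> z u = - u" if u: "u \<in> V" for u
  proof (cases "u = 0")
    case False
    then obtain x where x: "x \<in> V" "b u x = 1" using ndg_ex_partner[OF assms(1) u] by blast
    have eig: "b y u *s z u = b (z y) u *s u" if "y \<in> V" for y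
    proof -
      have "z (y + b y u *s u) = z y + b (z y) u *s u"
        using comm[OF iso_transvection[OF assms(1) u] that] .
      then show ?thesis using isoD(1,2)[OF z] that u s by (simp add: subspace_scale)
    qed
    have xu: "b x u = - 1" using x b_swap[of x u] by simp
    define c where "c = - b (z x) u"
    have zu: "z u = c *s u" using eig[OF x(1)] xu unfolding c_def
      by (metis minus_minus scale_minus_left scale_one)
    have "b (z x) (z u) = b x u" using isoD(5)[OF z x(1) u] .
    \<comment> \<open>Here \<open>b (z x) u = - c\<close> by definition and
      \<open>z u = c *s u\<close>, while \<open>b x u = - 1\<close>.\<close>
    then have "c * c = 1" using xu zu unfolding c_def by (simp add: b_simps) 
    then have "c = 1 \<or> c = - 1" by (metis square_eq_1_iff)
    then show ?thesis using zu by auto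
  qed (use iso_zero[OF z s] in simp)
  show ?thesis
  \<comment> \<open>The sign cannot depend on the vector: if x is negated and y is fixed, then z (x
    + y) = -x + y is neither x + y nor its negative.\<close>
  proof (rule ccontr)
    assume "\<not> ?thesis"
    then obtain x y where xy: "x \<in> V" "z x \<noteq> x" "y \<in> V" "z y \<noteq> - y" by blast
    then have zx: "z x = - x" "z y = y" using pm by blast+
    have "z (x + y) = - x + y" using isoD(1)[OF z] xy zx by simp
    then have "- x + y = x + y \<or> - x + y = - (x + y)" using pm[OF subspace_add[OF s xy(1,3)]] by metis
    then show False using two_cancel[of x] two_cancel[of y] xy zx by auto
  qed
qed

end

subsection \<open>Orthogonal spaces\<close>

locale orth_space = eps_space scale b 1 for scale :: "'a::{field,finite} \<Rightarrow> 'v::ab_group_add \<Rightarrow> 'v" (infixr "*s" 75) and b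
begin

definition Q :: "'v \<Rightarrow> 'a" where "Q x = b x x / 2"

lemma b_sym: "b x y = b y x"
  using b_swap[of x y] by (metis mult_1)

lemma b_self: "b x x = 2 * Q x"
  using two by (simp add: Q_def)

lemma Q_add: "Q (x + y) = Q x + Q y + b x y"
  using two b_sym[of y x] by (simp add: Q_def b_simps field_simps)

lemma Q_scale: "Q (c *s x) = c\<^sup>2 * Q x"
  by (simp add: Q_def b_simps power2_eq_square)

lemma Q_0 [simp]: "Q 0 = 0" by (simp add: Q_def)

lemma Q_minus [simp]: "Q (- x) = Q x" by (simp add: Q_def)

lemma Q_diff: "Q (x - y) = Q x + Q y - b x y"
  using Q_add[of x "- y"] by simp

lemma Q_eq_0: "Q x = 0 \<longleftrightarrow> b x x = 0"
  using two by (simp add: Q_def)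

lemma iso_Q: "isometry V V' g \<Longrightarrow> x \<in> V \<Longrightarrow> Q (g x) = Q x"
  by (simp add: Q_def isoD(5))

text \<open>If \<open>b x y = 1\<close>, then Q cannot vanish at x, y and x + y at once.\<close>

lemma ex_nonsingular:
  assumes "ndg V" "V \<noteq> {0}" obtains v where "v \<in> V" "Q v \<noteq> 0"
proof -
  obtain x where x: "x \<in> V" "x \<noteq> 0" using assms subspace_0[OF ndgD(1)[OF assms(1)]] by blast
  then obtain y where y: "y \<in> V" "b x y = 1" using ndg_ex_partner[OF assms(1)] by blast
  have "Q (x + y) \<noteq> 0 \<or> Q x \<noteq> 0 \<or> Q y \<noteq> 0" using y Q_add[of x y] by auto
  then show ?thesis using that x y subspace_add[OF ndgD(1)[OF assms(1)]] by blast
qed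

definition vproj :: "'v \<Rightarrow> 'v \<Rightarrow> 'v" where "vproj v x = x - (b x v / (2 * Q v)) *s v"

lemma vproj_in: "subspace V \<Longrightarrow> v \<in> V \<Longrightarrow> Q v \<noteq> 0 \<Longrightarrow> x \<in> V \<Longrightarrow> vproj v x \<in> perp1 V v"
  using two by (simp add: vproj_def perp1_def b_simps b_self subspace_diff subspace_scale)

lemma vdecomp: "x = (b x v / (2 * Q v)) *s v + vproj v x"
  by (simp add: vproj_def)

lemma vproj_id: "x \<in> perp1 V v \<Longrightarrow> vproj v x = x"
  by (simp add: vproj_def perp1_def)

lemma vcoords:
  assumes "Q v \<noteq> 0" "b w v = 0"
  shows "b (c *s v + w) v / (2 * Q v) = c" "vproj v (c *s v + w) = w"
  using assms two by (simp_all add: vproj_def b_simps b_self)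

lemma ndg_perp1: assumes "ndg V" "v \<in> V" "Q v \<noteq> 0" shows "ndg (perp1 V v)"
  unfolding ndg_def
proof (intro conjI ballI impI)
  note s = ndgD(1)[OF assms(1)]
  show "subspace (perp1 V v)" "finite (perp1 V v)"
    using assms ndgD subspace_perp1 by (auto simp: perp1_def)
  fix x assume x: "x \<in> perp1 V v" "\<forall>y\<in>perp1 V v. b x y = 0"
  show "x = 0"
  proof (rule ndg_zeroI[OF assms(1)])
    show "x \<in> V" using x by (simp add: perp1_def)
    fix y assume y: "y \<in> V"
    have "b x (vproj v y) = 0" using x vproj_in[OF s assms(2,3) y] by blast
    then show "b x y = 0" using x by (simp add: vproj_def b_simps perp1_def)
  qed
qed

lemma card_perp1:
  assumes "subspace V" "v \<in> V" "Q v \<noteq> 0" shows "card V = CARD('a) * card (perp1 V v)"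
proof -
  have "bij_betw (\<lambda>(c, w). c *s v + w) (UNIV \<times> perp1 V v) V"
  proof (rule bij_betw_byWitness[where f' = "\<lambda>x. (b x v / (2 * Q v), vproj v x)"])
    show "\<forall>a\<in>UNIV \<times> perp1 V v. (b ((\<lambda>(c, w). c *s v + w) a) v / (2 * Q v), vproj v ((\<lambda>(c, w). c *s v + w) a)) = a"
      using vcoords[OF assms(3)] by (auto simp: perp1_def)
    show "\<forall>a'\<in>V. (\<lambda>(c, w). c *s v + w) (b a' v / (2 * Q v), vproj v a') = a'"
      using vdecomp by simp
    show "(\<lambda>(c, w). c *s v + w) ` (UNIV \<times> perp1 V v) \<subseteq> V"
      using assms by (auto simp: perp1_def intro!: subspace_add subspace_scale)
    show "(\<lambda>x. (b x v / (2 * Q v), vproj v x)) ` V \<subseteq> UNIV \<times> perp1 V v"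
      using vproj_in assms by auto
  qed
  then show ?thesis using bij_betw_same_card by (fastforce simp: card_cartesian_product)
qed

lemma perp1_psubset: assumes "v \<in> V" "Q v \<noteq> 0" shows "perp1 V v \<subset> V"
proof -
  have "v \<notin> perp1 V v" using assms two by (simp add: perp1_def b_self)
  then show ?thesis using assms by (auto simp: perp1_def)
qed

lemma card_perp1_less:
  assumes "ndg V" "v \<in> V" "Q v \<noteq> 0" shows "card (perp1 V v) < card V"
  using perp1_psubset[OF assms(2,3)] ndgD(2)[OF assms(1)] psubset_card_mono by blast

text \<open>The analogue of \<open>hext\<close> for a splitting along one nonsingular vector: v goes
  to v', and h acts on the complement.\<close>

definition vext :: "'v \<Rightarrow> 'v \<Rightarrow> ('v \<Rightarrow> 'v) \<Rightarrow> 'v \<Rightarrow> 'v" where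
  "vext v v' h x = (b x v / (2 * Q v)) *s v' + h (vproj v x)"

lemma iso_vext:
  assumes V: "ndg V" and V': "subspace V'" and v: "v \<in> V" "Q v \<noteq> 0" and v': "v' \<in> V'" "Q v' = Q v"
    and h: "isometry (perp1 V v) (perp1 V' v') h"
  shows "isometry V V' (vext v v' h)"
proof -
  note s = ndgD(1)[OF V]
  note W = ndg_perp1[OF V v]
  note W' = iso_ndg[OF h W]
  have pin: "vproj v x \<in> perp1 V v" if "x \<in> V" for x using vproj_in[OF s v that] .
  have hin: "h (vproj v x) \<in> perp1 V' v'" if "x \<in> V" for x using isoD(4)[OF h pin[OF that]] .
  have cV: "card V' = card V"
    using card_perp1[OF s v] card_perp1[OF V' v'(1)] v v' iso_card[OF h W] by simp
  \<comment> \<open>Infinite sets have cardinality 0 by convention, so a positive cardinality gives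
    finiteness of V'.\<close>
  have "card V \<noteq> 0" using subspace_0[OF s] ndgD(2)[OF V] by auto
  then have "finite V'" using cV by (metis card.infinite)
  then show ?thesis
  proof (rule isoI[OF V _ cV])
    fix x y assume xy: "x \<in> V" "y \<in> V"
    have "vproj v (x + y) = vproj v x + vproj v y"
      by (simp add: vproj_def b_simps add_divide_distrib algebra_simps)
    then show "vext v v' h (x + y) = vext v v' h x + vext v v' h y"
      using isoD(1)[OF h pin[OF xy(1)] pin[OF xy(2)]]
      by (simp add: vext_def b_simps add_divide_distrib algebra_simps)
    have p: "b (c *s u + w) (c' *s u + w') = c * c' * (2 * Q u) + b w w'"
      if "b w u = 0" "b w' u = 0" for c c' u w w'
      using that b_sym[of u w'] by (simp add: b_simps b_self)
    have "b (vext v v' h x) (vext v v' h y)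
        = (b x v / (2 * Q v)) * (b y v / (2 * Q v)) * (2 * Q v) + b (h (vproj v x)) (h (vproj v y))"
      unfolding vext_def using p[of "h (vproj v x)" v' "h (vproj v y)"] hin[OF xy(1)] hin[OF xy(2)] v'
      by (simp add: perp1_def)
    also have "b (h (vproj v x)) (h (vproj v y)) = b (vproj v x) (vproj v y)"
      using isoD(5)[OF h pin pin] xy by blast
    also have "(b x v / (2 * Q v)) * (b y v / (2 * Q v)) * (2 * Q v) + b (vproj v x) (vproj v y) = b x y"
      using p[of "vproj v x" v "vproj v y" "b x v / (2 * Q v)" "b y v / (2 * Q v)"] pin[OF xy(1)] pin[OF xy(2)]
        vdecomp[of x v] vdecomp[of y v] by (simp add: perp1_def)
    finally show "b (vext v v' h x) (vext v v' h y) = b x y" .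
  next
    fix c x assume x: "x \<in> V"
    have "vproj v (c *s x) = c *s vproj v x"
      by (simp add: vproj_def b_simps algebra_simps)
    then show "vext v v' h (c *s x) = c *s vext v v' h x"
      using isoD(2)[OF h pin[OF x]] by (simp add: vext_def b_simps algebra_simps)
  next
    fix x assume "x \<in> V"
    then show "vext v v' h x \<in> V'" using hin[of x] v'(1) V'
      by (auto simp: vext_def perp1_def intro!: subspace_add subspace_scale)
  qed
qed

lemma iso_eqI_v:
  assumes "isometry V V' g" "isometry V V' h" "v \<in> V" "Q v \<noteq> 0" "subspace V" "g v = h v"
    "\<And>w. w \<in> perp1 V v \<Longrightarrow> g w = h w" "x \<in> V"
  shows "g x = h x"
proof -
  have p: "vproj v x \<in> perp1 V v" "vproj v x \<in> V"
    using vproj_in[OF assms(5,3,4,8)] by (auto simp: perp1_def)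
  have "k ((b x v / (2 * Q v)) *s v + vproj v x) = (b x v / (2 * Q v)) *s k v + k (vproj v x)"
    if "isometry V V' k" for k
    using isoD(1,2)[OF that] p assms(3,5) by (simp add: subspace_scale)
  from this[OF assms(1)] this[OF assms(2)] show ?thesis
    using assms(6) assms(7)[OF p(1)] by (simp flip: vdecomp)
qed

section \<open>Reflections and Siegel transformations\<close>

definition reflect :: "'v \<Rightarrow> 'v \<Rightarrow> 'v" where "reflect v x = x - (b x v / Q v) *s v"

lemma reflect_self: "Q v \<noteq> 0 \<Longrightarrow> reflect v v = - v"
proof -
  assume "Q v \<noteq> 0"
  then have "reflect v v = v - (2::'a) *s v" by (simp add: reflect_def b_self)
  also have "\<dots> = - v" by (metis (no_types) diff_add_cancel diff_minus_eq_add minus_diff_eq one_add_one scale_left_distrib scale_one)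
  finally show ?thesis .
qed

lemma reflect_perp: "b x v = 0 \<Longrightarrow> reflect v x = x"
  by (simp add: reflect_def)

lemma reflect_reflect [simp]: "Q v \<noteq> 0 \<Longrightarrow> reflect v (reflect v x) = x"
  by (simp add: reflect_def b_simps b_self field_simps)

lemma reflect_scale: "c \<noteq> 0 \<Longrightarrow> reflect (c *s v) x = reflect v x"
  by (simp add: reflect_def b_simps Q_scale power2_eq_square)

lemma iso_reflect: assumes "ndg V" "v \<in> V" "Q v \<noteq> 0" shows "isometry V V (reflect v)"
proof (rule isoI[OF assms(1) ndgD(2)[OF assms(1)]])
  show "b (reflect v x) (reflect v y) = b x y" for x y
    using assms(3) b_sym[of v y] by (simp add: reflect_def b_simps b_self)
qed (use assms ndgD(1)[OF assms(1)] in
    \<open>auto simp: reflect_def b_simps add_divide_distrib algebra_simps subspace_diff subspace_scale\<close>)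

lemma iso_reflect_commute:
  assumes "isometry V V' g" "subspace V" "v \<in> V" "x \<in> V" shows "g (reflect v x) = reflect (g v) (g x)"
  using iso_diff[OF assms(1,2,4) subspace_scale[OF assms(2,3)]] isoD(2)[OF assms(1,3)]
    isoD(5)[OF assms(1,4,3)] iso_Q[OF assms(1,3)] by (simp add: reflect_def)

definition sieg :: "'v \<Rightarrow> 'v \<Rightarrow> 'v \<Rightarrow> 'v" where
  "sieg u w x = x + b x u *s w - b x w *s u - (Q w * b x u) *s u"

text \<open>For fixed u the Siegel transformations depend additively on w. This yields both inverses
  (take -w) and square roots (take w/2).\<close>

lemma sieg_add:
  assumes "Q u = 0" "b u w = 0" "b u w' = 0" shows "sieg u w (sieg u w' x) = sieg u (w + w') x"
  using assms b_sym[of w u] b_sym[of w' u] b_sym[of w w']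
  by (simp add: sieg_def b_simps b_self Q_add algebra_simps)

lemma sieg_0 [simp]: "sieg u 0 x = x"
  by (simp add: sieg_def)

lemma iso_sieg:
  assumes "ndg V" "u \<in> V" "w \<in> V" "Q u = 0" "b u w = 0" shows "isometry V V (sieg u w)"
proof (rule isoI[OF assms(1) ndgD(2)[OF assms(1)]])
  show "b (sieg u w x) (sieg u w y) = b x y" for x y
    using assms(4,5) b_sym[of w u] b_sym[of u y] b_sym[of w y]
    by (simp add: sieg_def b_simps b_self algebra_simps)
qed (use assms ndgD(1)[OF assms(1)] in
    \<open>auto simp: sieg_def b_simps algebra_simps subspace_add subspace_diff subspace_scale\<close>)

lemma iso_sieg_commute:
  assumes "isometry V V' g" "subspace V" "u \<in> V" "w \<in> V" "x \<in> V"
  shows "g (sieg u w x) = sieg (g u) (g w) (g x)"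
  using assms isoD[OF assms(1)] iso_diff[OF assms(1,2)] iso_Q[OF assms(1)]
  by (simp add: sieg_def subspace_add subspace_diff subspace_scale)

lemma iso_foldr_reflect:
  assumes "ndg V" "set vs \<subseteq> {v \<in> V. Q v \<noteq> 0}" shows "isometry V V (foldr reflect vs)"
  using assms(2)
proof (induction vs)
  case (Cons v vs)
  then have "isometry V V (\<lambda>x. reflect v (foldr reflect vs x))"
    using iso_comp[OF _ iso_reflect[OF assms(1)], of V "foldr reflect vs" v] by auto
  then show ?case by (simp add: comp_def)
qed (simp add: iso_ident id_def)

lemma foldr_reflect_fix: "set vs \<subseteq> perp1 V v \<Longrightarrow> foldr reflect vs v = v"
  by (induction vs) (auto simp: perp1_def reflect_perp b_sym[of v])

text \<open>The Cartan-Dieudonne argument without a bound on the number of factors: one or two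
  reflections bring g v back to v, and what remains acts on the complement of v.\<close>

theorem isometry_product_of_reflections:
  assumes "ndg V" "isometry V V g"
  obtains vs where "set vs \<subseteq> {v \<in> V. Q v \<noteq> 0}" "\<And>x. x \<in> V \<Longrightarrow> g x = foldr reflect vs x"
  using assms
proof (induction "card V" arbitrary: V g thesis rule: less_induct)
  case less
  note s = ndgD(1)[OF less(3)]
  show ?case
  proof (cases "V = {0}")
    case True
    then show ?thesis using less(2)[of "[]"] iso_zero[OF less(4) s] by simp
  next
    case False
    then obtain v where v: "v \<in> V" "Q v \<noteq> 0" using ex_nonsingular less(3) by blast
    \<comment> \<open>Reflections in vectors orthogonal to v fix v, so a factorization found on the
      complement is valid on all of V.\<close>
    have fixing: "\<exists>vs. set vs \<subseteq> {v \<in> V. Q v \<noteq> 0} \<and> (\<forall>x\<in>V. g1 x = foldr reflect vs x)"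
      if g1: "isometry V V g1" "g1 v = v" for g1
    proof -
      have W: "isometry (perp1 V v) (perp1 V v) g1" using iso_perp1[OF g1(1) v(1)] g1(2) by simp
      obtain vs where vs: "set vs \<subseteq> {w \<in> perp1 V v. Q w \<noteq> 0}" "\<And>x. x \<in> perp1 V v \<Longrightarrow> g1 x = foldr reflect vs x"
        using less(1)[OF card_perp1_less[OF less(3) v] _ ndg_perp1[OF less(3) v] W] by blast
      have vs': "set vs \<subseteq> {v \<in> V. Q v \<noteq> 0}" using vs(1) by (auto simp: perp1_def)
      have "g1 x = foldr reflect vs x" if "x \<in> V" for x
      proof (rule iso_eqI_v[OF g1(1) iso_foldr_reflect[OF less(3) vs'] v s _ _ that])
        show "g1 v = foldr reflect vs v" using g1(2) foldr_reflect_fix[of vs V v] vs(1) by (simp add: subset_iff)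
      qed (rule vs(2))
      then show ?thesis using vs' by blast
    qed
    have gv: "g v \<in> V" "Q (g v) = Q v" using isoD(4)[OF less(4) v(1)] iso_Q[OF less(4) v(1)] by auto
    \<comment> \<open>Parallelogram law: the two values add up to 4 Q(v), so one of the two vectors
      is nonsingular and defines a reflection.\<close>
    have "Q (g v - v) + Q (g v + v) = 2 * (2 * Q v)" using gv by (simp add: Q_add Q_diff)
    then have "Q (g v - v) \<noteq> 0 \<or> Q (g v + v) \<noteq> 0" by (metis add_0 mult_eq_0_iff two v(2))
    then consider "Q (g v - v) \<noteq> 0" | "Q (g v + v) \<noteq> 0" by blast
    then show ?thesis
    proof cases
      case 1
      let ?a = "g v - v"
      have a: "?a \<in> V" "Q ?a \<noteq> 0" using 1 gv v s by (auto simp: subspace_diff)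
      have "b (g v) ?a = Q ?a" using gv by (simp add: b_simps b_self Q_diff)
      then have av: "reflect ?a (g v) = v" using a by (simp add: reflect_def)
      obtain vs where vs: "set vs \<subseteq> {v \<in> V. Q v \<noteq> 0}" "\<forall>x\<in>V. reflect ?a (g x) = foldr reflect vs x"
        using fixing[OF iso_comp[OF less(4) iso_reflect[OF less(3) a]] av] by blast
      show ?thesis
      proof (rule less(2)[of "?a # vs"])
        show "set (?a # vs) \<subseteq> {v \<in> V. Q v \<noteq> 0}" using a vs by auto
        show "g x = foldr reflect (?a # vs) x" if "x \<in> V" for x
          using bspec[OF vs(2) that] a(2) by (metis comp_apply foldr_Cons reflect_reflect)
      qed
    next
      case 2
      let ?a = "g v + v"
      have a: "?a \<in> V" "Q ?a \<noteq> 0" using 2 gv v s by (auto simp: subspace_add)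
      have "b (g v) ?a = Q ?a" using gv by (simp add: b_simps b_self Q_add)
      then have "reflect ?a (g v) = - v" using a by (simp add: reflect_def)
      then have av: "reflect v (reflect ?a (g v)) = v"
        using reflect_self[OF v(2)] iso_neg[OF iso_reflect[OF less(3) v] v(1)] by simp
      obtain vs where vs: "set vs \<subseteq> {v \<in> V. Q v \<noteq> 0}" "\<forall>x\<in>V. reflect v (reflect ?a (g x)) = foldr reflect vs x"
        using fixing[OF iso_comp[OF iso_comp[OF less(4) iso_reflect[OF less(3) a]] iso_reflect[OF less(3) v]] av] by blast
      show ?thesis
      proof (rule less(2)[of "?a # v # vs"])
        show "set (?a # v # vs) \<subseteq> {v \<in> V. Q v \<noteq> 0}" using a v vs by auto
        show "g x = foldr reflect (?a # v # vs) x" if "x \<in> V" for x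
          using bspec[OF vs(2) that] a(2) v(2) by (metis comp_apply foldr_Cons reflect_reflect)
      qed
    qed
  qed
qed

subsection \<open>Counting isometries\<close>

definition N :: "'v set \<Rightarrow> 'a \<Rightarrow> nat" where "N V t = card {x \<in> V. Q x = t}"

lemma card_mult_eq:
  "card {(a, c). a * c = (t::'a)} = (if t = 0 then 2 * CARD('a) - 1 else CARD('a) - 1)"
proof (cases "t = 0")
  case True
  have "{(a, c). a * c = t} = ({0} \<times> UNIV) \<union> ((UNIV - {0}) \<times> {0})" using True by auto
  also have "card \<dots> = CARD('a) + (CARD('a) - 1)"
    by (subst card_Un_disjoint) (auto simp: card_cartesian_product card_Diff_subset)
  finally show ?thesis using True card_UNIV_gt_1[where 'a = 'a] by simp
next
  case False
  have "bij_betw (\<lambda>a. (a, t / a)) (UNIV - {0}) {(a, c). a * c = t}"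
    by (rule bij_betw_byWitness[where f' = fst]) (use False in \<open>auto simp: field_simps\<close>)
  then have "card (UNIV - {0::'a}) = card {(a, c). a * c = t}" by (rule bij_betw_same_card)
  then show ?thesis using False by (simp add: card_Diff_subset)
qed

text \<open>Writing x = a e + c f + w turns Q x = t into ac = t - Q w. This has q - 1 solutions (a,
  c) for every w, and q more when Q w = t.\<close>

lemma N_hyp:
  assumes "ndg V" "hyp V e f"
  shows "N V t = CARD('a) * N (perp2 V e f) t + (CARD('a) - 1) * card (perp2 V e f)"
proof -
  let ?W = "perp2 V e f"
  have fW: "finite ?W" using ndgD(2)[OF assms(1)] by (simp add: perp2_def)
  let ?S = "SIGMA w:?W. {(a, c). a * c = t - Q w}"
  have QS: "Q (a *s e + c *s f + w) = a * c + Q w" if "w \<in> ?W" for a c w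
    using b_hdecomp[OF assms(2) that that, of a c a c] two by (simp add: Q_def field_simps)
  have "bij_betw (\<lambda>(w, a, c). a *s e + c *s f + w) ?S {x \<in> V. Q x = t}"
  proof (rule bij_betw_byWitness[where f' = "\<lambda>x. (hproj e f x, b x f, b x e)"])
    show "\<forall>p\<in>?S. (hproj e f ((\<lambda>(w, a, c). a *s e + c *s f + w) p), b ((\<lambda>(w, a, c). a *s e + c *s f + w) p) f,
        b ((\<lambda>(w, a, c). a *s e + c *s f + w) p) e) = p"
      using hyp_coords[OF assms(2)] by auto
    show "\<forall>x\<in>{x \<in> V. Q x = t}. (\<lambda>(w, a, c). a *s e + c *s f + w) (hproj e f x, b x f, b x e) = x"
      using hdecomp[of _ f e] by simp
    show "(\<lambda>(w, a, c). a *s e + c *s f + w) ` ?S \<subseteq> {x \<in> V. Q x = t}"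
      using ndgD(1)[OF assms(1)] hypD[OF assms(2)] QS
      by (auto simp: perp2_def intro!: subspace_add subspace_scale)
    show "(\<lambda>x. (hproj e f x, b x f, b x e)) ` {x \<in> V. Q x = t} \<subseteq> ?S"
    proof (rule image_subsetI)
      fix x assume x: "x \<in> {x \<in> V. Q x = t}"
      then have p: "hproj e f x \<in> ?W" using hproj_in[OF assms(2) ndgD(1)[OF assms(1)]] by simp
      have "Q x = b x f * b x e + Q (hproj e f x)"
        using QS[OF p, of "b x f" "b x e"] hdecomp[of x f e] by simp
      then show "(hproj e f x, b x f, b x e) \<in> ?S" using p x by (auto simp: eq_diff_eq)
    qed
  qed
  then have "N V t = card ?S" unfolding N_def using bij_betw_same_card[symmetric] by blast
  also have "\<dots> = (\<Sum>w\<in>?W. card {(a, c). a * c = t - Q w})"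
    using fW by (intro card_SigmaI) auto
  also have "\<dots> = (\<Sum>w\<in>?W. (if Q w = t then CARD('a) else 0) + (CARD('a) - 1))"
    unfolding card_mult_eq using card_UNIV_gt_1[where 'a = 'a] by (intro sum.cong) auto
  also have "\<dots> = CARD('a) * card {w \<in> ?W. Q w = t} + (CARD('a) - 1) * card ?W"
    using sum.inter_filter[OF fW, of "\<lambda>_. CARD('a)" "\<lambda>w. Q w = t"] by (subst sum.distrib) (simp add: mult.commute)
  finally show ?thesis by (simp add: N_def)
qed

text \<open>The number of solutions of x_1 y_1 + ... + x_r y_r + z^2 = t, given by the recursion of
  \<open>N_hyp\<close>.\<close>

fun M :: "nat \<Rightarrow> 'a \<Rightarrow> nat" where
  "M 0 t = card {c::'a. c\<^sup>2 = t}"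
| "M (Suc r) t = CARD('a) * M r t + (CARD('a) - 1) * CARD('a) ^ (2 * r + 1)"

lemma M_0: "M r 0 = CARD('a) ^ (2 * r)"
proof (induction r)
  case (Suc r)
  obtain n where n: "CARD('a) = Suc n" using card_UNIV_gt_1[where 'a = 'a] by (cases "CARD('a)") auto
  show ?case using Suc by (simp add: n algebra_simps)
qed simp

text \<open>V is the orthogonal sum of r hyperbolic planes and a line spanned by a vector with Q =
  1. Fixing the value on the line fixes the isometry type.\<close>

inductive hdec :: "'v set \<Rightarrow> nat \<Rightarrow> bool" where
  hdec_0: "ndg V \<Longrightarrow> z \<in> V \<Longrightarrow> Q z = 1 \<Longrightarrow> card V = CARD('a) \<Longrightarrow> hdec V 0"
| hdec_Suc: "ndg V \<Longrightarrow> hyp V e f \<Longrightarrow> hdec (perp2 V e f) r \<Longrightarrow> hdec V (Suc r)"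

lemma hdec_ndg: "hdec V r \<Longrightarrow> ndg V"
  by (induction rule: hdec.induct) auto

lemma line_eq:
  assumes "ndg V" "z \<in> V" "Q z \<noteq> 0" "card V = CARD('a)" "x \<in> V"
  shows "x = (b x z / (2 * Q z)) *s z"
proof -
  have "card (perp1 V z) = 1"
    using card_perp1[OF ndgD(1)[OF assms(1)] assms(2,3)] assms(4) card_UNIV_gt_1[where 'a = 'a] by simp
  then have "perp1 V z = {0}"
    using subspace_0[OF subspace_perp1[OF ndgD(1)[OF assms(1)]]] by (metis card_1_singletonE singletonD)
  then have "vproj z x = 0" using vproj_in[OF ndgD(1)[OF assms(1)] assms(2,3,5)] by simp
  then show ?thesis using vdecomp[of x z] by simp
qed

lemma hdec_count: "hdec V r \<Longrightarrow> card V = CARD('a) ^ (2 * r + 1) \<and> (\<forall>t. N V t = M r t)"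
proof (induction rule: hdec.induct)
  case (hdec_0 V z)
  have "N V t = M 0 t" for t
  proof -
    have "bij_betw (\<lambda>c. c *s z) {c. c\<^sup>2 = t} {x \<in> V. Q x = t}"
    proof (rule bij_betw_byWitness[where f' = "\<lambda>x. b x z / (2 * Q z)"])
      show "\<forall>a\<in>{c. c\<^sup>2 = t}. b (a *s z) z / (2 * Q z) = a"
        using hdec_0(3) two by (simp add: b_simps b_self)
      show e: "\<forall>a'\<in>{x \<in> V. Q x = t}. (b a' z / (2 * Q z)) *s z = a'"
        using line_eq[OF hdec_0(1,2) _ hdec_0(4)] hdec_0(3) by simp
      show "(\<lambda>c. c *s z) ` {c. c\<^sup>2 = t} \<subseteq> {x \<in> V. Q x = t}"
        using hdec_0(3) subspace_scale[OF ndgD(1)[OF hdec_0(1)] hdec_0(2)] by (auto simp: Q_scale)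
      show "(\<lambda>x. b x z / (2 * Q z)) ` {x \<in> V. Q x = t} \<subseteq> {c. c\<^sup>2 = t}"
      proof (rule image_subsetI)
        fix x assume "x \<in> {x \<in> V. Q x = t}"
        then show "b x z / (2 * Q z) \<in> {c. c\<^sup>2 = t}"
          using bspec[OF e, of x] Q_scale[of "b x z / (2 * Q z)" z] hdec_0(3) by simp
      qed
    qed
    from bij_betw_same_card[OF this] show ?thesis by (simp add: N_def)
  qed
  then show ?case using hdec_0 by simp
next
  case (hdec_Suc V e f r)
  then show ?case using card_hyp[OF ndgD(1)[OF hdec_Suc(1)] hdec_Suc(2)] N_hyp[OF hdec_Suc(1,2)] by simp
qed

text \<open>The vector e ranges over the nonzero singular vectors. In the affine hyperplane
  \<open>b e x = 1\<close> every line in direction e contains exactly one singular vector, because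
  Q(x + t e) = Q(x) + t there; so a q-th part of the hyperplane is available for f.\<close>

lemma card_hyps:
  assumes "ndg V" "card V = CARD('a) ^ (2 * Suc r + 1)" "N V 0 = CARD('a) ^ (2 * Suc r)"
  shows "card (hyps V) = (CARD('a) ^ (2 * r + 2) - 1) * CARD('a) ^ (2 * r + 1)"
proof -
  note s = ndgD(1)[OF assms(1)] and fin = ndgD(2)[OF assms(1)]
  let ?E = "{e \<in> V. Q e = 0} - {0}"
  let ?P = "\<lambda>e. {f \<in> V. b e f = 1 \<and> Q f = 0}"
  have "hyps V = (SIGMA e:?E. ?P e)"
    by (auto simp: hyps_def hyp_def Q_eq_0)
  then have "card (hyps V) = (\<Sum>e\<in>?E. card (?P e))"
    using fin by (simp add: card_SigmaI)
  also have "\<dots> = (\<Sum>e\<in>?E. CARD('a) ^ (2 * r + 1))"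
  proof (rule sum.cong)
    fix e assume e: "e \<in> ?E"
    have Qt: "Q (f + t *s e) = Q f + t * b e f" for f t
      using e b_sym[of f e] by (simp add: Q_add Q_scale b_simps)
    have "bij_betw (\<lambda>(t, f). f + t *s e) (UNIV \<times> ?P e) {x \<in> V. b e x = 1}"
    proof (rule bij_betw_byWitness[where f' = "\<lambda>x. (Q x, x - Q x *s e)"])
      show "\<forall>a\<in>UNIV \<times> ?P e. (Q ((\<lambda>(t, f). f + t *s e) a), (\<lambda>(t, f). f + t *s e) a - Q ((\<lambda>(t, f). f + t *s e) a) *s e) = a"
        by (auto simp: Qt)
      show "(\<lambda>(t, f). f + t *s e) ` (UNIV \<times> ?P e) \<subseteq> {x \<in> V. b e x = 1}"
        using e s by (auto simp: b_simps b_self subspace_add subspace_scale)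
      show "(\<lambda>x. (Q x, x - Q x *s e)) ` {x \<in> V. b e x = 1} \<subseteq> UNIV \<times> ?P e"
      proof (rule image_subsetI)
        fix x assume x: "x \<in> {x \<in> V. b e x = 1}"
        have "Q (x - Q x *s e) = 0" using Qt[of x "- Q x"] x by simp
        then show "(Q x, x - Q x *s e) \<in> UNIV \<times> ?P e"
          using e x s by (auto simp: b_simps b_self subspace_diff subspace_scale)
      qed
    qed simp
    then have "CARD('a) * card (?P e) = card {x \<in> V. b e x = 1}"
      using bij_betw_same_card by (fastforce simp: card_cartesian_product)
    then have "CARD('a) * (CARD('a) * card (?P e)) = CARD('a) * (CARD('a) * CARD('a) ^ (2 * r + 1))"
      using card_level[OF assms(1), of e 1] assms(2) e by simp
    then show "card (?P e) = CARD('a) ^ (2 * r + 1)"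
      using card_UNIV_gt_1[where 'a = 'a] by simp
  qed simp
  also have "\<dots> = (CARD('a) ^ (2 * r + 2) - 1) * CARD('a) ^ (2 * r + 1)"
  proof -
    have "card ?E = CARD('a) ^ (2 * r + 2) - 1"
      using assms(3) subspace_0[OF s] fin by (subst card_Diff_subset) (auto simp: N_def)
    then show ?thesis by simp
  qed
  finally show ?thesis .
qed

text \<open>The numbers \<open>N V' t\<close> play the role of Witt cancellation: they pass to the orthogonal
  complement of a hyperbolic pair, and in dimension 1 they determine the form.\<close>

theorem card_isos:
  assumes "hdec V r" "ndg V'" "card V' = CARD('a) ^ (2 * r + 1)" "\<And>t. N V' t = M r t"
  shows "card (isometries V V') = 2 * (\<Prod>i<r. (CARD('a) ^ (2 * i + 2) - 1) * CARD('a) ^ (2 * i + 1))"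
  using assms
proof (induction arbitrary: V' rule: hdec.induct)
  case (hdec_0 V z)
  note s = ndgD(1)[OF hdec_0(1)] and s' = ndgD(1)[OF hdec_0(5)]
  have le: "x = (b x z / 2) *s z" if "x \<in> V" for x
    using line_eq[OF hdec_0(1,2) _ hdec_0(4) that] hdec_0(3) by simp
  \<comment> \<open>An isometry of a line is determined by the image of z. There are two vectors
    with Q = 1, which is the origin of the factor 2.\<close>
  have "bij_betw (\<lambda>g. g z) (isometries V V') {z' \<in> V'. Q z' = 1}"
  proof (rule bij_betw_byWitness[where f' = "\<lambda>z'. \<lambda>x\<in>V. (b x z / 2) *s z'"])
    show "\<forall>g\<in>isometries V V'. (\<lambda>x\<in>V. (b x z / 2) *s g z) = g"
    proof
      fix g assume g: "g \<in> isometries V V'"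
      show "(\<lambda>x\<in>V. (b x z / 2) *s g z) = g"
      proof (rule extensionalityI[of _ V])
        fix x assume x: "x \<in> V"
        have "g ((b x z / 2) *s z) = (b x z / 2) *s g z"
          using g isoD(2)[of V V' g z] hdec_0(2) by (simp add: isometries_def)
        then show "(\<lambda>x\<in>V. (b x z / 2) *s g z) x = g x" using le[OF x] x by simp
      qed (use g in \<open>auto simp: isometries_def\<close>)
    qed
    show "\<forall>z'\<in>{z' \<in> V'. Q z' = 1}. (\<lambda>x\<in>V. (b x z / 2) *s z') z = z'"
      using hdec_0(2,3) two by (simp add: b_self)
    show "(\<lambda>g. g z) ` isometries V V' \<subseteq> {z' \<in> V'. Q z' = 1}"
      using hdec_0(2,3) by (auto simp: isometries_def isoD(4) iso_Q)
    show "(\<lambda>z'. \<lambda>x\<in>V. (b x z / 2) *s z') ` {z' \<in> V'. Q z' = 1} \<subseteq> isometries V V'"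
    proof (rule image_subsetI)
      fix z' assume z': "z' \<in> {z' \<in> V'. Q z' = 1}"
      have "isometry V V' (\<lambda>x. (b x z / 2) *s z')"
      proof (rule isoI[OF hdec_0(1) ndgD(2)[OF hdec_0(5)]])
        show "card V' = card V" using hdec_0(4,6) by simp
        fix x y assume xy: "x \<in> V" "y \<in> V"
        show "((b (x + y) z) / 2) *s z' = (b x z / 2) *s z' + (b y z / 2) *s z'"
          by (simp add: b_simps add_divide_distrib algebra_simps)
        have "b ((b x z / 2) *s z) ((b y z / 2) *s z) = b ((b x z / 2) *s z') ((b y z / 2) *s z')"
          using z' hdec_0(3) by (simp add: b_simps b_self)
        then show "b ((b x z / 2) *s z') ((b y z / 2) *s z') = b x y"
          using le xy by metis
      qed (use z' s' in \<open>auto simp: b_simps subspace_scale\<close>)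
      then show "(\<lambda>x\<in>V. (b x z / 2) *s z') \<in> isometries V V'"
        using iso_cong[OF _ s, of "\<lambda>x\<in>V. (b x z / 2) *s z'" "\<lambda>x. (b x z / 2) *s z'"]
        by (simp add: isometries_def)
    qed
  qed
  then have "card (isometries V V') = N V' 1" unfolding N_def by (rule bij_betw_same_card)
  also have "\<dots> = card {c::'a. c\<^sup>2 = 1}" using hdec_0(7) by simp
  also have "{c::'a. c\<^sup>2 = 1} = {1, - 1}" by (auto simp: power2_eq_1_iff)
  also have "card \<dots> = 2"
  proof -
    have "(1::'a) \<noteq> - 1" using two_cancel_F[of 1] by auto
    then show ?thesis by (simp only: card_2_iff) blast
  qed
  finally show ?case by simp
next
  case (hdec_Suc V e f r)
  let ?n = "2 * (\<Prod>i<r. (CARD('a) ^ (2 * i + 2) - 1) * CARD('a) ^ (2 * i + 1))"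
  have "card (isometries V V') = card (hyps V') * ?n"
  proof (rule card_isos_step[OF hdec_Suc(1,2,5)])
    fix e' f' assume h: "hyp V' e' f'"
    have c: "card (perp2 V' e' f') = CARD('a) ^ (2 * r + 1)"
      using card_hyp[OF ndgD(1)[OF hdec_Suc(5)] h] hdec_Suc(6) card_UNIV_gt_1[where 'a = 'a] by simp
    have "N (perp2 V' e' f') t = M r t" for t
    proof -
      have "CARD('a) * N (perp2 V' e' f') t = CARD('a) * M r t"
        using N_hyp[OF hdec_Suc(5) h, of t] hdec_Suc(7)[of t] c by simp
      then show ?thesis using card_UNIV_gt_1[where 'a = 'a] by simp
    qed
    then show "card (isometries (perp2 V e f) (perp2 V' e' f')) = ?n"
      by (rule hdec_Suc.IH[OF ndg_perp2[OF hdec_Suc(5) h] c])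
  qed
  then show ?case using card_hyps[OF hdec_Suc(5,6)] hdec_Suc(7) M_0[of "Suc r"] by simp
qed

end

text \<open>Each 2-cycle of t contributes the square of a value of f, which is 1; only fixed points
  remain.\<close>

lemma prod_involution:
  fixes f :: "'b \<Rightarrow> 'c::comm_monoid_mult"
  assumes "finite A" "\<And>x. x \<in> A \<Longrightarrow> t x \<in> A \<and> t (t x) = x \<and> f (t x) = f x \<and> f x * f x = 1"
  shows "prod f A = prod f {x \<in> A. t x = x}"
  using assms
proof (induction A rule: finite_psubset_induct)
  case (psubset A)
  show ?case
  proof (cases "\<exists>x\<in>A. t x \<noteq> x")
    case True
    then obtain x where x: "x \<in> A" "t x \<noteq> x" by blast
    let ?B = "A - {x, t x}"
    have tx: "t x \<in> A" "t (t x) = x" using psubset.prems x(1) by blast+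
    have "prod f ?B = prod f {y \<in> ?B. t y = y}"
    proof (rule psubset.IH)
      show "?B \<subset> A" using x by blast
      fix y assume y: "y \<in> ?B"
      then have "t y \<in> A \<and> t (t y) = y \<and> f (t y) = f y \<and> f y * f y = 1" using psubset.prems by blast
      moreover have "t y \<noteq> x" "t y \<noteq> t x" using y tx psubset.prems[of y] psubset.prems[of x] x by auto
      ultimately show "t y \<in> ?B \<and> t (t y) = y \<and> f (t y) = f y \<and> f y * f y = 1" by blast
    qed
    moreover have "{y \<in> ?B. t y = y} = {y \<in> A. t y = y}" using x tx by auto
    moreover have "prod f A = prod f ?B"
    proof -
      have A: "A = insert x (insert (t x) ?B)" using x tx by auto
      have "prod f A = prod f (insert x (insert (t x) ?B))" using A by (rule arg_cong)
      also have "\<dots> = f x * prod f (insert (t x) ?B)"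
        by (rule prod.insert) (use x psubset.hyps in auto)
      also have "prod f (insert (t x) ?B) = f (t x) * prod f ?B"
        by (rule prod.insert) (use psubset.hyps in auto)
      also have "f x * (f (t x) * prod f ?B) = (f x * f (t x)) * prod f ?B" by (simp only: mult.assoc)
      also have "f x * f (t x) = 1" using psubset.prems[OF x(1)] by simp
      finally show ?thesis by simp
    qed
    ultimately show ?thesis by simp
  next
    case False
    then have "{x \<in> A. t x = x} = A" by blast
    then show ?thesis by simp
  qed
qed

context orth_space begin

subsection \<open>The transfer characters\<close>

text \<open>For \<open>c \<noteq> 0\<close> the sphere \<open>{x \<in> V. Q x = c}\<close> is stable under \<open>x \<mapsto> - x\<close>.  As in Gauss's lemma,
  counting the sign changes on a half system gives a homomorphism from the isometry group of \<open>V\<close> to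
  \<open>{1, - 1}\<close>.\<close>

definition pos :: "'v \<Rightarrow> bool" where "pos x \<longleftrightarrow> (SOME y. y \<in> {x, - x}) = x"
definition sg :: "'v \<Rightarrow> int" where "sg x = (if pos x then 1 else - 1)"
definition up :: "'v \<Rightarrow> 'v" where "up x = (if pos x then x else - x)"
definition theta :: "'v set \<Rightarrow> 'a \<Rightarrow> ('v \<Rightarrow> 'v) \<Rightarrow> int" where
  "theta V c g = (\<Prod>y\<in>{y \<in> V. Q y = c \<and> pos y}. sg (g y))"

text \<open>The choice depends only on the set {x, -x}, hence it selects exactly one of two opposite
  nonzero vectors.\<close>

lemma pos_minus: assumes "x \<noteq> 0" shows "pos (- x) \<longleftrightarrow> \<not> pos x"
proof -
  have "{- x, - (- x)} = {x, - x}" by auto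
  then have "(SOME y. y \<in> {- x, - (- x)}) = (SOME y. y \<in> {x, - x})" by simp
  moreover have "(SOME y. y \<in> {x, - x}) \<in> {x, - x}" by (rule someI[of _ x]) simp
  moreover have "x \<noteq> - x" using two_cancel assms by blast
  ultimately show ?thesis unfolding pos_def by auto
qed

lemma sg_minus: "x \<noteq> 0 \<Longrightarrow> sg (- x) = - sg x"
  by (simp add: sg_def pos_minus)

lemma pos_up: "x \<noteq> 0 \<Longrightarrow> pos (up x)"
  by (simp add: up_def pos_minus)

lemma Q_up: "Q (up x) = Q x"
  by (simp add: up_def)

lemma theta_cong: "(\<And>x. x \<in> V \<Longrightarrow> g x = h x) \<Longrightarrow> theta V c g = theta V c h"
  unfolding theta_def by (rule prod.cong) auto

lemma theta_id: "(\<And>x. x \<in> V \<Longrightarrow> g x = x) \<Longrightarrow> theta V c g = 1"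
  unfolding theta_def by (rule prod.neutral) (auto simp: sg_def)

lemma theta_sq: "theta V c g * theta V c g = 1"
  unfolding theta_def prod.distrib[symmetric] by (rule prod.neutral) (auto simp: sg_def)

lemma theta_cases: "theta V c g = 1 \<or> theta V c g = - 1"
  using theta_sq[of V c g] by (metis square_eq_1_iff)

text \<open>The map y -> up (h y) permutes the half system, and the sign of g (h y) is that of h y
  times that of g at the representative \<open>up (h y)\<close>.\<close>

lemma theta_comp:
  assumes "ndg V" "isometry V V g" "isometry V V h" "c \<noteq> 0"
  shows "theta V c (\<lambda>x. g (h x)) = theta V c g * theta V c h"
proof -
  let ?Y = "{y \<in> V. Q y = c \<and> pos y}"
  note s = ndgD(1)[OF assms(1)]
  have fin: "finite ?Y" using ndgD(2)[OF assms(1)] by simp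
  have nz: "x \<noteq> 0" if "Q x = c" for x using that assms(4) by auto
  have hV: "h y \<in> V" "Q (h y) = c" if "y \<in> ?Y" for y
    using that isoD(4)[OF assms(3)] iso_Q[OF assms(3)] by auto
  have into: "up (h y) \<in> ?Y" if "y \<in> ?Y" for y
    using hV[OF that] Q_up pos_up nz by (auto simp: up_def subspace_neg[OF s])
  have inj: "inj_on (\<lambda>y. up (h y)) ?Y"
  proof (rule inj_onI)
    fix y y' assume y: "y \<in> ?Y" "y' \<in> ?Y" "up (h y) = up (h y')"
    then have "h y = h y' \<or> h y = - h y'" by (auto simp: up_def minus_equation_iff split: if_splits)
    then have "h y = h y' \<or> h y = h (- y')" using iso_neg[OF assms(3), of y'] y by auto
    then have "y = y' \<or> y = - y'"
      using iso_inj[OF assms(3,1)] y subspace_neg[OF s, of y'] by (auto dest: inj_onD)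
    then show "y = y'" using y pos_minus[of y'] nz[of y'] by auto
  qed
  have bij: "bij_betw (\<lambda>y. up (h y)) ?Y ?Y"
    unfolding bij_betw_def using inj endo_inj_surj[OF fin _ inj] into by blast
  have eq: "sg (g (h y)) = sg (h y) * sg (g (up (h y)))" if "y \<in> ?Y" for y
  proof -
    have "g (h y) \<noteq> 0" using iso_Q[OF assms(2) hV(1)[OF that]] hV(2)[OF that] nz by simp
    then show ?thesis
      using sg_minus[of "g (h y)"] iso_neg[OF assms(2) hV(1)[OF that]] by (simp add: up_def sg_def[of "h y"])
  qed
  have "theta V c (\<lambda>x. g (h x)) = (\<Prod>y\<in>?Y. sg (h y) * sg (g (up (h y))))"
    unfolding theta_def by (rule prod.cong) (use eq in auto)
  also have "\<dots> = theta V c h * (\<Prod>y\<in>?Y. sg (g (up (h y))))"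
    by (simp add: prod.distrib theta_def)
  also have "(\<Prod>y\<in>?Y. sg (g (up (h y)))) = theta V c g"
    unfolding theta_def by (rule prod.reindex_bij_betw[OF bij])
  finally show ?thesis by (simp add: mult.commute)
qed

text \<open>The reflection induces an involution of the half system, so factors cancel in pairs
  except where the reflection maps y to y or -y. The fixed vectors contribute 1. The negated ones
  lie on the line of v, which meets the half system of the sphere Q = c in one vector if c is Q(v)
  times a square and in none otherwise.\<close>

lemma theta_reflect:
  assumes "ndg V" "v \<in> V" "Q v \<noteq> 0" "c \<noteq> 0"
  shows "theta V c (reflect v) = (if \<exists>s. s\<^sup>2 * Q v = c then - 1 else 1)"
proof -
  let ?Y = "{y \<in> V. Q y = c \<and> pos y}"
  let ?r = "reflect v"
  let ?t = "\<lambda>y. up (?r y)"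
  note s = ndgD(1)[OF assms(1)]
  note ir = iso_reflect[OF assms(1-3)]
  have fin: "finite ?Y" using ndgD(2)[OF assms(1)] by simp
  have nz: "x \<noteq> 0" if "Q x = c" for x using that assms(4) by auto
  have rV: "?r y \<in> V" "Q (?r y) = c" if "y \<in> ?Y" for y
    using that isoD(4)[OF ir] iso_Q[OF ir] by auto
  have t: "?t y \<in> ?Y \<and> ?t (?t y) = y \<and> sg (?r (?t y)) = sg (?r y) \<and> sg (?r y) * sg (?r y) = 1"
    if y: "y \<in> ?Y" for y
  proof -
    have rt: "?r (?t y) = (if pos (?r y) then y else - y)"
      using iso_neg[OF ir rV(1)[OF y]] assms(3) by (simp add: up_def)
    have "pos y" "y \<noteq> 0" using y nz by auto
    then have "?t (?t y) = y \<and> sg (?r (?t y)) = sg (?r y)"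
      using pos_minus[of y] unfolding rt by (simp add: up_def sg_def)
    moreover have "?t y \<in> ?Y"
      using rV[OF y] Q_up pos_up nz by (auto simp: up_def subspace_neg[OF s])
    ultimately show ?thesis by (simp add: sg_def)
  qed
  have "theta V c ?r = (\<Prod>y\<in>{y \<in> ?Y. ?t y = y}. sg (?r y))"
    unfolding theta_def by (rule prod_involution[OF fin]) (rule t)
  also have "\<dots> = (\<Prod>y\<in>{y \<in> ?Y. ?r y = - y}. - 1)"
  proof (rule prod.mono_neutral_cong_right)
    show "finite {y \<in> ?Y. ?t y = y}" by (rule finite_subset[OF _ fin]) auto
    have m: "?t y = y" if "y \<in> ?Y" "?r y = - y" for y
      using that pos_minus[of y] nz[of y] by (simp add: up_def)
    then show "{y \<in> ?Y. ?r y = - y} \<subseteq> {y \<in> ?Y. ?t y = y}" by auto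
    show "\<forall>i\<in>{y \<in> ?Y. ?t y = y} - {y \<in> ?Y. ?r y = - y}. sg (?r i) = 1"
      by (auto simp: up_def sg_def minus_equation_iff split: if_splits)
    show "sg (?r y) = - 1" if "y \<in> {y \<in> ?Y. ?r y = - y}" for y
      using that sg_minus[of y] nz[of y] by (simp add: sg_def)
  qed
  also have "\<dots> = (- 1) ^ card {y \<in> ?Y. ?r y = - y}" by simp
  also have "card {y \<in> ?Y. ?r y = - y} = (if \<exists>s. s\<^sup>2 * Q v = c then 1 else 0)"
  proof -
    have line: "\<exists>t. y = t *s v \<and> t\<^sup>2 * Q v = c" if "y \<in> ?Y" "?r y = - y" for y
    proof -
      have "y + y = (b y v / Q v) *s v" using that(2) by (simp add: reflect_def algebra_simps)
      then have "y = (1/2) *s ((b y v / Q v) *s v)" using half_double[of y] by simp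
      then have y: "y = ((1/2) * (b y v / Q v)) *s v" by simp
      define t where "t = (1/2) * (b y v / Q v)"
      have "y = t *s v" using y unfolding t_def .
      then show ?thesis using that(1) Q_scale[of t v] by (intro exI[of _ t]) simp
    qed
    show ?thesis
    proof (cases "\<exists>s. s\<^sup>2 * Q v = c")
      case True
      then obtain s0 where s0: "s0\<^sup>2 * Q v = c" by blast
      let ?z = "s0 *s v"
      have z: "?z \<in> V" "Q ?z = c" using assms(2) s s0 by (auto simp: subspace_scale Q_scale)
      have rz: "?r ?z = - ?z" using isoD(2)[OF ir assms(2)] reflect_self[OF assms(3)] by simp
      have "{y \<in> ?Y. ?r y = - y} = {up ?z}"
      proof (intro equalityI subsetI)
        fix y assume "y \<in> {y \<in> ?Y. ?r y = - y}"
        then obtain t1 where y: "y \<in> ?Y" "y = t1 *s v" "t1\<^sup>2 * Q v = c" using line by blast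
        then have "t1\<^sup>2 = s0\<^sup>2" using s0 assms(3) by (metis mult_right_cancel)
        then have "t1 = s0 \<or> t1 = - s0" by (simp add: power2_eq_iff)
        then have "y = ?z \<or> y = - ?z" using y by auto
        then show "y \<in> {up ?z}" using y(1) pos_minus[of ?z] nz[OF z(2)] by (auto simp: up_def)
      next
        fix y assume "y \<in> {up ?z}"
        then show "y \<in> {y \<in> ?Y. ?r y = - y}"
          using z rz pos_up[of ?z] nz[OF z(2)] iso_neg[OF ir z(1)] s by (auto simp: up_def subspace_neg)
      qed
      then show ?thesis using True by simp
    next
      case False
      then have "{y \<in> ?Y. ?r y = - y} = {}" using line by blast
      then show ?thesis using False by (simp only: card.empty if_False)
    qed
  qed
  finally show ?thesis by simp
qed

text \<open>A Siegel transformation is the square of the one with w/2, and a sign character is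
  trivial on squares.\<close>

lemma theta_sieg:
  assumes "ndg V" "u \<in> V" "w \<in> V" "Q u = 0" "b u w = 0" "c \<noteq> 0"
  shows "theta V c (sieg u w) = 1"
proof -
  let ?w = "(1/2) *s w"
  have w: "?w \<in> V" "b u ?w = 0" using assms ndgD(1)[OF assms(1)] by (auto simp: subspace_scale b_simps)
  have "?w + ?w = w" using half_double[of w] by (simp add: scale_right_distrib)
  then have eq: "sieg u w x = sieg u ?w (sieg u ?w x)" for x
    using sieg_add[OF assms(4) w(2) w(2)] by simp
  note i = iso_sieg[OF assms(1,2) w(1) assms(4) w(2)]
  have "theta V c (sieg u w) = theta V c (\<lambda>x. sieg u ?w (sieg u ?w x))"
    by (rule theta_cong) (rule eq)
  also have "\<dots> = 1" unfolding theta_comp[OF assms(1) i i assms(6)] by (rule theta_sq)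
  finally show ?thesis .
qed

subsection \<open>Products of Siegel transformations\<close>

text \<open>Membership in Omega for functions considered only on V; restriction to extensional
  functions is postponed to the group level. The factors need no separate inverses, since the
  inverse of a Siegel transformation is one.\<close>

inductive siegel_prod :: "'v set \<Rightarrow> ('v \<Rightarrow> 'v) \<Rightarrow> bool" for V where
  siegel_prod_id: "\<forall>x\<in>V. g x = x \<Longrightarrow> siegel_prod V g"
| siegel_prod_step: "u \<in> V \<Longrightarrow> w \<in> V \<Longrightarrow> u \<noteq> 0 \<Longrightarrow> Q u = 0 \<Longrightarrow> b u w = 0 \<Longrightarrow> siegel_prod V h \<Longrightarrow>
    \<forall>x\<in>V. g x = sieg u w (h x) \<Longrightarrow> siegel_prod V g"

lemma siegel_prod_sieg:
  assumes "u \<in> V" "w \<in> V" "Q u = 0" "b u w = 0" shows "siegel_prod V (sieg u w)"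
proof (cases "u = 0")
  case True
  then show ?thesis by (intro siegel_prod_id) (simp add: sieg_def)
next
  case False
  show ?thesis by (rule siegel_prod_step[OF assms(1,2) False assms(3,4) siegel_prod_id[of V id]]) simp_all
qed

lemma iso_cong_imp: "isometry V V h \<Longrightarrow> \<forall>x\<in>V. g x = h x \<Longrightarrow> subspace V \<Longrightarrow> isometry V V g"
  using iso_cong[of V g h V] by blast

lemma siegel_prod_iso: assumes "ndg V" "siegel_prod V g" shows "isometry V V g"
  using assms(2)
proof induction
  case (siegel_prod_id g)
  show ?case by (rule iso_cong_imp[OF iso_ident(1) siegel_prod_id ndgD(1)[OF assms(1)]])
next
  case (siegel_prod_step u w h g)
  show ?case
    by (rule iso_cong_imp[OF iso_comp[OF siegel_prod_step.IH iso_sieg[OF assms(1) siegel_prod_step.hyps(1,2,4,5)]] siegel_prod_step.hyps(7) ndgD(1)[OF assms(1)]])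
qed

lemma siegel_prod_theta: assumes "ndg V" "siegel_prod V g" "c \<noteq> 0" shows "theta V c g = 1"
  using assms(2)
proof induction
  case (siegel_prod_step u w h g)
  have "theta V c g = theta V c (\<lambda>x. sieg u w (h x))" by (rule theta_cong) (use siegel_prod_step in auto)
  also have "\<dots> = 1"
    using theta_comp[OF assms(1) iso_sieg[OF assms(1) siegel_prod_step.hyps(1,2,4,5)] siegel_prod_iso[OF assms(1) siegel_prod_step.hyps(6)] assms(3)]
      theta_sieg[OF assms(1) siegel_prod_step.hyps(1,2,4,5) assms(3)] siegel_prod_step by simp
  finally show ?case .
qed (auto intro: theta_id)

lemma siegel_prod_cong: "siegel_prod V h \<Longrightarrow> \<forall>x\<in>V. g x = h x \<Longrightarrow> siegel_prod V g"
  by (induction arbitrary: g rule: siegel_prod.induct) (auto intro: siegel_prod.intros)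

lemma siegel_prod_comp: assumes "ndg V" "siegel_prod V g" "siegel_prod V h" shows "siegel_prod V (\<lambda>x. g (h x))"
  using assms(2)
proof induction
  case (siegel_prod_id g)
  then show ?case using siegel_prod_iso[OF assms(1,3)] by (intro siegel_prod_cong[OF assms(3)]) (auto dest: isoD(4))
next
  case (siegel_prod_step u w k g)
  show ?case by (rule siegel_prod.siegel_prod_step[OF siegel_prod_step.hyps(1-5) siegel_prod_step.IH])
    (use siegel_prod_step.hyps(7) siegel_prod_iso[OF assms(1,3)] in \<open>auto dest: isoD(4)\<close>)
qed

lemma siegel_prod_inv: assumes "ndg V" "siegel_prod V g"
  obtains h where "siegel_prod V h" "\<forall>x\<in>V. h (g x) = x" "\<forall>x\<in>V. g (h x) = x"
proof -
  have "\<exists>h. siegel_prod V h \<and> (\<forall>x\<in>V. h (g x) = x) \<and> (\<forall>x\<in>V. g (h x) = x)"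
    using assms(2)
  proof induction
    case (siegel_prod_id g)
    then show ?case by (intro exI[of _ id]) (auto intro: siegel_prod.siegel_prod_id)
  next
    case (siegel_prod_step u w k g)
    then obtain h where h: "siegel_prod V h" "\<forall>x\<in>V. h (k x) = x" "\<forall>x\<in>V. k (h x) = x" by blast
    note g = siegel_prod_step.hyps(7)
    have mw: "- w \<in> V" "b u (- w) = 0" using siegel_prod_step ndgD(1)[OF assms(1)] by (auto simp: subspace_neg)
    have inv: "sieg u (- w) (sieg u w x) = x" "sieg u w (sieg u (- w) x) = x" for x
      using sieg_add[OF siegel_prod_step.hyps(4) mw(2) siegel_prod_step.hyps(5)] sieg_add[OF siegel_prod_step.hyps(4,5) mw(2)] by simp_all
    note o = siegel_prod_sieg[OF siegel_prod_step.hyps(1) mw(1) siegel_prod_step.hyps(4) mw(2)]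
    have "h (sieg u (- w) x) \<in> V" "sieg u (- w) x \<in> V" if "x \<in> V" for x
      using isoD(4)[OF siegel_prod_iso[OF assms(1) h(1)]] isoD(4)[OF siegel_prod_iso[OF assms(1) o]] that by auto
    moreover have "k x \<in> V" if "x \<in> V" for x using isoD(4)[OF siegel_prod_iso[OF assms(1) siegel_prod_step.hyps(6)]] that .
    ultimately have "\<forall>x\<in>V. h (sieg u (- w) (g x)) = x" "\<forall>x\<in>V. g (h (sieg u (- w) x)) = x"
      using h inv g by auto
    then show ?case using siegel_prod_comp[OF assms(1) h(1) o] by blast
  qed
  then show ?thesis using that by blast
qed

text \<open>Conjugating by k replaces (u, w) by (k u, k w), so Omega is normal in the full isometry
  group.\<close>

lemma siegel_prod_conj:
  assumes "ndg V" "siegel_prod V h" "isometry V V k" "isometry V V k'" "\<forall>x\<in>V. k (k' x) = x"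
  shows "siegel_prod V (\<lambda>x. k (h (k' x)))"
  using assms(2)
proof induction
  case (siegel_prod_id h)
  then show ?case using assms isoD(4)[OF assms(4)] by (intro siegel_prod.siegel_prod_id) auto
next
  case (siegel_prod_step u w h1 h)
  note s = ndgD(1)[OF assms(1)]
  show ?case
  proof (rule siegel_prod.siegel_prod_step[OF _ _ _ _ _ siegel_prod_step.IH])
    show "k u \<in> V" "k w \<in> V" using isoD(4)[OF assms(3)] siegel_prod_step by auto
    show "Q (k u) = 0" "b (k u) (k w) = 0"
      using iso_Q[OF assms(3)] isoD(5)[OF assms(3)] siegel_prod_step by auto
    show "k u \<noteq> 0"
    proof
      assume "k u = 0"
      then have "u = 0" using inj_onD[OF iso_inj[OF assms(3,1)], of u 0] siegel_prod_step.hyps(1) iso_zero[OF assms(3) s] subspace_0[OF s] by simp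
      then show False using siegel_prod_step.hyps(3) by simp
    qed
    show "\<forall>x\<in>V. k (h (k' x)) = sieg (k u) (k w) (k (h1 (k' x)))"
      using iso_sieg_commute[OF assms(3) s siegel_prod_step.hyps(1,2)] siegel_prod_step.hyps(7) isoD(4)[OF assms(4)]
        isoD(4)[OF siegel_prod_iso[OF assms(1) siegel_prod_step.hyps(6)]] by auto
  qed
qed

text \<open>The two reflections lie in the same coset of Omega.\<close>

definition reflect_equiv :: "'v set \<Rightarrow> 'v \<Rightarrow> 'v \<Rightarrow> bool" where
  "reflect_equiv V v v' \<longleftrightarrow> siegel_prod V (\<lambda>x. reflect v (reflect v' x))"

lemma reflect_equiv_trans:
  assumes "ndg V" "reflect_equiv V v v'" "reflect_equiv V v' v''" "Q v' \<noteq> 0" shows "reflect_equiv V v v''"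
  using siegel_prod_comp[OF assms(1) assms(2,3)[unfolded reflect_equiv_def]] assms(4) by (simp add: reflect_equiv_def)

lemma reflect_equiv_sym:
  assumes "ndg V" "reflect_equiv V v v'" "v \<in> V" "Q v \<noteq> 0" "v' \<in> V" "Q v' \<noteq> 0" shows "reflect_equiv V v' v"
proof -
  obtain h where h: "siegel_prod V h" "\<forall>x\<in>V. h (reflect v (reflect v' x)) = x"
    using siegel_prod_inv[OF assms(1,2)[unfolded reflect_equiv_def]] by blast
  note i = isoD(4)[OF iso_reflect[OF assms(1,3,4)]] isoD(4)[OF iso_reflect[OF assms(1,5,6)]]
  have "reflect v' (reflect v x) = h x" if "x \<in> V" for x
    using bspec[OF h(2), of "reflect v' (reflect v x)"] i that assms(4,6) by simp
  then show ?thesis unfolding reflect_equiv_def by (intro siegel_prod_cong[OF h(1)]) blast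
qed

lemma reflect_equiv_cong: "(\<And>x. reflect v x = reflect u x) \<Longrightarrow> (\<And>x. reflect v' x = reflect u' x) \<Longrightarrow> reflect_equiv V v v' \<longleftrightarrow> reflect_equiv V u u'"
  by (simp add: reflect_equiv_def)

text \<open>The product of the reflections in v and g v is the commutator of the reflection in v
  with g, hence lies in Omega by normality.\<close>

lemma reflect_equiv_image:
  assumes "ndg V" "siegel_prod V g" "v \<in> V" "Q v \<noteq> 0" shows "reflect_equiv V v (g v)"
proof -
  note s = ndgD(1)[OF assms(1)] and ig = siegel_prod_iso[OF assms(1,2)] and ir = iso_reflect[OF assms(1,3,4)]
  obtain h where h: "siegel_prod V h" "\<forall>x\<in>V. g (h x) = x" using siegel_prod_inv[OF assms(1,2)] by blast
  have hV: "h x \<in> V" if "x \<in> V" for x using isoD(4)[OF siegel_prod_iso[OF assms(1) h(1)] that] .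
  have "siegel_prod V (\<lambda>x. reflect v (g (reflect v (h x))))"
    by (rule siegel_prod_comp[OF assms(1) siegel_prod_conj[OF assms(1,2) ir ir] h(1)]) (use assms(4) in simp)
  moreover have "reflect (g v) x = g (reflect v (h x))" if "x \<in> V" for x
    using iso_reflect_commute[OF ig s assms(3) hV[OF that]] bspec[OF h(2) that] by simp
  ultimately show ?thesis unfolding reflect_equiv_def by (auto intro: siegel_prod_cong)
qed

lemma scale_double: "(x * 2) *s v = x *s v + x *s v"
  by (simp only: mult_2_right scale_left_distrib)

text \<open>The orthogonal analogue of writing the Weyl element of SL_2 as a product of three
  alternating transvections. With k = Q(w), the product of the Siegel transformations for (e, w),
  (f, w/k) and (e, w) sends e to -f/k, f to -k e and w to -w, and fixes the vectors orthogonal to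
  these; so does the product of the reflections in w and f + k e.\<close>

lemma reflect_equiv_hyp:
  assumes "ndg V" "hyp V e f" "w \<in> perp2 V e f" "Q w \<noteq> 0"
  shows "reflect_equiv V w (f + Q w *s e)"
proof -
  define k where "k = Q w"
  note h = hypD[OF assms(2)]
  have w: "w \<in> V" "b w e = 0" "b w f = 0" "b e w = 0" "b f w = 0"
    using assms(3) perp2_swap[OF assms(3)] by (auto simp: perp2_def)
  have Q: "Q e = 0" "Q f = 0" "Q w = k" using h by (simp_all add: Q_def k_def)
  have k0: "k \<noteq> 0" using assms(4) k_def by simp
  let ?w = "(1/k) *s w"
  have Qw: "Q ?w = 1/k" using Q k0 by (simp add: Q_scale power2_eq_square)
  have eq: "sieg e w (sieg f ?w (sieg e w x)) = reflect w (reflect (f + k *s e) x)" for x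
  proof -
    define A B G where abc: "A = b x e" "B = b x f" "G = b x w"
    define y where "y = x + A *s w - (G + k * A) *s e"
    have y: "sieg e w x = y" using Q by (simp add: sieg_def y_def abc algebra_simps)
    have by': "b y e = A" "b y f = B - G - k * A" "b y w = G + 2 * k * A"
      using w h Q by (simp_all add: y_def b_simps abc b_self algebra_simps)
    define z where "z = x + ((B - G) / k) *s w - (G + k * A) *s e - ((B + k * A) / k) *s f"
    have z: "sieg f ?w y = z"
    proof -
      have "sieg f ?w y = y + ((B - G - k * A) / k) *s w
          - ((G + 2 * k * A) / k + (1/k) * (B - G - k * A)) *s f"
        unfolding sieg_def Qw b_scale2 by'
        by (simp only: scale_scale scale_left_distrib times_divide_eq_right times_divide_eq_left mult_1_right mult_1_left diff_diff_eq)
      also have "(G + 2 * k * A) / k + (1/k) * (B - G - k * A) = (B + k * A) / k"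
        using k0 by (simp add: field_simps)
      also have "(B - G - k * A) / k = (B - G) / k - A" using k0 by (simp add: field_simps)
      finally show ?thesis by (simp add: y_def z_def algebra_simps)
    qed
    have bz: "b z e = - (B / k)" "b z w = B + B - G"
      using w h Q k0 by (simp_all add: z_def b_simps abc b_self field_simps)
    have "sieg e w z = z - (B / k) *s w - (B + B - G) *s e + B *s e"
      unfolding sieg_def bz Q using k0 by (simp add: scale_double algebra_simps)
    also have "\<dots> = x - (G / k) *s w - (B + k * A) *s e - ((B + k * A) / k) *s f"
      by (simp add: z_def diff_divide_distrib scale_double algebra_simps)
    also have "\<dots> = reflect w (reflect (f + k *s e) x)"
    proof -
      have Qf: "Q (f + k *s e) = k" using Q h by (simp add: Q_add Q_scale b_simps)
      have r1: "reflect (f + k *s e) x = x - ((B + k * A) / k) *s f - (B + k * A) *s e"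
      proof -
        have bx: "b x (f + k *s e) = B + k * A" by (simp add: b_simps abc)
        have c: "(B + k * A) / k * k = B + k * A" using k0 by simp
        show ?thesis unfolding reflect_def Qf bx by (simp only: scale_right_distrib scale_scale c diff_diff_eq)
      qed
      have r2: "b (x - ((B + k * A) / k) *s f - (B + k * A) *s e) w = G"
        using w by (simp add: b_simps abc)
      show ?thesis unfolding r1 reflect_def[of w] r2 Q(3) by (simp only: diff_diff_eq ac_simps)
    qed
    finally show ?thesis using y z by simp
  qed
  have wV: "?w \<in> V" "b f ?w = 0" using w ndgD(1)[OF assms(1)] by (auto simp: subspace_scale b_simps)
  note oe = siegel_prod_sieg[OF h(1) w(1) Q(1) w(4)] and of' = siegel_prod_sieg[OF h(2) wV(1) Q(2) wV(2)]
  have "siegel_prod V (\<lambda>x. sieg e w (sieg f ?w (sieg e w x)))"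
    using siegel_prod_comp[OF assms(1) oe siegel_prod_comp[OF assms(1) of' oe]] .
  then show ?thesis unfolding reflect_equiv_def eq by (simp add: k_def)
qed

text \<open>The product is the diagonal map that scales e by \<alpha>/\<beta> and f by
  \<beta>/\<alpha>; what matters below is that it depends only on the ratio.\<close>

lemma reflect_ratio:
  assumes "hyp V e f" "\<alpha> \<noteq> 0" "\<beta> \<noteq> 0"
  shows "reflect (f + \<alpha> *s e) (reflect (f + \<beta> *s e) x)
    = x + ((\<beta> / \<alpha> - 1) * b x e) *s f + ((\<alpha> / \<beta> - 1) * b x f) *s e"
proof -
  note h = hypD[OF assms(1)]
  have Q: "Q e = 0" "Q f = 0" using h by (simp_all add: Q_def)
  have Qf: "Q (f + \<gamma> *s e) = \<gamma>" for \<gamma> using Q h by (simp add: Q_add Q_scale b_simps)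
  define A B where ab: "A = b x e" "B = b x f"
  define y where "y = x - (B / \<beta> + A) *s f - (B + \<beta> * A) *s e"
  have y: "reflect (f + \<beta> *s e) x = y"
  proof -
    have bx: "b x (f + \<beta> *s e) = B + \<beta> * A" by (simp add: b_simps ab)
    have c: "(B / \<beta> + A) * \<beta> = B + \<beta> * A" "(B + \<beta> * A) / \<beta> = B / \<beta> + A"
      using assms by (simp_all add: field_simps)
    show ?thesis unfolding reflect_def Qf bx y_def by (simp only: scale_right_distrib scale_scale c diff_diff_eq)
  qed
  have yb: "b y e = - (B / \<beta>)" "b y f = - (\<beta> * A)" using h by (simp_all add: y_def b_simps ab)
  have "reflect (f + \<alpha> *s e) y = y + (\<beta> * A / \<alpha> + B / \<beta>) *s f + (\<beta> * A + \<alpha> * B / \<beta>) *s e"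
  proof -
    have by': "b y (f + \<alpha> *s e) = - (\<beta> * A) - \<alpha> * B / \<beta>" by (simp add: b_simps yb)
    have c: "(- (\<beta> * A) - \<alpha> * B / \<beta>) / \<alpha> = - (\<beta> * A / \<alpha> + B / \<beta>)"
      "(\<beta> * A / \<alpha> + B / \<beta>) * \<alpha> = \<beta> * A + \<alpha> * B / \<beta>"
      using assms by (simp_all add: field_simps)
    show ?thesis unfolding reflect_def Qf by' c(1)
      by (simp only: mult_minus_left scale_minus_left minus_add_distrib[symmetric] diff_minus_eq_add scale_right_distrib scale_scale c(2) add.assoc)
  qed
  also have "\<dots> = x + ((\<beta> / \<alpha> - 1) * A) *s f + ((\<alpha> / \<beta> - 1) * B) *s e"
    by (simp add: y_def algebra_simps)
  finally show ?thesis using y ab by simp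
qed

subsection \<open>Transitivity on hyperbolic pairs\<close>

text \<open>Transitivity is shown first on lines; the scalar that remains is harmless, because later
  only square classes of values of Q matter.\<close>

definition line_equiv :: "'v set \<Rightarrow> 'v \<Rightarrow> 'v \<Rightarrow> bool" where
  "line_equiv V x y \<longleftrightarrow> (\<exists>g c. siegel_prod V g \<and> c \<noteq> 0 \<and> g x = c *s y)"

lemma line_equiv_trans: assumes "ndg V" "line_equiv V x y" "line_equiv V y z" "x \<in> V" "y \<in> V" "z \<in> V" shows "line_equiv V x z"
proof -
  obtain g c h d where g: "siegel_prod V g" "c \<noteq> 0" "g x = c *s y" "siegel_prod V h" "d \<noteq> 0" "h y = d *s z"
    using assms(2,3) by (auto simp: line_equiv_def)
  have "h (g x) = (c * d) *s z" using isoD(2)[OF siegel_prod_iso[OF assms(1) g(4)] assms(5)] g by simp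
  then show ?thesis using siegel_prod_comp[OF assms(1) g(4,1)] g unfolding line_equiv_def
    by (intro exI[of _ "\<lambda>x. h (g x)"] exI[of _ "c * d"]) simp
qed

lemma line_equiv_sym: assumes "ndg V" "line_equiv V x y" "x \<in> V" "y \<in> V" shows "line_equiv V y x"
proof -
  obtain g c where g: "siegel_prod V g" "c \<noteq> 0" "g x = c *s y" using assms(2) by (auto simp: line_equiv_def)
  show ?thesis
  proof (rule siegel_prod_inv[OF assms(1) g(1)])
    fix h assume h: "siegel_prod V h" "\<forall>x\<in>V. h (g x) = x"
    have "c *s h y = h (c *s y)" using isoD(2)[OF siegel_prod_iso[OF assms(1) h(1)] assms(4)] by simp
    also have "\<dots> = x" using bspec[OF h(2) assms(3)] unfolding g(3) .
    finally have "(1/c) *s (c *s h y) = (1/c) *s x" by (rule arg_cong)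
    then have "h y = (1/c) *s x" using g(2) by simp
    then show ?thesis unfolding line_equiv_def using h(1) g(2) by (intro exI[of _ h] exI[of _ "1/c"]) simp
  qed
qed

text \<open>The transformation with parameters f and w sends e to e + w - Q(w) f, and every singular
  x with \<open>b x f = 1\<close> has this form.\<close>

lemma sieg_reaches:
  assumes "hyp V e f" "Q x = 0" "b x f = 1" shows "sieg f (hproj e f x) e = x"
proof -
  note h = hypD[OF assms(1)]
  let ?w = "hproj e f x"
  have x: "x = e + b x e *s f + ?w" using hdecomp[of x f e] assms(3) by simp
  have bw: "b e ?w = 0" using h assms(3) b_sym[of e x] by (simp add: hproj_def b_simps)
  have bw': "b f ?w = 0" using h assms(3) b_sym[of f x] by (simp add: hproj_def b_simps)
  have "Q x = Q (e + b x e *s f + ?w)" using x by simp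
  also have "\<dots> = b x e + Q ?w"
    using bw bw' h by (simp add: Q_add Q_scale b_simps Q_eq_0[THEN iffD2])
  finally have "Q ?w = - b x e" using assms(2) by (simp add: eq_neg_iff_add_eq_0 add.commute)
  then have "sieg f ?w e = e + ?w + b x e *s f" using h bw by (simp add: sieg_def)
  then show ?thesis using x by (simp add: algebra_simps)
qed

lemma hyp_swap: "hyp V e f \<Longrightarrow> hyp V f e"
  by (auto simp: hyp_def b_sym)

lemma line_equiv_nonperp:
  assumes "ndg V" "hyp V e f" "x \<in> V" "Q x = 0" "b x f \<noteq> 0" shows "line_equiv V x e"
proof -
  note h = hypD[OF assms(2)] and s = ndgD(1)[OF assms(1)]
  let ?x = "(1 / b x f) *s x"
  have x: "?x \<in> V" "Q ?x = 0" "b ?x f = 1"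
    using assms s by (auto simp: subspace_scale Q_scale b_simps)
  let ?w = "hproj e f ?x"
  have w: "?w \<in> V" "b f ?w = 0" using hproj_in[OF assms(2) s x(1)] perp2_swap[OF hproj_in[OF assms(2) s x(1)]] by (auto simp: perp2_def)
  have "line_equiv V e x" unfolding line_equiv_def
    using siegel_prod_sieg[OF h(2) w(1) _ w(2)] sieg_reaches[OF assms(2) x(2,3)] assms(5) h(4)
    by (intro exI[of _ "sieg f ?w"] exI[of _ "1 / b x f"]) (simp add: Q_def)
  then show ?thesis using line_equiv_sym assms h by blast
qed

text \<open>If e is singular and \<open>b e y = 1\<close>, then Q(y - t e) = Q(y) - t, so t = Q(y)
  makes the partner singular.\<close>

lemma ex_hyp:
  assumes "ndg V" "e \<in> V" "e \<noteq> 0" "Q e = 0" obtains f where "hyp V e f"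
proof -
  obtain y where y: "y \<in> V" "b e y = 1" using ndg_ex_partner[OF assms(1-3)] by blast
  have "Q (y - Q y *s e) = 0" using y assms(4) b_sym[of y e] by (simp add: Q_diff Q_scale b_simps)
  then have z: "b (y - Q y *s e) (y - Q y *s e) = 0" "b e e = 0" using assms(4) by (simp_all only: Q_eq_0)
  then have "b e (y - Q y *s e) = 1" using y by (simp add: b_simps)
  then have "hyp V e (y - Q y *s e)"
    unfolding hyp_def using z assms y ndgD(1)[OF assms(1)] by (blast intro: subspace_diff subspace_scale)
  then show ?thesis using that by blast
qed

lemma line_equiv_singular:
  assumes "ndg V" "hyp V e f" "w0 \<in> perp2 V e f" "Q w0 \<noteq> 0" "x \<in> V" "x \<noteq> 0" "Q x = 0"
  shows "line_equiv V x e"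
proof -
  note h = hypD[OF assms(2)] and s = ndgD(1)[OF assms(1)] and hs = hyp_swap[OF assms(2)]
  have w0: "w0 \<in> V" "b w0 e = 0" "b w0 f = 0" "b e w0 = 0" "b f w0 = 0"
    using assms(3) perp2_swap[OF assms(3)] by (auto simp: perp2_def)
  \<comment> \<open>A singular vector orthogonal to neither e nor f. It links the lines of e and f;
    the nonsingular \<open>w0\<close> outside the plane is what makes it available.\<close>
  let ?z = "e + w0 - Q w0 *s f"
  have z: "?z \<in> V" "Q ?z = 0" "b ?z f \<noteq> 0" "b ?z e \<noteq> 0"
    using w0 h s assms(4) by (auto simp: subspace_add subspace_diff subspace_scale Q_add Q_diff Q_scale b_simps Q_eq_0[THEN iffD2])
  have fe: "line_equiv V f e"
    using line_equiv_trans[OF assms(1) line_equiv_sym[OF assms(1) line_equiv_nonperp[OF assms(1) hs z(1,2,4)] z(1) h(2)]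
        line_equiv_nonperp[OF assms(1,2) z(1-3)] h(2) z(1) h(1)] .
  consider "b x f \<noteq> 0" | "b x e \<noteq> 0" | "b x f = 0" "b x e = 0" by blast
  then show ?thesis
  proof cases
    case 1 then show ?thesis using line_equiv_nonperp assms by blast
  next
    case 2
    then show ?thesis using line_equiv_trans[OF assms(1) line_equiv_nonperp[OF assms(1) hs assms(5,7)] fe assms(5) h(2,1)] by blast
  next
    case 3
    have xW: "x \<in> perp2 V e f" using 3 assms(5) by (simp add: perp2_def)
    obtain f' where f': "hyp (perp2 V e f) x f'" using ex_hyp[OF ndg_perp2[OF assms(1,2)] xW assms(6,7)] by blast
    note h' = hypD[OF f']
    have f'V: "f' \<in> V" "b f' e = 0" "Q f' = 0" using h' by (auto simp: perp2_def Q_def)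
    \<comment> \<open>If x is orthogonal to e and f, a partner f' of x inside the complement gives a
      Siegel transformation that moves x to x + e, which is no longer orthogonal to f.\<close>
    have "sieg f' e x = x + e" using h' 3 h(3) by (simp add: sieg_def Q_def)
    then have 1: "line_equiv V x (x + e)" unfolding line_equiv_def
      using siegel_prod_sieg[OF f'V(1) h(1) f'V(3,2)] by (intro exI[of _ "sieg f' e"] exI[of _ 1]) simp
    have xe: "x + e \<in> V" "Q (x + e) = 0" "b (x + e) f \<noteq> 0"
      using assms(5,7) h s 3 by (auto simp: subspace_add Q_add b_simps Q_eq_0[THEN iffD2])
    show ?thesis using line_equiv_trans[OF assms(1) 1 line_equiv_nonperp[OF assms(1,2) xe] assms(5) xe(1) h(1)] .
  qed
qed

lemma hyp_transitive:
  assumes "ndg V" "hyp V e f" "w0 \<in> perp2 V e f" "Q w0 \<noteq> 0" "hyp V e' f'"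
  obtains g t where "siegel_prod V g" "t \<noteq> 0" "g e' = t *s e" "g f' = (1/t) *s f"
proof -
  note h = hypD[OF assms(2)] and h' = hypD[OF assms(5)] and s = ndgD(1)[OF assms(1)]
  have Q: "Q e = 0" "Q f = 0" "Q e' = 0" "Q f' = 0" using h h' by (simp_all add: Q_def)
  have "e' \<noteq> 0" using h'(5) by auto
  then obtain g t where g: "siegel_prod V g" "t \<noteq> 0" "g e' = t *s e"
    using line_equiv_singular[OF assms(1-4) h'(1) _ Q(3)] by (auto simp: line_equiv_def)
  note ig = siegel_prod_iso[OF assms(1) g(1)]
  let ?f = "g f'"
  have f: "?f \<in> V" "Q ?f = 0" "b (t *s e) ?f = 1"
    using isoD(4)[OF ig h'(2)] iso_Q[OF ig h'(2)] isoD(5)[OF ig h'(1,2)] Q h' g by auto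
  let ?x = "t *s ?f"
  have x: "?x \<in> V" "Q ?x = 0" "b ?x e = 1"
    using f s b_sym[of ?f e] by (auto simp: subspace_scale Q_scale b_simps)
  let ?w = "hproj f e ?x"
  have w: "?w \<in> V" "b e ?w = 0"
    using hproj_in[OF hyp_swap[OF assms(2)] s x(1)] perp2_swap[OF hproj_in[OF hyp_swap[OF assms(2)] s x(1)]] by (auto simp: perp2_def)
  have mw: "- ?w \<in> V" "b e (- ?w) = 0" using w s by (auto simp: subspace_neg)
  \<comment> \<open>Once the line of e' is in place, the second vector is corrected by a Siegel
    transformation with parameter e, which fixes e.\<close>
  have "sieg e ?w f = ?x" using sieg_reaches[OF hyp_swap[OF assms(2)] x(2,3)] .
  then have 1: "sieg e (- ?w) ?x = f" using sieg_add[OF Q(1) mw(2) w(2), of f] by simp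
  have o: "siegel_prod V (sieg e (- ?w))" using siegel_prod_sieg[OF h(1) mw(1) Q(1) mw(2)] .
  have "t *s sieg e (- ?w) ?f = f" using 1 isoD(2)[OF siegel_prod_iso[OF assms(1) o] f(1)] by simp
  from arg_cong[OF this, of "\<lambda>y. (1/t) *s y"] have 2: "sieg e (- ?w) ?f = (1/t) *s f" using g(2) by simp
  have 3: "sieg e (- ?w) (t *s e) = t *s e" using h b_sym[of e ?w] w(2) by (simp add: sieg_def b_simps)
  show ?thesis using that[OF siegel_prod_comp[OF assms(1) o g(1)] g(2)] 2 3 g(3) by simp
qed

text \<open>Modulo Omega every reflection is one in a vector f + \<alpha> e of a fixed hyperbolic
  plane, where \<alpha> is Q(v) times a square; and \<alpha> can be changed by any nonzero
  square.\<close>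

lemma reflect_equiv_square_class:
  assumes "ndg V" "hyp V e f" "w0 \<in> perp2 V e f" "Q w0 \<noteq> 0"
    and v: "v \<in> V" "Q v \<noteq> 0" and v': "v' \<in> V" "Q v' \<noteq> 0" and c: "c \<noteq> 0" "Q v = c\<^sup>2 * Q v'"
  shows "reflect_equiv V v v'"
proof -
  note h = hypD[OF assms(2)] and s = ndgD(1)[OF assms(1)]
  have Q0: "Q e = 0" "Q f = 0" using h by (simp_all add: Q_def)
  let ?u = "\<lambda>\<alpha>. f + \<alpha> *s e"
  have u: "?u \<alpha> \<in> V" "Q (?u \<alpha>) = \<alpha>" for \<alpha>
    using h s Q0 by (auto simp: subspace_add subspace_scale Q_add Q_scale b_simps)
  \<comment> \<open>The vectors w0 and t w0 have the same reflection but values of Q that differ by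
    t^2, so \<open>reflect_equiv_hyp\<close> applies to both. This compares \<alpha> = Q(w0) with
    its multiple by t^2; since only the ratio enters, the result holds for every \<alpha>.\<close>
  have scaled: "reflect_equiv V (?u \<alpha>) (?u (t\<^sup>2 * \<alpha>))" if "\<alpha> \<noteq> 0" "t \<noteq> 0" for \<alpha> t
  proof -
    let ?k = "Q w0"
    have w0: "w0 \<in> V" using assms(3) by (simp add: perp2_def)
    have tw: "t *s w0 \<in> perp2 V e f" "Q (t *s w0) = t\<^sup>2 * ?k"
      using subspace_scale[OF subspace_perp2[OF s] assms(3)] by (auto simp: Q_scale)
    have 1: "reflect_equiv V (?u ?k) w0"
      using reflect_equiv_sym[OF assms(1) reflect_equiv_hyp[OF assms(1-4)] w0 assms(4) u(1)] u(2) assms(4) by simp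
    have "reflect_equiv V (t *s w0) (?u (t\<^sup>2 * ?k))"
      using reflect_equiv_hyp[OF assms(1,2) tw(1)] tw(2) that assms(4) by simp
    then have 2: "reflect_equiv V w0 (?u (t\<^sup>2 * ?k))"
      using reflect_equiv_cong[of "t *s w0" w0 "?u (t\<^sup>2 * ?k)" "?u (t\<^sup>2 * ?k)" V] reflect_scale[OF that(2)] by simp
    have "reflect_equiv V (?u ?k) (?u (t\<^sup>2 * ?k))" using reflect_equiv_trans[OF assms(1) 1 2 assms(4)] .
    moreover have "reflect (?u ?k) (reflect (?u (t\<^sup>2 * ?k)) x) = reflect (?u \<alpha>) (reflect (?u (t\<^sup>2 * \<alpha>)) x)" for x
      using reflect_ratio[OF assms(2), of ?k "t\<^sup>2 * ?k"] reflect_ratio[OF assms(2), of \<alpha> "t\<^sup>2 * \<alpha>"] that assms(4)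
      by simp
    ultimately show ?thesis by (simp add: reflect_equiv_def)
  qed
  have normal: "\<exists>t. t \<noteq> 0 \<and> reflect_equiv V v (?u (t\<^sup>2 * Q v))" if v: "v \<in> V" "Q v \<noteq> 0" for v
  proof -
    \<comment> \<open>If all singular vectors were orthogonal to v, so would be e, f and the
      singular vector e + v - Q(v) f, which forces 2 Q(v) = 0.\<close>
    have "\<exists>e1\<in>V. Q e1 = 0 \<and> b e1 v \<noteq> 0"
    proof (rule ccontr)
      assume "\<not> ?thesis"
      then have z: "b e1 v = 0" if "e1 \<in> V" "Q e1 = 0" for e1 using that by blast
      have "b e v = 0" "b f v = 0" using z h Q0 by auto
      then have vW: "v \<in> perp2 V e f" using v b_sym by (simp add: perp2_def)
      let ?z = "e + v - Q v *s f"
      have "?z \<in> V" "Q ?z = 0"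
        using v h s Q0 \<open>b e v = 0\<close> \<open>b f v = 0\<close> b_sym[of v f]
        by (auto simp: subspace_add subspace_diff subspace_scale Q_add Q_diff Q_scale b_simps)
      then have "b ?z v = 0" using z by blast
      then have "2 * Q v = 0" using \<open>b e v = 0\<close> \<open>b f v = 0\<close> by (simp add: b_simps b_self)
      then show False using v two by simp
    qed
    then obtain e1 where e1: "e1 \<in> V" "Q e1 = 0" "b e1 v \<noteq> 0" by blast
    define e2 where "e2 = (1 / b e1 v) *s e1"
    \<comment> \<open>Now v = ?f + Q(v) e2 with (e2, ?f) hyperbolic, and moving this pair to a
      rescaling of (e, f) puts v in the desired form up to a scalar.\<close>
    let ?f = "v - Q v *s e2"
    have ev: "e2 \<in> V" "Q e2 = 0" "b e2 v = 1" using e1 s by (auto simp: e2_def subspace_scale Q_scale b_simps)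
    have "Q ?f = 0" using ev b_sym[of v e2] by (simp add: Q_diff Q_scale b_simps)
    then have z: "b ?f ?f = 0" "b e2 e2 = 0" using ev(2) by (simp_all only: Q_eq_0)
    have "b e2 ?f = 1" using ev(3) z(2) by (simp add: b_simps)
    then have hf: "hyp V e2 ?f"
      unfolding hyp_def using z ev(1) v s by (blast intro: subspace_diff subspace_scale)
    obtain g t where g: "siegel_prod V g" "t \<noteq> 0" "g e2 = t *s e" "g ?f = (1/t) *s f"
      using hyp_transitive[OF assms(1-4) hf] by blast
    note ig = siegel_prod_iso[OF assms(1) g(1)]
    have "g v = g (?f + Q v *s e2)" by simp
    also have "\<dots> = g ?f + Q v *s g e2"
      by (simp only: isoD(1)[OF ig hypD(2)[OF hf] subspace_scale[OF s ev(1)]] isoD(2)[OF ig ev(1)])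
    also have "\<dots> = (1/t) *s ?u (t\<^sup>2 * Q v)"
      unfolding g(3,4) using g(2) by (simp add: scale_right_distrib power2_eq_square mult.commute)
    finally have "reflect (g v) x = reflect (?u (t\<^sup>2 * Q v)) x" for x
      using reflect_scale[of "1/t"] g(2) by simp
    then have "reflect_equiv V v (?u (t\<^sup>2 * Q v))"
      using reflect_equiv_image[OF assms(1) g(1) v] reflect_equiv_cong[of v v "g v" "?u (t\<^sup>2 * Q v)" V] by simp
    then show ?thesis using g(2) by blast
  qed
  obtain t where t: "t \<noteq> 0" "reflect_equiv V v (?u (t\<^sup>2 * Q v))" using normal[OF v] by blast
  obtain t' where t': "t' \<noteq> 0" "reflect_equiv V v' (?u (t'\<^sup>2 * Q v'))" using normal[OF v'] by blast
  have nz: "t\<^sup>2 * Q v \<noteq> 0" "t'\<^sup>2 * Q v' \<noteq> 0" using t t' v v' by auto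
  have eq: "t'\<^sup>2 * Q v' = (t' / (c * t))\<^sup>2 * (t\<^sup>2 * Q v)"
    using c t by (simp add: power_divide power_mult_distrib field_simps)
  have "t' / (c * t) \<noteq> 0" using c t t' by simp
  then have "reflect_equiv V (?u (t\<^sup>2 * Q v)) (?u (t'\<^sup>2 * Q v'))"
    unfolding eq by (rule scaled[OF nz(1)])
  then have r1: "reflect_equiv V v (?u (t'\<^sup>2 * Q v'))"
    by (rule reflect_equiv_trans[OF assms(1) t(2)]) (simp only: u(2) nz not_False_eq_True)
  have r2: "reflect_equiv V (?u (t'\<^sup>2 * Q v')) v'"
    by (rule reflect_equiv_sym[OF assms(1) t'(2) v' u(1)]) (simp only: u(2) nz not_False_eq_True)
  show ?thesis by (rule reflect_equiv_trans[OF assms(1) r1 r2]) (simp only: u(2) nz not_False_eq_True)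
qed

text \<open>Modulo Omega there are only two reflections, in va and in vb, and these commute. So each
  isometry is an element of Omega times a product of some of the two, and the two characters detect
  which of them occur.\<close>

theorem siegel_prod_if_theta:
  assumes "ndg V" "hyp V e f" "w0 \<in> perp2 V e f" "Q w0 \<noteq> 0"
    and d: "d \<noteq> 0" "\<And>x. x\<^sup>2 \<noteq> d"
    and va: "va \<in> V" "Q va = 1" and vb: "vb \<in> V" "Q vb = d" and ab: "b va vb = 0"
    and g: "isometry V V g" "theta V 1 g = 1" "theta V d g = 1"
  shows "siegel_prod V g"
proof -
  note s = ndgD(1)[OF assms(1)]
  let ?S = "{v \<in> V. Q v \<noteq> 0}"
  let ?A = "reflect va" and ?C = "reflect vb"
  define H where "H = (\<lambda>i j x. (if i then ?A else id) ((if j then ?C else id) x))"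
  have nz: "Q va \<noteq> 0" "Q vb \<noteq> 0" using va vb d by auto
  note iA = iso_reflect[OF assms(1) va(1) nz(1)] and iC = iso_reflect[OF assms(1) vb(1) nz(2)]
  have comm: "?A (?C x) = ?C (?A x)" for x
    using ab b_sym[of vb va] by (simp add: reflect_def b_simps algebra_simps)
  have AH: "?A (H i j x) = H (\<not> i) j x" and CH: "?C (H i j x) = H i (\<not> j) x" for i j x
    using nz comm by (auto simp: H_def)
  have iH: "isometry V V (H i j)" for i j
    using iA iC iso_comp[OF iC iA] iso_ident by (cases i; cases j) (auto simp: H_def id_def)
  have red: "\<exists>w i j. siegel_prod V w \<and> (\<forall>x\<in>V. foldr reflect vs x = w (H i j x))" if "set vs \<subseteq> ?S" for vs
    using that
  proof (induction vs)
    case Nil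
    show ?case by (rule exI[of _ id], rule exI[of _ False], rule exI[of _ False]) (auto simp: H_def intro: siegel_prod_id)
  next
    case (Cons v vs)
    then obtain w i j where w: "siegel_prod V w" "\<And>x. x \<in> V \<Longrightarrow> foldr reflect vs x = w (H i j x)" by auto
    have v: "v \<in> V" "Q v \<noteq> 0" using Cons by auto
    have wit: "\<exists>w' i' j'. siegel_prod V w' \<and> (\<forall>x\<in>V. foldr reflect (v # vs) x = w' (H i' j' x))"
      if u: "u \<in> V" "Q u \<noteq> 0" "reflect_equiv V v u" "\<And>x. reflect u (H i j x) = H i' j' x" for u i' j'
    proof -
      note iu = iso_reflect[OF assms(1) u(1,2)]
      \<comment> \<open>A new reflection in v is moved past w: (r_v r_u)(r_u w r_u) r_u, where both
        brackets lie in Omega and the last r_u is absorbed into \<open>H\<close>.\<close>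
      let ?w = "\<lambda>x. reflect v (reflect u (reflect u (w (reflect u x))))"
      have "siegel_prod V ?w"
        by (rule siegel_prod_comp[OF assms(1) u(3)[unfolded reflect_equiv_def] siegel_prod_conj[OF assms(1) w(1) iu iu]]) (use u(2) in simp)
      moreover have "foldr reflect (v # vs) x = ?w (H i' j' x)" if "x \<in> V" for x
        using w(2)[OF that] u(2) by (simp flip: u(4))
      ultimately show ?thesis by blast
    qed
    show ?case
    proof (cases "\<exists>c. c\<^sup>2 = Q v")
      case True
      then obtain c where c: "c\<^sup>2 = Q v" by blast
      then have "c \<noteq> 0" using v(2) by auto
      then have "reflect_equiv V v va" using reflect_equiv_square_class[OF assms(1-4) v va(1) nz(1), of c] c va by simp
      then show ?thesis using wit[OF va(1) nz(1) _ AH] by blast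
    next
      case False
      then obtain t where "t \<noteq> 0" "Q v = d * t\<^sup>2"
        using nonsquare_ratio[OF two d(1) v(2) d(2)] by blast
      then have "reflect_equiv V v vb" using reflect_equiv_square_class[OF assms(1-4) v vb(1) nz(2), of t] vb by (simp add: mult.commute)
      then show ?thesis using wit[OF vb(1) nz(2) _ CH] by blast
    qed
  qed
  obtain vs where vs: "set vs \<subseteq> ?S" "\<And>x. x \<in> V \<Longrightarrow> g x = foldr reflect vs x"
    using isometry_product_of_reflections[OF assms(1) g(1)] by blast
  then obtain w i j where w: "siegel_prod V w" "\<And>x. x \<in> V \<Longrightarrow> g x = w (H i j x)" using red by metis
  have thA: "theta V 1 ?A = - 1" "theta V d ?A = 1"
    using theta_reflect[OF assms(1) va(1) nz(1)] d va(2) by (auto intro: exI[of _ 1])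
  have no: "s\<^sup>2 * d \<noteq> 1" for s
  proof
    assume "s\<^sup>2 * d = 1"
    then have "(1/s)\<^sup>2 = d" by (metis eq_divide_imp mult.commute mult_zero_left power_one_over zero_neq_one)
    then show False using d(2) by blast
  qed
  have thC: "theta V 1 ?C = 1" "theta V d ?C = - 1"
    using theta_reflect[OF assms(1) vb(1) nz(2)] d(1) vb(2) no by (auto intro: exI[of _ 1])
  have thH: "theta V c g = theta V c (H i j)" if "c \<noteq> 0" for c
  proof -
    have "theta V c g = theta V c (\<lambda>x. w (H i j x))" by (rule theta_cong) (rule w(2))
    then show ?thesis
      using theta_comp[OF assms(1) siegel_prod_iso[OF assms(1) w(1)] iH that] siegel_prod_theta[OF assms(1) w(1) that] by simp
  qed
  have "theta V 1 (H i j) = (if i then - 1 else 1)" "theta V d (H i j) = (if j then - 1 else 1)"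
    using theta_comp[OF assms(1) iA iC] thA thC d(1) theta_id[of V id]
    by (cases i; cases j; simp add: H_def id_def theta_id)+
  then have "\<not> i" "\<not> j" using thH[of 1] thH[OF d(1)] g by (auto split: if_splits)
  then show ?thesis using w by (intro siegel_prod_cong[OF w(1)]) (simp add: H_def)
qed

end

lemma card_eq_twice_kernel:
  fixes th :: "'b \<Rightarrow> int"
  assumes "finite S" "\<And>x. x \<in> S \<Longrightarrow> f x \<in> S" "\<And>x. x \<in> S \<Longrightarrow> f (f x) = x"
    "\<And>x. x \<in> S \<Longrightarrow> th (f x) = - th x" "\<And>x. x \<in> S \<Longrightarrow> th x = 1 \<or> th x = - 1"
  shows "card S = 2 * card {x \<in> S. th x = 1}"
proof -
  have "bij_betw f {x \<in> S. th x = 1} {x \<in> S. th x = - 1}"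
    by (rule bij_betw_byWitness[where f' = f]) (use assms in auto)
  then have c: "card {x \<in> S. th x = - 1} = card {x \<in> S. th x = 1}"
    using bij_betw_same_card by fastforce
  have "S = {x \<in> S. th x = 1} \<union> {x \<in> S. th x = - 1}" using assms(5) by blast
  then have "card S = card ({x \<in> S. th x = 1} \<union> {x \<in> S. th x = - 1})" by (rule arg_cong)
  also have "\<dots> = card {x \<in> S. th x = 1} + card {x \<in> S. th x = - 1}"
    by (rule card_Un_disjoint) (use assms(1) in auto)
  finally show ?thesis using c by simp
qed

section \<open>Orthogonal bases and the characters of involutions\<close>

context orth_space begin

text \<open>The value of \<open>theta V c\<close> on a reflection in a vector with Q = t, provided c
  and t are nonzero.\<close>

definition chi :: "'a \<Rightarrow> 'a \<Rightarrow> int" where "chi c t = (if \<exists>s. s\<^sup>2 * t = c then - 1 else 1)"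

text \<open>In dimension at least 2 there are two orthogonal nonsingular vectors, and a binary form
  over a finite field takes every value.\<close>

lemma represents:
  assumes "ndg A" "card A > CARD('a)" obtains v where "v \<in> A" "Q v = t"
proof -
  note s = ndgD(1)[OF assms(1)]
  have "A \<noteq> {0}" using assms(2) by auto
  then obtain u where u: "u \<in> A" "Q u \<noteq> 0" using ex_nonsingular assms(1) by blast
  have "perp1 A u \<noteq> {0}" using card_perp1[OF s u] assms(2) by auto
  then obtain w where w: "w \<in> perp1 A u" "Q w \<noteq> 0" using ex_nonsingular ndg_perp1[OF assms(1) u] by blast
  obtain x y where xy: "Q u * x\<^sup>2 + Q w * y\<^sup>2 = t"
    using binary_form_represents[OF two u(2) w(2)] by blast
  have "b u w = 0" using w(1) b_sym[of u w] by (simp add: perp1_def)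
  then have "Q (x *s u + y *s w) = t" using xy by (simp add: Q_add Q_scale b_simps mult.commute)
  moreover have "x *s u + y *s w \<in> A" using u w s by (auto simp: perp1_def subspace_add subspace_scale)
  ultimately show ?thesis using that by blast
qed

text \<open>The values of Q along an orthogonal basis, chosen one vector at a time in successive
  complements. Equal lists give isometric spaces.\<close>

inductive diag_values :: "'v set \<Rightarrow> 'a list \<Rightarrow> bool" where
  diag_values_Nil: "diag_values {0} []"
| diag_values_Cons: "ndg A \<Longrightarrow> v \<in> A \<Longrightarrow> Q v = t \<Longrightarrow> t \<noteq> 0 \<Longrightarrow> diag_values (perp1 A v) ts \<Longrightarrow> diag_values A (t # ts)"

lemma diag_values_card: "diag_values A ts \<Longrightarrow> card A = CARD('a) ^ length ts"
proof (induction rule: diag_values.induct)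
  case (diag_values_Cons A v t ts)
  then show ?case using card_perp1[OF ndgD(1)[OF diag_values_Cons(1)] diag_values_Cons(2)] by simp
qed simp

lemma diag_values_iso: "diag_values A ts \<Longrightarrow> diag_values A' ts \<Longrightarrow> \<exists>h. isometry A A' h"
proof (induction arbitrary: A' rule: diag_values.induct)
  case diag_values_Nil
  then have "A' = {0}" by (cases rule: diag_values.cases) auto
  then show ?case using iso_ident(1) by blast
next
  case (diag_values_Cons A v t ts)
  from diag_values_Cons.prems obtain v' where v': "ndg A'" "v' \<in> A'" "Q v' = t" "diag_values (perp1 A' v') ts"
    by (cases rule: diag_values.cases) auto
  obtain h where "isometry (perp1 A v) (perp1 A' v') h" using diag_values_Cons.IH[OF v'(4)] by blast
  from iso_vext[OF diag_values_Cons.hyps(1) ndgD(1)[OF v'(1)] diag_values_Cons.hyps(2) _ v'(2) _ this]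
  show ?case using diag_values_Cons.hyps(3,4) v'(3) by blast
qed

text \<open>The value 1 is represented as long as the dimension exceeds 1, so all entries but the
  last can be 1; on the final line rescaling reaches 1 or d according to the square class.\<close>

lemma diag_values_exists:
  assumes "d \<noteq> 0" "\<forall>x. x\<^sup>2 \<noteq> d" "ndg A" "A \<noteq> {0}"
  shows "\<exists>m t. diag_values A (replicate m 1 @ [t]) \<and> (t = 1 \<or> t = d)"
  using assms(3,4)
proof (induction "card A" arbitrary: A rule: less_induct)
  case less
  note s = ndgD(1)[OF less(2)]
  show ?case
  proof (cases "card A > CARD('a)")
    case True
    obtain v where v: "v \<in> A" "Q v = 1" using represents[OF less(2) True] by blast
    then have v0: "Q v \<noteq> 0" by simp
    have "perp1 A v \<noteq> {0}" using card_perp1[OF s v(1) v0] True by auto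
    then obtain m t where "diag_values (perp1 A v) (replicate m 1 @ [t])" "t = 1 \<or> t = d"
      using less(1)[OF card_perp1_less[OF less(2) v(1) v0] ndg_perp1[OF less(2) v(1) v0]] by blast
    then show ?thesis using diag_values_Cons[OF less(2) v _ \<open>diag_values (perp1 A v) (replicate m 1 @ [t])\<close>]
      by (intro exI[of _ "Suc m"] exI[of _ t]) simp
  next
    case False
    obtain u where u: "u \<in> A" "Q u \<noteq> 0" using ex_nonsingular less(2,3) by blast
    have "\<exists>c t. c \<noteq> 0 \<and> c\<^sup>2 * Q u = t \<and> (t = 1 \<or> t = d)"
    proof (cases "\<exists>x. x\<^sup>2 = Q u")
      case True
      then obtain x where "x\<^sup>2 = Q u" by blast
      then show ?thesis using u(2) by (intro exI[of _ "1/x"] exI[of _ 1]) (auto simp: power_one_over)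
    next
      case False
      then obtain x where "x \<noteq> 0" "Q u = d * x\<^sup>2"
        using nonsquare_ratio[OF two assms(1) u(2)] assms(2) by blast
      then show ?thesis by (intro exI[of _ "1/x"] exI[of _ d]) (simp add: power_one_over)
    qed
    then obtain c t where c: "c \<noteq> 0" "c\<^sup>2 * Q u = t" "t = 1 \<or> t = d" by blast
    let ?v = "c *s u"
    have v: "?v \<in> A" "Q ?v = t" "t \<noteq> 0" using u c s assms(1) by (auto simp: subspace_scale Q_scale)
    then have v0: "Q ?v \<noteq> 0" by simp
    have "0 \<in> perp1 A ?v" using subspace_0[OF subspace_perp1[OF s]] .
    moreover have "card (perp1 A ?v) = 1"
    proof -
      have "CARD('a) * card (perp1 A ?v) \<le> CARD('a) * 1" using card_perp1[OF s v(1) v0] False by simp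
      then have "card (perp1 A ?v) \<le> 1" using card_UNIV_gt_1[where 'a = 'a] by (simp only: mult_le_cancel1)
      moreover have "card (perp1 A ?v) \<noteq> 0"
        using \<open>0 \<in> perp1 A ?v\<close> ndgD(2)[OF ndg_perp1[OF less(2) v(1) v0]] by auto
      ultimately show ?thesis by simp
    qed
    ultimately have "perp1 A ?v = {0}" by (metis card_1_singletonE singletonD)
    then have "diag_values A [t]" using diag_values_Cons[OF less(2) v] diag_values_Nil by simp
    then show ?thesis using c(3) by (intro exI[of _ 0] exI[of _ t]) simp
  qed
qed

text \<open>A map that is -1 on A and the identity on its complement is the product of the
  reflections in an orthogonal basis of A. The induction strips off one reflection and shrinks A
  accordingly.\<close>

lemma theta_diag_values:
  assumes "ndg V" "c \<noteq> 0" "diag_values A ts" "A \<subseteq> V"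
    and "isometry V V g" "\<And>x. x \<in> A \<Longrightarrow> g x = - x" "\<And>x. x \<in> V \<Longrightarrow> (\<And>y. y \<in> A \<Longrightarrow> b x y = 0) \<Longrightarrow> g x = x"
  shows "theta V c g = prod_list (map (chi c) ts)"
  using assms(3-)
proof (induction arbitrary: g rule: diag_values.induct)
  case diag_values_Nil
  then show ?case by (auto intro: theta_id)
next
  case (diag_values_Cons A v t ts)
  note s = ndgD(1)[OF assms(1)]
  have vA: "v \<in> A" "v \<in> V" and v0: "Q v \<noteq> 0" using diag_values_Cons by auto
  note ir = iso_reflect[OF assms(1) vA(2) v0]
  note ig = diag_values_Cons.prems(2)
  let ?g = "\<lambda>x. reflect v (g x)"
  have "theta V c ?g = prod_list (map (chi c) ts)"
  proof (rule diag_values_Cons.IH)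
    show "perp1 A v \<subseteq> V" using diag_values_Cons.prems(1) by (auto simp: perp1_def)
    show "isometry V V ?g" by (rule iso_comp[OF ig ir])
    show "?g x = - x" if "x \<in> perp1 A v" for x
      using that diag_values_Cons.prems(3)[of x] by (auto simp: perp1_def reflect_perp)
    fix x assume x: "x \<in> V" "\<And>y. y \<in> perp1 A v \<Longrightarrow> b x y = 0"
    \<comment> \<open>For x orthogonal to the smaller space, the component along v is negated twice,
      by g and by the reflection, while y is orthogonal to all of A and fixed by both.\<close>
    define e y where "e = (b x v / (2 * Q v)) *s v" and "y = vproj v x"
    have xe: "x = e + y" using vdecomp[of x v] by (simp add: e_def y_def)
    have e: "e \<in> V" "g e = - e" "reflect v e = - e"
    proof -
      show "e \<in> V" using vA s by (simp add: e_def subspace_scale)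
      show "g e = - e" using diag_values_Cons.prems(3)[OF vA(1)] isoD(2)[OF ig vA(2)] by (simp add: e_def)
      show "reflect v e = - e" using isoD(2)[OF ir vA(2)] reflect_self[OF v0] by (simp add: e_def)
    qed
    have y: "y \<in> V" "b y v = 0" using vproj_in[OF s vA(2) v0 x(1)] by (auto simp: y_def perp1_def)
    have "b y z = 0" if z: "z \<in> A" for z
    proof -
      have p: "vproj v z \<in> perp1 A v" using vproj_in[OF ndgD(1)[OF diag_values_Cons.hyps(1)] vA(1) v0 z] .
      have "b y (vproj v z) = 0"
        using x(2)[OF p] p b_sym[of v "vproj v z"] by (simp add: y_def vproj_def[of v x] b_simps perp1_def)
      then show ?thesis using vdecomp[of z v] y(2) by (metis add.right_neutral b_add2 b_scale2 mult_zero_right)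
    qed
    then have gy: "g y = y" using diag_values_Cons.prems(4)[OF y(1)] by blast
    have "g x = - e + y" using isoD(1)[OF ig e(1) y(1)] e(2) gy xe by simp
    then have "?g x = reflect v (- e) + reflect v y"
      using isoD(1)[OF ir subspace_neg[OF s e(1)] y(1)] by simp
    also have "\<dots> = x" using iso_neg[OF ir e(1)] e(3) reflect_perp[OF y(2)] xe by simp
    finally show "?g x = x" .
  qed
  moreover have "theta V c g = theta V c (\<lambda>x. reflect v (?g x))"
    by (rule theta_cong) (use v0 in simp)
  moreover have "\<dots> = theta V c (reflect v) * theta V c ?g"
    by (rule theta_comp[OF assms(1) ir iso_comp[OF ig ir] assms(2)])
  moreover have "theta V c (reflect v) = chi c t"
    using theta_reflect[OF assms(1) vA(2) v0 assms(2)] diag_values_Cons.hyps(3) by (simp add: chi_def)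
  ultimately show ?case by simp
qed

lemma theta_involution:
  assumes "ndg V" "c \<noteq> 0" "isometry V V g" "\<forall>x\<in>V. g (g x) = x" "diag_values (mneg V g) ts"
  shows "theta V c g = prod_list (map (chi c) ts)"
proof (rule theta_diag_values[OF assms(1,2,5) _ assms(3)])
  show "mneg V g \<subseteq> V" "\<And>x. x \<in> mneg V g \<Longrightarrow> g x = - x" by (auto simp: mneg_def)
  fix x assume x: "x \<in> V" "\<And>y. y \<in> mneg V g \<Longrightarrow> b x y = 0"
  note p = nproj[OF assms(3) ndgD(1)[OF assms(1)] assms(4) x(1)]
  have "nproj g x = 0"
  proof (rule ndg_zeroI[OF ndg_mneg[OF assms(3,1,4)] p(1)])
    fix y assume y: "y \<in> mneg V g"
    have "b (x - nproj g x) y = 0" using mneg_perp_mfix[OF assms(3) y p(2)] b_sym by metis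
    then show "b (nproj g x) y = 0" using x(2)[OF y] by (simp add: b_diff)
  qed
  then show "g x = x" using p(2) by (simp add: mfix_def)
qed

text \<open>Negate the first j vectors of the orthogonal basis and fix the others.\<close>

lemma ex_involution:
  assumes "diag_values V (replicate j 1 @ ts)" "ndg V"
  shows "\<exists>g. isometry V V g \<and> (\<forall>x\<in>V. g (g x) = x) \<and> diag_values (mneg V g) (replicate j 1)"
  using assms
proof (induction j arbitrary: V)
  case 0
  have "mneg V (\<lambda>x. x) = {0}" using two_cancel subspace_0[OF ndgD(1)[OF 0(2)]] by (auto simp: mneg_def)
  then show ?case using diag_values_Nil iso_ident(1) by (intro exI[of _ "\<lambda>x. x"]) simp
next
  case (Suc j)
  from Suc(2) obtain v where v: "v \<in> V" "Q v = 1" "diag_values (perp1 V v) (replicate j 1 @ ts)"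
    by (cases rule: diag_values.cases) auto
  have v0: "Q v \<noteq> 0" using v by simp
  note s = ndgD(1)[OF Suc(3)]
  let ?W = "perp1 V v"
  obtain g where g: "isometry ?W ?W g" "\<forall>x\<in>?W. g (g x) = x" "diag_values (mneg ?W g) (replicate j 1)"
    using Suc.IH[OF v(3) ndg_perp1[OF Suc(3) v(1) v0]] by blast
  let ?G = "vext v (- v) g"
  have W': "perp1 V (- v) = ?W" by (simp add: perp1_def)
  have iG: "isometry V V ?G"
    by (rule iso_vext[OF Suc(3) s v(1) v0]) (use v s g W' in \<open>auto simp: subspace_neg\<close>)
  have g0: "g 0 = 0" using iso_zero[OF g(1) subspace_perp1[OF s]] .
  have Gv: "?G v = - v" using v0 two g0 by (simp add: vext_def vproj_def b_self)
  have GW: "?G x = g x" if "x \<in> ?W" for x using that vproj_id[OF that] by (simp add: vext_def perp1_def)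
  have GG: "\<forall>x\<in>V. ?G (?G x) = x"
  proof
    fix x assume x: "x \<in> V"
    show "?G (?G x) = x"
    proof (rule iso_eqI_v[OF iso_comp[OF iG iG] iso_ident(1) v(1) v0 s _ _ x])
      show "?G (?G v) = v" using Gv iso_neg[OF iG v(1)] by simp
      show "?G (?G w) = w" if "w \<in> ?W" for w
        using that GW isoD(4)[OF g(1) that] g(2) by simp
    qed
  qed
  have "perp1 (mneg V ?G) v = mneg ?W g"
    using GW by (auto simp: mneg_def perp1_def)
  moreover have "v \<in> mneg V ?G" using Gv v by (simp add: mneg_def)
  ultimately have "diag_values (mneg V ?G) (1 # replicate j 1)"
    using diag_values_Cons[OF ndg_mneg[OF iG Suc(3) GG], of v 1] g(3) v(2) by simp
  then show ?case using iG GG by (intro exI[of _ ?G]) simp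
qed

end

section \<open>The common kernel of the two characters\<close>

locale omega_space = orth_space scale b
  for scale :: "'a::{field,finite} \<Rightarrow> 'v::ab_group_add \<Rightarrow> 'v" (infixr "*s" 75) and b +
  fixes V :: "'v set" and r :: nat and d :: 'a
  assumes hdec: "hdec V r" and r: "r \<ge> 1" and d: "d \<noteq> 0" "\<forall>x. x\<^sup>2 \<noteq> d"
begin

lemma V: "ndg V" and sV: "subspace V" and finV: "finite V"
  using hdec_ndg[OF hdec] ndgD by auto

lemma cardV: "card V = CARD('a) ^ (2 * r + 1)"
  using hdec_count[OF hdec] by simp

lemma q_gt_1: "CARD('a) > 1" by (rule card_UNIV_gt_1)

text \<open>The elements 1 and d represent the two square classes, so each character is nontrivial
  on exactly one class of reflections.\<close>

lemma chi_vals: "chi 1 1 = - 1" "chi 1 d = 1" "chi d 1 = 1" "chi d d = - 1"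
proof -
  have "s\<^sup>2 * d \<noteq> 1" for s
  proof
    assume *: "s\<^sup>2 * d = 1"
    then have "s \<noteq> 0" by auto
    then have "(1/s)\<^sup>2 = d" using * by (simp add: power_one_over field_simps)
    then show False using d by blast
  qed
  then show "chi 1 1 = - 1" "chi 1 d = 1" "chi d 1 = 1" "chi d d = - 1"
    using d by (auto simp: chi_def intro: exI[of _ 1])
qed

definition K :: "('v \<Rightarrow> 'v) set" where
  "K = {g \<in> isometries V V. theta V 1 g = 1 \<and> theta V d g = 1}"

lemma ex_va: obtains va vb where "va \<in> V" "Q va = 1" "vb \<in> V" "Q vb = d" "b va vb = 0"
proof -
  have "CARD('a) ^ 1 < CARD('a) ^ (2 * r)" "CARD('a) ^ 1 < CARD('a) ^ (2 * r + 1)"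
    using r q_gt_1 by (intro power_strict_increasing; simp)+
  then have c: "CARD('a) < CARD('a) ^ (2 * r)" and "CARD('a) < card V" unfolding cardV by simp_all
  then obtain va where va: "va \<in> V" "Q va = 1" using represents[OF V] by blast
  then have "card (perp1 V va) = CARD('a) ^ (2 * r)"
    using card_perp1[OF sV va(1)] cardV q_gt_1 by simp
  then obtain vb where "vb \<in> perp1 V va" "Q vb = d"
    using represents[OF ndg_perp1[OF V va(1)], of d] c va by auto
  then show ?thesis using that[of va vb] va b_sym[of va vb] by (simp add: perp1_def)
qed

text \<open>The reflections in v and w have character pairs (-1, 1) and (1, -1), so multiplying by
  one or both of them corrects any h into the common kernel. The explicit alternatives are kept so
  that commutation can be checked afterwards.\<close>

lemma theta_adjust:
  assumes v: "v \<in> V" "Q v = 1" and w: "w \<in> V" "Q w = d" and h: "isometry V V h"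
  obtains k where "isometry V V k" "theta V 1 k = 1" "theta V d k = 1"
    "k = h \<or> k = (\<lambda>x. reflect v (h x)) \<or> k = (\<lambda>x. reflect w (h x)) \<or> k = (\<lambda>x. reflect v (reflect w (h x)))"
proof -
  have nz: "Q v \<noteq> 0" "Q w \<noteq> 0" using v w d by auto
  note iv = iso_reflect[OF V v(1) nz(1)] and iw = iso_reflect[OF V w(1) nz(2)]
  have tv: "theta V 1 (reflect v) = - 1" "theta V d (reflect v) = 1"
    and tw: "theta V 1 (reflect w) = 1" "theta V d (reflect w) = - 1"
    using theta_reflect[OF V v(1) nz(1)] theta_reflect[OF V w(1) nz(2)] chi_vals v(2) w(2) d(1)
    by (simp_all add: chi_def)
  have h1: "isometry V V (\<lambda>x. reflect v (h x))" "isometry V V (\<lambda>x. reflect w (h x))"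
    "isometry V V (\<lambda>x. reflect v (reflect w (h x)))"
    using iso_comp[OF h iv] iso_comp[OF h iw] iso_comp[OF iso_comp[OF h iw] iv] by auto
  have t1: "theta V c (\<lambda>x. reflect v (h x)) = theta V c (reflect v) * theta V c h"
    "theta V c (\<lambda>x. reflect w (h x)) = theta V c (reflect w) * theta V c h"
    "theta V c (\<lambda>x. reflect v (reflect w (h x))) = theta V c (reflect v) * (theta V c (reflect w) * theta V c h)"
    if "c \<noteq> 0" for c
    using theta_comp[OF V iv h that] theta_comp[OF V iw h that] theta_comp[OF V iv h1(2) that] by auto
  consider "theta V 1 h = 1" "theta V d h = 1" | "theta V 1 h = - 1" "theta V d h = 1"
    | "theta V 1 h = 1" "theta V d h = - 1" | "theta V 1 h = - 1" "theta V d h = - 1"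
    using theta_cases[of V 1 h] theta_cases[of V d h] by blast
  then show ?thesis
  proof cases
    case 1 then show ?thesis using that[of h] h by blast
  next
    case 2 then show ?thesis using that[of "\<lambda>x. reflect v (h x)"] h1 t1[of 1] t1[OF d(1)] tv tw by simp
  next
    case 3 then show ?thesis using that[of "\<lambda>x. reflect w (h x)"] h1 t1[of 1] t1[OF d(1)] tv tw by simp
  next
    case 4 then show ?thesis using that[of "\<lambda>x. reflect v (reflect w (h x))"] h1 t1[of 1] t1[OF d(1)] tv tw by simp
  qed
qed

lemma K_iff: "g \<in> K \<longleftrightarrow> g \<in> extensional V \<and> isometry V V g \<and> theta V 1 g = 1 \<and> theta V d g = 1"
  by (auto simp: K_def isometries_def)

lemma siegel_prod_iff: "siegel_prod V g \<longleftrightarrow> isometry V V g \<and> theta V 1 g = 1 \<and> theta V d g = 1"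
proof
  assume "siegel_prod V g"
  then show "isometry V V g \<and> theta V 1 g = 1 \<and> theta V d g = 1"
    using siegel_prod_iso[OF V] siegel_prod_theta[OF V] d(1) by simp
next
  assume g: "isometry V V g \<and> theta V 1 g = 1 \<and> theta V d g = 1"
  obtain k where k: "r = Suc k" using r by (cases r) auto
  from hdec[unfolded k] obtain e f where ef: "hyp V e f" "hdec (perp2 V e f) k"
    by (cases rule: hdec.cases) auto
  have "card (perp2 V e f) \<noteq> 1" using hdec_count[OF ef(2)] q_gt_1 by simp
  then have "perp2 V e f \<noteq> {0}" by auto
  then obtain w0 where w0: "w0 \<in> perp2 V e f" "Q w0 \<noteq> 0" using ex_nonsingular hdec_ndg[OF ef(2)] by blast
  obtain va vb where v: "va \<in> V" "Q va = 1" "vb \<in> V" "Q vb = d" "b va vb = 0" using ex_va .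
  show "siegel_prod V g" using siegel_prod_if_theta[OF V ef(1) w0 d(1) _ v] g d(2) by blast
qed

text \<open>Composing with a reflection exchanges the two values of a character, which gives index 2
  twice; the factor 2 in the number of isometries turns index 4 into the factor 2 here.\<close>

theorem card_K: "2 * card K = (\<Prod>i<r. (CARD('a) ^ (2 * i + 2) - 1) * CARD('a) ^ (2 * i + 1))"
proof -
  obtain va vb where v: "va \<in> V" "Q va = 1" "vb \<in> V" "Q vb = d" "b va vb = 0" using ex_va .
  have nz: "Q va \<noteq> 0" "Q vb \<noteq> 0" using v d by auto
  have tv: "theta V 1 (reflect va) = - 1" "theta V 1 (reflect vb) = 1" "theta V d (reflect vb) = - 1"
    using theta_reflect[OF V v(1) nz(1)] theta_reflect[OF V v(3) nz(2)] chi_vals v(2,4) d(1)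
    by (simp_all add: chi_def)
  let ?f = "\<lambda>u g. \<lambda>x\<in>V. reflect u (g x)"
  have f: "?f u g \<in> isometries V V" "?f u (?f u g) = g" "\<And>c. c \<noteq> 0 \<Longrightarrow> theta V c (?f u g) = theta V c (reflect u) * theta V c g"
    if u: "u \<in> V" "Q u \<noteq> 0" and g: "g \<in> isometries V V" for u g
  proof -
    note iu = iso_reflect[OF V u]
    have ig: "isometry V V g" "g \<in> extensional V" using g by (auto simp: isometries_def)
    have iug: "isometry V V (\<lambda>x. reflect u (g x))" by (rule iso_comp[OF ig(1) iu])
    show "?f u g \<in> isometries V V"
      using iso_cong[OF _ sV, of "?f u g" "\<lambda>x. reflect u (g x)" V] iug by (simp add: isometries_def)
    show "?f u (?f u g) = g"
      by (rule extensionalityI[OF _ ig(2)]) (use u in auto)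
    show "theta V c (?f u g) = theta V c (reflect u) * theta V c g" if "c \<noteq> 0" for c
    proof -
      have "theta V c (?f u g) = theta V c (\<lambda>x. reflect u (g x))" by (rule theta_cong) simp
      then show ?thesis using theta_comp[OF V iu ig(1) that] by simp
    qed
  qed
  have fin: "finite (isometries V V)" by (rule finite_isos[OF finV finV])
  have 1: "card (isometries V V) = 2 * card {g \<in> isometries V V. theta V 1 g = 1}"
    by (rule card_eq_twice_kernel[where f = "?f va"])
      (use f[OF v(1) nz(1)] tv(1) fin theta_cases in auto)
  have 2: "card {g \<in> isometries V V. theta V 1 g = 1} = 2 * card {g \<in> {g \<in> isometries V V. theta V 1 g = 1}. theta V d g = 1}"
  proof (rule card_eq_twice_kernel[where f = "?f vb"])
    show "finite {g \<in> isometries V V. theta V 1 g = 1}" using fin by simp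
    fix g assume g: "g \<in> {g \<in> isometries V V. theta V 1 g = 1}"
    then have gi: "g \<in> isometries V V" by simp
    note F = f[OF v(3) nz(2) gi]
    show "?f vb g \<in> {g \<in> isometries V V. theta V 1 g = 1}" using F(1) F(3)[of 1] tv(2) g by simp
    show "?f vb (?f vb g) = g" by (rule F(2))
    show "theta V d (?f vb g) = - theta V d g" using F(3)[OF d(1)] tv(3) by simp
    show "theta V d g = 1 \<or> theta V d g = - 1" by (rule theta_cases)
  qed
  have "{g \<in> {g \<in> isometries V V. theta V 1 g = 1}. theta V d g = 1} = K" by (auto simp: K_def)
  then have "card (isometries V V) = 4 * card K" using 1 2 by simp
  then show ?thesis using card_isos[OF hdec V cardV] hdec_count[OF hdec] by simp
qed

text \<open>The character for d forces the last diagonal entry of the -1-eigenspace to be 1, and the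
  character for 1 then forces an even dimension. The square class of the fixed space is read off
  from -g; it is the same for all g, since -g and -1 differ by an element on which the character is
  trivial.\<close>

lemma involution_structure:
  assumes g: "isometry V V g" "\<forall>x\<in>V. g (g x) = x" "\<exists>x\<in>V. g x \<noteq> x" "theta V 1 g = 1" "theta V d g = 1"
  obtains k m t where "1 \<le> k" "diag_values (mneg V g) (replicate (2 * k) 1)"
    "diag_values (mfix V g) (replicate m 1 @ [t])" "t = 1 \<or> t = d" "chi d t = theta V d uminus"
proof -
  note nm = ndg_mneg[OF g(1) V g(2)] and nf = ndg_mfix[OF g(1) V g(2)]
  obtain x where x: "x \<in> V" "g x \<noteq> x" using g(3) by blast
  have "nproj g x \<noteq> 0"
  proof
    assume "nproj g x = 0"
    then have "x \<in> mfix V g" using nproj(2)[OF g(1) sV g(2) x(1)] by simp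
    then show False using x(2) by (simp add: mfix_def)
  qed
  then have "mneg V g \<noteq> {0}" using nproj(1)[OF g(1) sV g(2) x(1)] by blast
  then obtain m1 t1 where o: "diag_values (mneg V g) (replicate m1 1 @ [t1])" "t1 = 1 \<or> t1 = d"
    using diag_values_exists[OF d nm] by blast
  have th: "theta V c g = prod_list (map (chi c) (replicate m1 1 @ [t1]))" if "c \<noteq> 0" for c
    by (rule theta_involution[OF V that g(1,2) o(1)])
  have "chi d t1 = 1" using th[OF d(1)] g(5) chi_vals(3) by (simp add: prod_list_replicate)
  then have t1: "t1 = 1" using o(2) chi_vals(4) by auto
  have "(- 1 :: int) ^ Suc m1 = 1" using th[of 1] g(4) chi_vals(1) t1 by (simp add: prod_list_replicate)
  then have "even (Suc m1)" by (metis neg_one_odd_power one_neq_neg_one)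
  then obtain k where k: "Suc m1 = 2 * k" by (rule evenE)
  have "replicate m1 1 @ [t1] = replicate (2 * k) (1::'a)"
    using t1 by (simp add: replicate_append_same flip: k)
  then have ok: "diag_values (mneg V g) (replicate (2 * k) 1)" using o(1) by simp
  \<comment> \<open>The whole space has odd dimension and the -1-eigenspace has even
    dimension.\<close>
  have "mfix V g \<noteq> {0}"
  proof
    assume "mfix V g = {0}"
    then have "CARD('a) ^ (2 * r + 1) = CARD('a) ^ (2 * k)"
      using card_mneg_mfix[OF g(1) V g(2)] diag_values_card[OF ok] cardV by simp
    then have "2 * r + 1 = 2 * k" using q_gt_1 power_inject_exp by blast
    then show False by presburger
  qed
  then obtain m t where mt: "diag_values (mfix V g) (replicate m 1 @ [t])" "t = 1 \<or> t = d"
    using diag_values_exists[OF d nf] by blast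
  let ?n = "\<lambda>x. - g x"
  have ing: "isometry V V ?n" by (rule iso_uminus[OF g(1) sV])
  have nn: "\<forall>x\<in>V. ?n (?n x) = x" using g(2) iso_neg[OF g(1)] isoD(4)[OF g(1)] by simp
  have "theta V d ?n = prod_list (map (chi d) (replicate m 1 @ [t]))"
    by (rule theta_involution[OF V d(1) ing nn]) (use mt(1) mfix_mneg in simp)
  then have tn: "theta V d ?n = chi d t" using chi_vals(3) by (simp add: prod_list_replicate)
  have "theta V d uminus = theta V d (\<lambda>x. ?n (g x))" by (rule theta_cong) (use g(2) in simp)
  also have "\<dots> = chi d t" using theta_comp[OF V ing g(1) d(1)] tn g(5) by simp
  finally have "chi d t = theta V d uminus" by simp
  then show ?thesis using that[OF _ ok mt] k by force
qed

text \<open>Both pairs of eigenspaces have equal diagonal forms, so the involutions are conjugate by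
  some isometry h. That h is then corrected into the common kernel by reflections that commute with
  g'.\<close>

theorem conj_involutions:
  assumes g: "isometry V V g" "\<forall>x\<in>V. g (g x) = x" "\<exists>x\<in>V. g x \<noteq> x" "theta V 1 g = 1" "theta V d g = 1"
    and g': "isometry V V g'" "\<forall>x\<in>V. g' (g' x) = x" "\<exists>x\<in>V. g' x \<noteq> x" "theta V 1 g' = 1" "theta V d g' = 1"
    and c: "card (mneg V g) = card (mneg V g')"
  obtains h where "isometry V V h" "theta V 1 h = 1" "theta V d h = 1" "\<forall>x\<in>V. h (g x) = g' (h x)"
proof -
  obtain k m t where k: "1 \<le> k" "diag_values (mneg V g) (replicate (2 * k) 1)"
    "diag_values (mfix V g) (replicate m 1 @ [t])" "t = 1 \<or> t = d" "chi d t = theta V d uminus"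
    using involution_structure[OF g] .
  obtain k' m' t' where k': "1 \<le> k'" "diag_values (mneg V g') (replicate (2 * k') 1)"
    "diag_values (mfix V g') (replicate m' 1 @ [t'])" "t' = 1 \<or> t' = d" "chi d t' = theta V d uminus"
    using involution_structure[OF g'] .
  have inj: "x = y" if "CARD('a) ^ x = CARD('a) ^ y" for x y :: nat
    using that q_gt_1 power_inject_exp by blast
  have "2 * k = 2 * k'" using c diag_values_card[OF k(2)] diag_values_card[OF k'(2)] inj[of "2 * k" "2 * k'"] by simp
  then have kk: "k' = k" by simp
  have "card (mfix V g) = card (mfix V g')"
  proof -
    have "card (mneg V g') * card (mfix V g) = card (mneg V g') * card (mfix V g')"
      using card_mneg_mfix[OF g(1) V g(2)] card_mneg_mfix[OF g'(1) V g'(2)] c by metis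
    then show ?thesis using diag_values_card[OF k'(2)] q_gt_1 by simp
  qed
  then have "m + 1 = m' + 1" using diag_values_card[OF k(3)] diag_values_card[OF k'(3)] inj[of "m + 1" "m' + 1"] by simp
  then have mm: "m' = m" by simp
  have tt: "t' = t" using k(4,5) k'(4,5) chi_vals by auto
  obtain h1 where h1: "isometry (mneg V g) (mneg V g') h1" using diag_values_iso[OF k(2)] k'(2) kk by blast
  obtain h2 where h2: "isometry (mfix V g) (mfix V g') h2" using diag_values_iso[OF k(3)] k'(3) mm tt by blast
  have "\<exists>h. isometry V V h \<and> (\<forall>x\<in>V. h (g x) = g' (h x))"
    by (rule iso_intertwine[OF V V refl g(1,2) h1 h2 g'(1)]) blast
  then obtain h where h: "isometry V V h" "\<forall>x\<in>V. h (g x) = g' (h x)" by blast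
  have big: "CARD('a) < card (mneg V g')"
  proof -
    have "CARD('a) ^ 1 < CARD('a) ^ (2 * k')" using k'(1) q_gt_1 by (intro power_strict_increasing) auto
    then show ?thesis using diag_values_card[OF k'(2)] by simp
  qed
  note nm = ndg_mneg[OF g'(1) V g'(2)]
  obtain v where v: "v \<in> mneg V g'" "Q v = 1" using represents[OF nm big] by blast
  obtain w where w: "w \<in> mneg V g'" "Q w = d" using represents[OF nm big] by blast
  \<comment> \<open>For u in the -1-eigenspace, g' sends u to -u, and u and -u define the same
    reflection.\<close>
  have rc: "reflect u (g' x) = g' (reflect u x)" if u: "u \<in> mneg V g'" and x: "x \<in> V" for u x
  proof -
    have "u \<in> V" "g' u = - u" using u by (auto simp: mneg_def)
    then have "g' (reflect u x) = reflect (- u) (g' x)"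
      using iso_reflect_commute[OF g'(1) sV _ x, of u] by simp
    also have "\<dots> = reflect u (g' x)" using reflect_scale[of "- 1" u "g' x"] by simp
    finally show ?thesis by simp
  qed
  have vV: "v \<in> V" and wV: "w \<in> V" using v w by (auto simp: mneg_def)
  have ivV: "reflect v x \<in> V" "reflect w x \<in> V" if "x \<in> V" for x
    using isoD(4)[OF iso_reflect[OF V vV] that] isoD(4)[OF iso_reflect[OF V wV] that] v w d by auto
  obtain p where p: "isometry V V p" "theta V 1 p = 1" "theta V d p = 1"
    "p = h \<or> p = (\<lambda>x. reflect v (h x)) \<or> p = (\<lambda>x. reflect w (h x)) \<or> p = (\<lambda>x. reflect v (reflect w (h x)))"
    using theta_adjust[OF vV v(2) wV w(2) h(1)] .
  have "\<forall>x\<in>V. p (g x) = g' (p x)"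
  proof
    fix x assume x: "x \<in> V"
    have hx: "h x \<in> V" using isoD(4)[OF h(1) x] .
    have e: "h (g x) = g' (h x)" using h(2) x by blast
    show "p (g x) = g' (p x)"
      using p(4) e rc[OF v(1) hx] rc[OF w(1) hx] rc[OF v(1) ivV(2)[OF hx]] by (elim disjE) simp_all
  qed
  then show ?thesis using that p(1-3) by blast
qed

lemma diag_values_V: obtains t where "diag_values V (replicate (2 * r) 1 @ [t])" "t = 1 \<or> t = d"
proof -
  have "V \<noteq> {0}" using cardV q_gt_1 by auto
  then obtain m t where m: "diag_values V (replicate m 1 @ [t])" "t = 1 \<or> t = d" using diag_values_exists[OF d V] by blast
  have "CARD('a) ^ (m + 1) = CARD('a) ^ (2 * r + 1)" using diag_values_card[OF m(1)] cardV by simp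
  then have "m + 1 = 2 * r + 1" using q_gt_1 power_inject_exp by blast
  then show ?thesis using that m by simp
qed

lemma involution_exists:
  assumes "1 \<le> k" "k \<le> r"
  shows "\<exists>g. isometry V V g \<and> (\<forall>x\<in>V. g (g x) = x) \<and> (\<exists>x\<in>V. g x \<noteq> x) \<and> theta V 1 g = 1 \<and> theta V d g = 1
    \<and> card (mneg V g) = CARD('a) ^ (2 * k)"
proof -
  obtain t where t: "diag_values V (replicate (2 * r) 1 @ [t])" using diag_values_V by blast
  have "replicate (2 * r) (1::'a) = replicate (2 * k) 1 @ replicate (2 * r - 2 * k) 1"
    using assms(2) by (simp flip: replicate_add)
  then have "diag_values V (replicate (2 * k) 1 @ (replicate (2 * r - 2 * k) 1 @ [t]))" using t by simp
  then obtain g where g: "isometry V V g" "\<forall>x\<in>V. g (g x) = x" "diag_values (mneg V g) (replicate (2 * k) 1)"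
    using ex_involution[OF _ V] by blast
  have th: "theta V c g = prod_list (map (chi c) (replicate (2 * k) 1))" if "c \<noteq> 0" for c
    by (rule theta_involution[OF V that g])
  have "theta V 1 g = 1" "theta V d g = 1"
    using th[of 1] th[OF d(1)] chi_vals(1,3) by (simp_all add: prod_list_replicate)
  moreover have c: "card (mneg V g) = CARD('a) ^ (2 * k)" using diag_values_card[OF g(3)] by simp
  moreover have "\<exists>x\<in>V. g x \<noteq> x"
  proof (rule ccontr)
    assume "\<not> ?thesis"
    then have "mneg V g \<subseteq> {0}" using two_cancel by (auto simp: mneg_def)
    then have "card (mneg V g) \<le> card {0::'v}" by (intro card_mono) auto
    moreover have "CARD('a) ^ 0 < CARD('a) ^ (2 * k)" using assms q_gt_1 by (intro power_strict_increasing) auto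
    ultimately show False using c by simp
  qed
  ultimately show ?thesis using g by blast
qed

lemma involution_card:
  assumes g: "isometry V V g" "\<forall>x\<in>V. g (g x) = x" "\<exists>x\<in>V. g x \<noteq> x" "theta V 1 g = 1" "theta V d g = 1"
  shows "\<exists>k. 1 \<le> k \<and> k \<le> r \<and> card (mneg V g) = CARD('a) ^ (2 * k)"
proof -
  obtain k m t where k: "1 \<le> k" "diag_values (mneg V g) (replicate (2 * k) 1)"
    "diag_values (mfix V g) (replicate m 1 @ [t])" using involution_structure[OF g] .
  have "CARD('a) ^ (2 * r + 1) = CARD('a) ^ (2 * k + (m + 1))"
    using card_mneg_mfix[OF g(1) V g(2)] diag_values_card[OF k(2)] diag_values_card[OF k(3)] cardV by (simp add: power_add)
  then have "2 * r + 1 = 2 * k + (m + 1)" using q_gt_1 power_inject_exp by blast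
  then show ?thesis using k diag_values_card[OF k(2)] by (intro exI[of _ k]) auto
qed

text \<open>On a diagonal form with 2r ones and a last entry t, the characters of -1 are
  \<open>chi 1 t\<close> and \<open>chi d t\<close>, and exactly one of them is -1.\<close>

lemma uminus_not_siegel_prod: "\<not> (theta V 1 uminus = 1 \<and> theta V d uminus = 1)"
proof -
  obtain t where t: "diag_values V (replicate (2 * r) 1 @ [t])" "t = 1 \<or> t = d" using diag_values_V .
  have i: "isometry V V uminus" using iso_uminus[OF iso_ident(1) sV] by simp
  have m: "mneg V uminus = V" by (auto simp: mneg_def)
  have "theta V c uminus = prod_list (map (chi c) (replicate (2 * r) 1 @ [t]))" if "c \<noteq> 0" for c
    by (rule theta_involution[OF V that i]) (use m t in auto)
  from this[of 1] this[OF d(1)] show ?thesis using t(2) chi_vals by (auto simp: prod_list_replicate)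
qed

end

subsection \<open>Counting classes of involutions through a quotient\<close>

lemma (in group) orbit_conj_subset:
  assumes "x \<in> carrier G" "y \<in> carrier G" "h \<in> carrier G" "h \<otimes> x = y \<otimes> h"
  shows "orbit G (\<lambda>g x. g \<otimes> x \<otimes> inv g) y \<subseteq> orbit G (\<lambda>g x. g \<otimes> x \<otimes> inv g) x"
proof
  fix z assume "z \<in> orbit G (\<lambda>g x. g \<otimes> x \<otimes> inv g) y"
  then obtain g where g: "g \<in> carrier G" "z = g \<otimes> y \<otimes> inv g" by (auto simp: orbit_def)
  have "y = h \<otimes> x \<otimes> inv h" using assms by (metis inv_solve_right m_closed)
  then have "z = (g \<otimes> h) \<otimes> x \<otimes> inv (g \<otimes> h)"
    using g assms(1,3) by (simp add: m_assoc inv_mult_group)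
  then show "z \<in> orbit G (\<lambda>g x. g \<otimes> x \<otimes> inv g) x" using g assms by (auto simp: orbit_def)
qed

lemma (in group) orbit_conj_eq:
  assumes "x \<in> carrier G" "y \<in> carrier G"
  shows "orbit G (\<lambda>g x. g \<otimes> x \<otimes> inv g) x = orbit G (\<lambda>g x. g \<otimes> x \<otimes> inv g) y
    \<longleftrightarrow> (\<exists>h\<in>carrier G. h \<otimes> x = y \<otimes> h)"
proof
  assume "orbit G (\<lambda>g x. g \<otimes> x \<otimes> inv g) x = orbit G (\<lambda>g x. g \<otimes> x \<otimes> inv g) y"
  moreover have "y \<in> orbit G (\<lambda>g x. g \<otimes> x \<otimes> inv g) y"
    unfolding orbit_def using assms by (auto intro!: exI[of _ \<one>])
  ultimately obtain h where h: "h \<in> carrier G" "y = h \<otimes> x \<otimes> inv h" by (auto simp: orbit_def)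
  then have "h \<otimes> x = y \<otimes> h" using assms by (simp add: m_assoc)
  then show "\<exists>h\<in>carrier G. h \<otimes> x = y \<otimes> h" using h by blast
next
  assume "\<exists>h\<in>carrier G. h \<otimes> x = y \<otimes> h"
  then obtain h where h: "h \<in> carrier G" "h \<otimes> x = y \<otimes> h" by blast
  have h': "inv h \<otimes> y = x \<otimes> inv h"
    using h assms by (metis inv_closed inv_solve_left inv_solve_right m_assoc m_closed)
  show "orbit G (\<lambda>g x. g \<otimes> x \<otimes> inv g) x = orbit G (\<lambda>g x. g \<otimes> x \<otimes> inv g) y"
    using orbit_conj_subset[OF assms h] orbit_conj_subset[OF assms(2,1) _ h'] h by blast
qed

text \<open>Used with f the class of an element and J a complete invariant, so that classes are
  counted by the values of the invariant.\<close>

lemma card_image_eq_card_image: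
  assumes "\<And>x y. x \<in> P \<Longrightarrow> y \<in> P \<Longrightarrow> f x = f y \<longleftrightarrow> J x = J y"
  shows "card (f ` P) = card (J ` P)"
proof -
  have "bij_betw (\<lambda>j. f (inv_into P J j)) (J ` P) (f ` P)"
    unfolding bij_betw_def
  proof
    show "inj_on (\<lambda>j. f (inv_into P J j)) (J ` P)"
      by (rule inj_onI) (metis assms f_inv_into_f inv_into_into)
    show "(\<lambda>j. f (inv_into P J j)) ` J ` P = f ` P"
      unfolding image_image by (rule image_cong[OF refl]) (metis assms f_inv_into_f image_eqI inv_into_into)
  qed
  then show ?thesis using bij_betw_same_card by metis
qed

text \<open>Classes of involutions of H are counted among their lifts to G, the set P; conjugacy in
  H becomes an equation in G modulo the kernel of p.\<close>

lemma k2_surj_hom: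
  assumes G: "group G" and H: "group H" and p: "p \<in> hom G H" "p ` carrier G = carrier H"
    and P: "P = {g \<in> carrier G. p g \<noteq> \<one>\<^bsub>H\<^esub> \<and> p (g \<otimes>\<^bsub>G\<^esub> g) = \<one>\<^bsub>H\<^esub>}"
    and J: "\<And>g g'. g \<in> P \<Longrightarrow> g' \<in> P \<Longrightarrow>
      J g = J g' \<longleftrightarrow> (\<exists>h\<in>carrier G. p (h \<otimes>\<^bsub>G\<^esub> g) = p (g' \<otimes>\<^bsub>G\<^esub> h))"
  shows "k2 H = card (J ` P)"
proof -
  interpret H: group H by fact
  let ?c = "\<lambda>g x. g \<otimes>\<^bsub>H\<^esub> x \<otimes>\<^bsub>H\<^esub> inv\<^bsub>H\<^esub> g"
  have "involutions H = p ` P"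
  proof (intro equalityI subsetI)
    fix x assume x: "x \<in> involutions H"
    then obtain g where g: "g \<in> carrier G" "x = p g" using p(2) by (auto simp: involutions_def)
    then have "g \<in> P" using x hom_mult[OF p(1)] by (simp add: P involutions_def)
    then show "x \<in> p ` P" using g by blast
  next
    fix x assume "x \<in> p ` P"
    then show "x \<in> involutions H" using p hom_mult[OF p(1)] by (auto simp: P involutions_def)
  qed
  then have "orbits H (involutions H) ?c = (\<lambda>g. orbit H ?c (p g)) ` P"
    by (auto simp: orbits_def)
  moreover have "card ((\<lambda>g. orbit H ?c (p g)) ` P) = card (J ` P)"
  proof (rule card_image_eq_card_image)
    fix g g' assume g: "g \<in> P" "g' \<in> P"
    then have gc: "g \<in> carrier G" "g' \<in> carrier G" by (auto simp: P)
    then have pc: "p g \<in> carrier H" "p g' \<in> carrier H" using p(2) by auto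
    have "(\<exists>h\<in>carrier H. h \<otimes>\<^bsub>H\<^esub> p g = p g' \<otimes>\<^bsub>H\<^esub> h) \<longleftrightarrow>
        (\<exists>h\<in>carrier G. p h \<otimes>\<^bsub>H\<^esub> p g = p g' \<otimes>\<^bsub>H\<^esub> p h)"
      unfolding p(2)[symmetric] by auto
    also have "\<dots> \<longleftrightarrow> J g = J g'"
      unfolding J[OF g] using gc by (intro bex_cong) (auto simp: hom_mult[OF p(1)])
    finally show "orbit H ?c (p g) = orbit H ?c (p g') \<longleftrightarrow> J g = J g'"
      using H.orbit_conj_eq[OF pc] by simp
  qed
  ultimately show ?thesis by (simp add: k2_def)
qed

lemma k2_is_iso:
  assumes "group G" "group H" "G \<cong> H" shows "k2 G = k2 H"
proof -
  interpret G: group G by fact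
  obtain p where p: "p \<in> iso G H" using assms(3) by (auto simp: is_iso_def)
  let ?P = "involutions G"
  let ?J = "orbit G (\<lambda>g x. g \<otimes>\<^bsub>G\<^esub> x \<otimes>\<^bsub>G\<^esub> inv\<^bsub>G\<^esub> g)"
  have hom: "p \<in> hom G H" and bij: "bij_betw p (carrier G) (carrier H)" using p by (auto simp: iso_def)
  have inj: "p x = p y \<longleftrightarrow> x = y" if "x \<in> carrier G" "y \<in> carrier G" for x y
    using bij that by (auto simp: bij_betw_def inj_on_def)
  have p1: "p \<one>\<^bsub>G\<^esub> = \<one>\<^bsub>H\<^esub>" using hom_one[OF hom assms(1,2)] .
  have "k2 H = card (?J ` ?P)"
  proof (rule k2_surj_hom[OF assms(1,2) hom])
    show "p ` carrier G = carrier H" using bij by (simp add: bij_betw_def)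
    show "?P = {g \<in> carrier G. p g \<noteq> \<one>\<^bsub>H\<^esub> \<and> p (g \<otimes>\<^bsub>G\<^esub> g) = \<one>\<^bsub>H\<^esub>}"
      using inj[OF _ G.one_closed] p1 by (auto simp: involutions_def)
    fix g g' assume "g \<in> ?P" "g' \<in> ?P"
    then have g: "g \<in> carrier G" "g' \<in> carrier G" by (auto simp: involutions_def)
    show "?J g = ?J g' \<longleftrightarrow> (\<exists>h\<in>carrier G. p (h \<otimes>\<^bsub>G\<^esub> g) = p (g' \<otimes>\<^bsub>G\<^esub> h))"
      unfolding G.orbit_conj_eq[OF g] using g inj by (intro bex_cong) auto
  qed
  moreover have "orbits G ?P (\<lambda>g x. g \<otimes>\<^bsub>G\<^esub> x \<otimes>\<^bsub>G\<^esub> inv\<^bsub>G\<^esub> g) = ?J ` ?P"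
    by (auto simp: orbits_def)
  ultimately show ?thesis by (simp add: k2_def)
qed

lemma order_surj_hom:
  assumes "group G" "group H" "p \<in> hom G H" "p ` carrier G = carrier H"
  shows "order G = order H * card (kernel G H p)"
proof -
  interpret group_hom G H p
    by (rule group_hom.intro[OF assms(1,2)]) (simp add: group_hom_axioms_def assms(3))
  have "card (carrier (G Mod kernel G H p)) = card (carrier H)"
    by (rule iso_same_card) (use FactGroup_iso_set[OF assms(4)] in \<open>auto simp: is_iso_def\<close>)
  then show ?thesis
    using group.lagrange[OF assms(1) subgroup_kernel] by (simp add: FactGroup_def order_def)
qed

lemma surj_hom_eq_iff:
  assumes "group G" "group H" "p \<in> hom G H" "a \<in> carrier G" "b \<in> carrier G"
  shows "p a = p b \<longleftrightarrow> (\<exists>k\<in>kernel G H p. a = k \<otimes>\<^bsub>G\<^esub> b)"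
proof -
  interpret group_hom G H p
    by (rule group_hom.intro[OF assms(1,2)]) (simp add: group_hom_axioms_def assms(3))
  show ?thesis
  proof
    assume "p a = p b"
    then have "a \<otimes>\<^bsub>G\<^esub> inv\<^bsub>G\<^esub> b \<in> kernel G H p" using assms(4,5) by (simp add: kernel_def)
    moreover have "a = (a \<otimes>\<^bsub>G\<^esub> inv\<^bsub>G\<^esub> b) \<otimes>\<^bsub>G\<^esub> b" using assms(4,5) by (simp add: G.m_assoc)
    ultimately show "\<exists>k\<in>kernel G H p. a = k \<otimes>\<^bsub>G\<^esub> b" by blast
  qed (use assms(5) in \<open>auto simp: kernel_def\<close>)
qed

lemma (in group) subgroup_center: "subgroup (group_center G) G"
proof (rule subgroupI)
  show "group_center G \<subseteq> carrier G" by (auto simp: group_center_def)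
  show "group_center G \<noteq> {}" by (auto simp: group_center_def)
  fix a assume a: "a \<in> group_center G"
  then have ac: "a \<in> carrier G" "\<And>g. g \<in> carrier G \<Longrightarrow> a \<otimes> g = g \<otimes> a" by (auto simp: group_center_def)
  have "inv a \<otimes> g = g \<otimes> inv a" if "g \<in> carrier G" for g
    using ac that by (metis inv_closed inv_solve_left inv_solve_right m_assoc m_closed)
  then show "inv a \<in> group_center G" unfolding group_center_def using inv_closed[OF ac(1)] by blast
  fix b assume "b \<in> group_center G"
  then have bc: "b \<in> carrier G" "\<And>g. g \<in> carrier G \<Longrightarrow> b \<otimes> g = g \<otimes> b" by (auto simp: group_center_def)
  have "a \<otimes> b \<otimes> g = g \<otimes> (a \<otimes> b)" if "g \<in> carrier G" for g
    using ac bc that by (metis m_assoc)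
  then show "a \<otimes> b \<in> group_center G" unfolding group_center_def using m_closed[OF ac(1) bc(1)] by blast
qed

lemma (in group) normal_center: "group_center G \<lhd> G"
  by (rule normalI[OF subgroup_center]) (auto simp: group_center_def r_coset_def l_coset_def)

lemma FactGroup_kernel:
  assumes "N \<lhd> G" shows "kernel G (G Mod N) (\<lambda>g. N #>\<^bsub>G\<^esub> g) = N"
proof -
  interpret normal N G by fact
  show ?thesis unfolding kernel_def FactGroup_def
    using coset_join1[OF _ _ subgroup_axioms] coset_join2[OF _ subgroup_axioms] subset by auto
qed

lemma FactGroup_surj:
  "(\<lambda>g. N #>\<^bsub>G\<^esub> g) ` carrier G = carrier (G Mod N)"
  by (auto simp: FactGroup_def RCOSETS_def)

subsection \<open>Groups of isometries\<close>

lemma BijGroup_mult: "g \<in> Bij S \<Longrightarrow> h \<in> Bij S \<Longrightarrow> g \<otimes>\<^bsub>BijGroup S\<^esub> h = compose S g h"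
  by (simp add: BijGroup_def)

context eps_space begin

lemma iso_mneg_conj:
  assumes "isometry V V h" "ndg V" "isometry V V g" "\<forall>x\<in>V. h (g x) = g' (h x)"
  shows "isometry (mneg V g) (mneg V g') h"
proof -
  note s = ndgD(1)[OF assms(2)]
  have "h ` mneg V g = mneg V g'"
  proof (intro equalityI subsetI)
    fix y assume "y \<in> h ` mneg V g"
    then obtain x where x: "x \<in> V" "g x = - x" "y = h x" by (auto simp: mneg_def)
    then show "y \<in> mneg V g'"
      using bspec[OF assms(4) x(1)] iso_neg[OF assms(1) x(1)] isoD(4)[OF assms(1)] by (auto simp: mneg_def)
  next
    fix y assume y: "y \<in> mneg V g'"
    then obtain x where x: "x \<in> V" "y = h x" using isoD(3)[OF assms(1)] by (auto simp: mneg_def)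
    have "h (g x) = h (- x)"
      using bspec[OF assms(4) x(1)] iso_neg[OF assms(1) x(1)] y x(2) by (simp add: mneg_def)
    then have "g x = - x"
      using iso_inj[OF assms(1,2)] x(1) subspace_neg[OF s x(1)] isoD(4)[OF assms(3) x(1)] by (auto dest: inj_onD)
    then show "y \<in> h ` mneg V g" using x by (auto simp: mneg_def)
  qed
  then show ?thesis using assms(1) unfolding isometry_def mneg_def by auto
qed

lemma card_mneg_conj:
  assumes "isometry V V h" "ndg V" "isometry V V g" "\<forall>x\<in>V. h (g x) = g' (h x)"
  shows "card (mneg V g) = card (mneg V g')"
proof -
  have "inj_on h (mneg V g)" using iso_inj[OF assms(1,2)] by (auto simp: mneg_def inj_on_def)
  then show ?thesis using isoD(3)[OF iso_mneg_conj[OF assms]] card_image by metis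
qed

definition IsoGroup :: "'v set \<Rightarrow> ('v \<Rightarrow> 'v) monoid" where
  "IsoGroup V = (BijGroup V)\<lparr>carrier := isometries V V\<rparr>"

lemma isos_Bij: "ndg V \<Longrightarrow> isometries V V \<subseteq> Bij V"
  by (auto simp: isometries_def Bij_def iso_bij)

lemma isos_compose:
  assumes "ndg V" "g \<in> isometries V V" "h \<in> isometries V V" shows "compose V g h \<in> isometries V V"
proof -
  have "isometry V V (compose V g h)"
    using iso_cong[OF _ ndgD(1)[OF assms(1)], of "compose V g h" "\<lambda>x. g (h x)" V] iso_comp[of V V h V g] assms(2,3)
    by (simp add: isometries_def compose_eq)
  then show ?thesis by (simp add: isometries_def)
qed

lemma id_isos: assumes "ndg V" shows "(\<lambda>x\<in>V. x) \<in> isometries V V"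
  using iso_cong[OF _ ndgD(1)[OF assms], of "\<lambda>x\<in>V. x" "\<lambda>x. x" V] iso_ident by (simp add: isometries_def)

lemma inv_isos: assumes "ndg V" "g \<in> isometries V V" shows "(\<lambda>x\<in>V. inv_into V g x) \<in> isometries V V"
  using iso_cong[OF _ ndgD(1)[OF assms(1)], of "\<lambda>x\<in>V. inv_into V g x" "inv_into V g" V] iso_inv[of V V g] assms
  by (simp add: isometries_def)

lemma subgroup_isos: assumes "ndg V" shows "subgroup (isometries V V) (BijGroup V)"
proof (rule group.subgroupI[OF group_BijGroup])
  show "isometries V V \<subseteq> carrier (BijGroup V)" using isos_Bij[OF assms] by (simp add: BijGroup_def)
  show "isometries V V \<noteq> {}" using id_isos[OF assms] by blast
  fix g assume g: "g \<in> isometries V V"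
  show "inv\<^bsub>BijGroup V\<^esub> g \<in> isometries V V"
    using inv_BijGroup[of g V] inv_isos[OF assms g] isos_Bij[OF assms] g by auto
  fix h assume h: "h \<in> isometries V V"
  show "g \<otimes>\<^bsub>BijGroup V\<^esub> h \<in> isometries V V"
    unfolding BijGroup_mult[OF subsetD[OF isos_Bij[OF assms] g] subsetD[OF isos_Bij[OF assms] h]]
    by (rule isos_compose[OF assms g h])
qed

lemma group_IsoGroup: "ndg V \<Longrightarrow> group (IsoGroup V)"
  unfolding IsoGroup_def using group.subgroup_imp_group[OF group_BijGroup subgroup_isos] .

lemma IsoGroup_simps:
  assumes "ndg V"
  shows "carrier (IsoGroup V) = isometries V V" "\<one>\<^bsub>IsoGroup V\<^esub> = (\<lambda>x\<in>V. x)"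
    "g \<in> isometries V V \<Longrightarrow> h \<in> isometries V V \<Longrightarrow> g \<otimes>\<^bsub>IsoGroup V\<^esub> h = compose V g h"
  using isos_Bij[OF assms] by (auto simp: IsoGroup_def BijGroup_def)

end

text \<open>Agreement on V becomes equality of functions after restriction, and the inductive steps
  become products in \<open>BijGroup V\<close>.\<close>

lemma (in orth_space) siegel_prod_generate:
  assumes "ndg V" "siegel_prod V g"
  shows "restrict g V \<in> generate (BijGroup V) {restrict (sieg u w) V | u w. u \<in> V \<and> w \<in> V \<and> u \<noteq> 0 \<and> Q u = 0 \<and> b u w = 0}"
    (is "_ \<in> generate _ ?S")
  using assms(2)
proof induction
  case (siegel_prod_id g)
  have "restrict g V = \<one>\<^bsub>BijGroup V\<^esub>" using siegel_prod_id by (auto simp: BijGroup_def)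
  then show ?case by (simp only: generate.one)
next
  case (siegel_prod_step u w h g)
  have B: "restrict k V \<in> Bij V" if "isometry V V k" for k
    using iso_bij[OF that assms(1)] by (auto simp: Bij_def cong: bij_betw_cong)
  note is' = iso_sieg[OF assms(1) siegel_prod_step.hyps(1,2,4,5)] and ih = siegel_prod_iso[OF assms(1) siegel_prod_step.hyps(6)]
  have "restrict g V = compose V (restrict (sieg u w) V) (restrict h V)"
    by (rule extensionalityI[of _ V]) (use siegel_prod_step.hyps(7) isoD(4)[OF ih] in \<open>auto simp: compose_eq\<close>)
  also have "\<dots> = restrict (sieg u w) V \<otimes>\<^bsub>BijGroup V\<^esub> restrict h V"
    by (rule BijGroup_mult[OF B[OF is'] B[OF ih], symmetric])
  also have "\<dots> \<in> generate (BijGroup V) ?S"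
    by (rule generate.eng[OF generate.incl siegel_prod_step.IH]) (use siegel_prod_step.hyps in blast)
  finally show ?case .
qed

context omega_space begin

lemma K_isos: "K \<subseteq> isometries V V" by (auto simp: K_def)

lemma subgroup_K: "subgroup K (BijGroup V)"
proof (rule group.subgroupI[OF group_BijGroup])
  show "K \<subseteq> carrier (BijGroup V)" using isos_Bij[OF V] K_isos by (auto simp: BijGroup_def)
  have "theta V c (\<lambda>x\<in>V. x) = 1" for c by (rule theta_id) simp
  then show "K \<noteq> {}" using id_isos[OF V] by (auto simp: K_def)
  fix g assume g: "g \<in> K"
  then have gi: "g \<in> isometries V V" "isometry V V g" and tg: "theta V 1 g = 1" "theta V d g = 1" by (auto simp: K_def isometries_def)
  let ?i = "inv_into V g"
  have "theta V c (\<lambda>x\<in>V. ?i x) = theta V c g" if "c \<noteq> 0" for c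
  proof -
    have "theta V c (\<lambda>x\<in>V. ?i x) = theta V c ?i" by (rule theta_cong) simp
    moreover have "theta V c (\<lambda>x. g (?i x)) = 1"
      by (rule theta_id) (use isoD(3)[OF gi(2)] in \<open>simp add: f_inv_into_f\<close>)
    then have "theta V c g * theta V c ?i = 1" using theta_comp[OF V gi(2) iso_inv[OF gi(2) V] that] by simp
    ultimately show ?thesis using theta_cases[of V c g] by auto
  qed
  then show "inv\<^bsub>BijGroup V\<^esub> g \<in> K"
    using inv_BijGroup[of g V] inv_isos[OF V gi(1)] isos_Bij[OF V] gi(1) tg d(1) by (auto simp: K_def)
  fix h assume h: "h \<in> K"
  then have hi: "h \<in> isometries V V" "isometry V V h" and th: "theta V 1 h = 1" "theta V d h = 1" by (auto simp: K_def isometries_def)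
  have "theta V c (compose V g h) = theta V c g * theta V c h" if "c \<noteq> 0" for c
  proof -
    have "theta V c (compose V g h) = theta V c (\<lambda>x. g (h x))" by (rule theta_cong) (simp add: compose_eq)
    then show ?thesis using theta_comp[OF V gi(2) hi(2) that] by simp
  qed
  then have gh: "compose V g h \<in> K" using isos_compose[OF V gi(1) hi(1)] tg th d(1) by (simp add: K_def)
  show "g \<otimes>\<^bsub>BijGroup V\<^esub> h \<in> K"
    unfolding BijGroup_mult[OF subsetD[OF isos_Bij[OF V] gi(1)] subsetD[OF isos_Bij[OF V] hi(1)]] by (rule gh)
qed

theorem K_eq_generate:
  "generate (BijGroup V) {restrict (sieg u w) V | u w. u \<in> V \<and> w \<in> V \<and> u \<noteq> 0 \<and> Q u = 0 \<and> b u w = 0} = K"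
    (is "generate _ ?S = K")
proof
  show "K \<subseteq> generate (BijGroup V) ?S"
  proof
    fix g assume g: "g \<in> K"
    then have "restrict g V = g" by (auto simp: K_iff intro: extensional_restrict)
    then show "g \<in> generate (BijGroup V) ?S" using siegel_prod_generate[OF V, of g] g by (simp add: siegel_prod_iff K_iff)
  qed
  show "generate (BijGroup V) ?S \<subseteq> K"
  proof (rule group.generate_subgroup_incl[OF group_BijGroup _ subgroup_K], clarify)
    fix u w assume u: "u \<in> V" "w \<in> V" "u \<noteq> 0" "Q u = 0" "b u w = 0"
    have "theta V c (restrict (sieg u w) V) = theta V c (sieg u w)" for c by (rule theta_cong) simp
    moreover have "isometry V V (restrict (sieg u w) V)"
      using iso_cong[OF _ sV, of "restrict (sieg u w) V" "sieg u w" V] iso_sieg[OF V u(1,2,4,5)] by simp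
    ultimately show "restrict (sieg u w) V \<in> K" using theta_sieg[OF V u(1,2,4,5)] d(1) by (simp add: K_iff)
  qed
qed

definition KGroup :: "('v \<Rightarrow> 'v) monoid" where "KGroup = (BijGroup V)\<lparr>carrier := K\<rparr>"

lemma group_KGroup: "group KGroup"
  unfolding KGroup_def using group.subgroup_imp_group[OF group_BijGroup subgroup_K] .

lemma KGroup_simps:
  "carrier KGroup = K" "\<one>\<^bsub>KGroup\<^esub> = (\<lambda>x\<in>V. x)" "g \<in> K \<Longrightarrow> h \<in> K \<Longrightarrow> g \<otimes>\<^bsub>KGroup\<^esub> h = compose V g h"
  using isos_Bij[OF V] K_isos by (auto simp: KGroup_def BijGroup_def)

lemma K_eqI: "g \<in> K \<Longrightarrow> h \<in> K \<Longrightarrow> (\<And>x. x \<in> V \<Longrightarrow> g x = h x) \<Longrightarrow> g = h"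
  by (rule extensionalityI[of _ V]) (auto simp: K_iff)

text \<open>The kernel is trivial, so lifts are involutions of K; the size of the -1-eigenspace is a
  complete invariant, and its dimension runs through 2, 4, ..., 2r.\<close>

theorem k2_KGroup:
  assumes H: "group H" and p: "p \<in> hom KGroup H" "p ` carrier KGroup = carrier H" "kernel KGroup H p = {\<lambda>x\<in>V. x}"
  shows "k2 H = r"
proof -
  define P where "P = {g \<in> carrier KGroup. p g \<noteq> \<one>\<^bsub>H\<^esub> \<and> p (g \<otimes>\<^bsub>KGroup\<^esub> g) = \<one>\<^bsub>H\<^esub>}"
  let ?J = "\<lambda>g. card (mneg V g)"
  interpret KG: group KGroup by (rule group_KGroup)
  have ker: "p g = \<one>\<^bsub>H\<^esub> \<longleftrightarrow> (\<forall>x\<in>V. g x = x)" if "g \<in> K" for g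
  proof -
    have "p g = \<one>\<^bsub>H\<^esub> \<longleftrightarrow> g \<in> kernel KGroup H p" using that by (simp add: kernel_def KGroup_simps(1))
    also have "\<dots> \<longleftrightarrow> (\<forall>x\<in>V. g x = x)"
      unfolding p(3) using that KG.one_closed
      by (auto simp: KGroup_simps intro!: K_eqI)
    finally show ?thesis .
  qed
  have inj: "p g = p h \<longleftrightarrow> (\<forall>x\<in>V. g x = h x)" if "g \<in> K" "h \<in> K" for g h
  proof -
    have "(\<lambda>x\<in>V. x) \<otimes>\<^bsub>KGroup\<^esub> h = h"
      using KG.l_one[of h] that by (simp add: KGroup_simps(1,2))
    then have "p g = p h \<longleftrightarrow> g = h"
      using surj_hom_eq_iff[OF group_KGroup H p(1), of g h] that unfolding p(3) by (simp add: KGroup_simps(1))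
    then show ?thesis using K_eqI[OF that] by auto
  qed
  have P: "g \<in> P \<longleftrightarrow> g \<in> extensional V \<and> isometry V V g \<and> (\<forall>x\<in>V. g (g x) = x) \<and> (\<exists>x\<in>V. g x \<noteq> x)
      \<and> theta V 1 g = 1 \<and> theta V d g = 1" for g
  proof (cases "g \<in> K")
    case True
    have "compose V g g \<in> K" using KG.m_closed[of g g] True by (simp add: KGroup_simps)
    then show ?thesis using True ker by (auto simp: P_def KGroup_simps K_iff compose_eq)
  next
    case False
    then show ?thesis by (auto simp: P_def KGroup_simps K_iff)
  qed
  have "k2 H = card (?J ` P)"
  proof (rule k2_surj_hom[OF group_KGroup H p(1,2) P_def])
    fix g g' assume gP: "g \<in> P" "g' \<in> P"
    note g = gP(1)[unfolded P] and g' = gP(2)[unfolded P]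
    have gK: "g \<in> K" "g' \<in> K" using g g' by (auto simp: K_iff)
    have eq: "p (h \<otimes>\<^bsub>KGroup\<^esub> g) = p (g' \<otimes>\<^bsub>KGroup\<^esub> h) \<longleftrightarrow> (\<forall>x\<in>V. h (g x) = g' (h x))" if h: "h \<in> K" for h
      using inj[of "h \<otimes>\<^bsub>KGroup\<^esub> g" "g' \<otimes>\<^bsub>KGroup\<^esub> h"] KG.m_closed[of h g] KG.m_closed[of g' h] h gK
      by (simp add: KGroup_simps compose_eq)
    show "?J g = ?J g' \<longleftrightarrow> (\<exists>h\<in>carrier KGroup. p (h \<otimes>\<^bsub>KGroup\<^esub> g) = p (g' \<otimes>\<^bsub>KGroup\<^esub> h))"
    proof
      assume c: "?J g = ?J g'"
      obtain h where h: "isometry V V h" "theta V 1 h = 1" "theta V d h = 1" "\<forall>x\<in>V. h (g x) = g' (h x)"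
        using conj_involutions[of g g'] g g' c by blast
      let ?h = "restrict h V"
      have "theta V c ?h = theta V c h" for c by (rule theta_cong) simp
      then have hK: "?h \<in> K" using h iso_cong[OF _ sV, of ?h h V] by (simp add: K_iff)
      have "\<forall>x\<in>V. ?h (g x) = g' (?h x)" using h(4) g isoD(4)[of V V g] by simp
      then show "\<exists>h\<in>carrier KGroup. p (h \<otimes>\<^bsub>KGroup\<^esub> g) = p (g' \<otimes>\<^bsub>KGroup\<^esub> h)"
        using eq[OF hK] hK by (auto simp: KGroup_simps(1))
    next
      assume "\<exists>h\<in>carrier KGroup. p (h \<otimes>\<^bsub>KGroup\<^esub> g) = p (g' \<otimes>\<^bsub>KGroup\<^esub> h)"
      then obtain h where h: "h \<in> K" "\<forall>x\<in>V. h (g x) = g' (h x)" using eq by (auto simp: KGroup_simps(1))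
      then show "?J g = ?J g'" using card_mneg_conj[of V h g g'] V g by (simp add: K_iff)
    qed
  qed
  also have "?J ` P = (\<lambda>k. CARD('a) ^ (2 * k)) ` {1..r}"
  proof (intro equalityI subsetI)
    fix j assume "j \<in> ?J ` P"
    then obtain g where "g \<in> P" "j = ?J g" by blast
    then show "j \<in> (\<lambda>k. CARD('a) ^ (2 * k)) ` {1..r}" using involution_card[of g] unfolding P by auto
  next
    fix j assume "j \<in> (\<lambda>k. CARD('a) ^ (2 * k)) ` {1..r}"
    then obtain k where k: "1 \<le> k" "k \<le> r" "j = CARD('a) ^ (2 * k)" by auto
    obtain g where g: "isometry V V g" "\<forall>x\<in>V. g (g x) = x" "\<exists>x\<in>V. g x \<noteq> x" "theta V 1 g = 1" "theta V d g = 1"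
      "card (mneg V g) = CARD('a) ^ (2 * k)" using involution_exists[OF k(1,2)] by blast
    let ?g = "restrict g V"
    have t: "theta V c ?g = theta V c g" for c by (rule theta_cong) simp
    have m: "mneg V ?g = mneg V g" by (auto simp: mneg_def)
    have "?g \<in> P" unfolding P
      using g(2-5) t iso_cong[OF _ sV, of ?g g V] g(1) isoD(4)[OF g(1)] by simp
    then show "j \<in> ?J ` P" using g(6) k(3) m by (intro image_eqI[of _ _ ?g]) simp_all
  qed
  also have "card \<dots> = r"
    by (subst card_image) (use q_gt_1 in \<open>auto simp: inj_on_def\<close>)
  finally show ?thesis .
qed

end

text \<open>Elements are considered up to sign. If the lift has square 1, replacing g by -g
  exchanges the eigenspaces, so only the smaller size is an invariant; the dimension 2k of that
  eigenspace satisfies 1 <= k <= r/2. Lifts with square -1 account for one further class.\<close>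

lemma (in symp_space) k2_IsoGroup:
  assumes V: "ndg V" "card V = CARD('a) ^ (2 * r)" and r: "r \<ge> 1"
    and H: "group H" and p: "p \<in> hom (IsoGroup V) H" "p ` carrier (IsoGroup V) = carrier H"
      "kernel (IsoGroup V) H p = {\<lambda>x\<in>V. x, \<lambda>x\<in>V. - x}"
  shows "k2 H = r div 2 + 1"
proof -
  note s = ndgD(1)[OF V(1)] and simps = IsoGroup_simps[OF V(1)] and q1 = card_UNIV_gt_1[where 'a = 'a]
  define P where "P = {g \<in> carrier (IsoGroup V). p g \<noteq> \<one>\<^bsub>H\<^esub> \<and> p (g \<otimes>\<^bsub>IsoGroup V\<^esub> g) = \<one>\<^bsub>H\<^esub>}"
  \<comment> \<open>The value 0 marks lifts with square -1; it cannot clash with the other values,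
    because an eigenspace contains 0 and so has positive size.\<close>
  define J where "J = (\<lambda>g. if \<forall>x\<in>V. g (g x) = x then min (card (mneg V g)) (card (mfix V g)) else 0)"
  interpret G: group "IsoGroup V" by (rule group_IsoGroup[OF V(1)])
  have ext: "g = h \<longleftrightarrow> (\<forall>x\<in>V. g x = h x)" if "g \<in> isometries V V" "h \<in> isometries V V" for g h
  proof
    assume "\<forall>x\<in>V. g x = h x"
    then show "g = h" using that by (intro extensionalityI[of _ V]) (auto simp: isometries_def)
  qed simp
  have idV: "(\<lambda>x\<in>V. x) \<in> isometries V V" by (rule id_isos[OF V(1)])
  have negV: "(\<lambda>x\<in>V. - x) \<in> isometries V V"
    using iso_cong[OF _ s, of "\<lambda>x\<in>V. - x" "\<lambda>x. - x" V] iso_uminus[OF iso_ident(1) s] by (simp add: isometries_def)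
  have ker: "p g = \<one>\<^bsub>H\<^esub> \<longleftrightarrow> (\<forall>x\<in>V. g x = x) \<or> (\<forall>x\<in>V. g x = - x)" if g: "g \<in> isometries V V" for g
  proof -
    have "p g = \<one>\<^bsub>H\<^esub> \<longleftrightarrow> g \<in> kernel (IsoGroup V) H p" using g by (simp add: kernel_def simps(1))
    also have "\<dots> \<longleftrightarrow> (\<forall>x\<in>V. g x = x) \<or> (\<forall>x\<in>V. g x = - x)"
      unfolding p(3) insert_iff ext[OF g idV] ext[OF g negV] by simp
    finally show ?thesis .
  qed
  have peq: "p g = p h \<longleftrightarrow> (\<forall>x\<in>V. g x = h x) \<or> (\<forall>x\<in>V. g x = - h x)"
    if g: "g \<in> isometries V V" and h: "h \<in> isometries V V" for g h
  proof -
    have hV: "h x \<in> V" if "x \<in> V" for x using isoD(4)[of V V h x] h that by (simp add: isometries_def)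
    have c: "compose V (\<lambda>x\<in>V. x) h \<in> isometries V V" "compose V (\<lambda>x\<in>V. - x) h \<in> isometries V V"
      using isos_compose[OF V(1)] idV negV h by auto
    have "p g = p h \<longleftrightarrow> g = compose V (\<lambda>x\<in>V. x) h \<or> g = compose V (\<lambda>x\<in>V. - x) h"
      using surj_hom_eq_iff[OF G.is_group H p(1), of g h] g h idV negV unfolding p(3)
      by (simp add: simps)
    also have "\<dots> \<longleftrightarrow> (\<forall>x\<in>V. g x = h x) \<or> (\<forall>x\<in>V. g x = - h x)"
      unfolding ext[OF g c(1)] ext[OF g c(2)] using hV by (simp add: compose_eq)
    finally show ?thesis .
  qed
  have P: "g \<in> P \<longleftrightarrow> g \<in> isometries V V \<and> \<not> (\<forall>x\<in>V. g x = x) \<and> \<not> (\<forall>x\<in>V. g x = - x)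
      \<and> ((\<forall>x\<in>V. g (g x) = x) \<or> (\<forall>x\<in>V. g (g x) = - x))" for g
  proof (cases "g \<in> isometries V V")
    case True
    then show ?thesis using ker[OF True] ker[OF isos_compose[OF V(1) True True]]
      by (simp add: P_def simps compose_eq)
  next
    case False
    then show ?thesis by (simp add: P_def simps)
  qed
  have prod: "card V = card (mneg V g) * card (mfix V g)" "card (mneg V g) > 0" "card (mfix V g) > 0"
    if "isometry V V g" "\<forall>x\<in>V. g (g x) = x" for g
    using card_mneg_mfix[OF that(1) V(1) that(2)] V(2) q1
    by (auto intro!: Nat.gr0I)
  have no_both: False if "\<forall>x\<in>V. g (g x) = x" "\<forall>x\<in>V. g (g x) = - x" "g \<in> P" for g
  proof -
    have "x = 0" if "x \<in> V" for x using two_cancel[of x] that \<open>\<forall>x\<in>V. g (g x) = x\<close> \<open>\<forall>x\<in>V. g (g x) = - x\<close> by simp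
    then show False using that(3) isoD(4)[of V V g] unfolding P isometries_def by (metis (mono_tags, lifting) mem_Collect_eq)
  qed
  have "k2 H = card (J ` P)"
  proof (rule k2_surj_hom[OF G.is_group H p(1,2) P_def])
    fix g g' assume gP: "g \<in> P" "g' \<in> P"
    have g: "g \<in> isometries V V" "isometry V V g" and g': "g' \<in> isometries V V" "isometry V V g'"
      using gP unfolding P by (auto simp: isometries_def)
    have gV: "g x \<in> V" "g' x \<in> V" if "x \<in> V" for x using isoD(4)[OF g(2) that] isoD(4)[OF g'(2) that] .
    have eq: "p (h \<otimes>\<^bsub>IsoGroup V\<^esub> g) = p (g' \<otimes>\<^bsub>IsoGroup V\<^esub> h)
        \<longleftrightarrow> (\<forall>x\<in>V. h (g x) = g' (h x)) \<or> (\<forall>x\<in>V. h (g x) = - g' (h x))" if h: "h \<in> isometries V V" for h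
      using peq[OF isos_compose[OF V(1) h g(1)] isos_compose[OF V(1) g'(1) h]] h g g'
      by (simp add: simps compose_eq)
    have witness: "\<exists>h\<in>carrier (IsoGroup V). p (h \<otimes>\<^bsub>IsoGroup V\<^esub> g) = p (g' \<otimes>\<^bsub>IsoGroup V\<^esub> h)"
      if h: "isometry V V h" "(\<forall>x\<in>V. h (g x) = g' (h x)) \<or> (\<forall>x\<in>V. h (g x) = - g' (h x))" for h
    proof -
      have hi: "restrict h V \<in> isometries V V" using h(1) iso_cong[OF _ s, of "restrict h V" h V] by (simp add: isometries_def)
      have "(\<forall>x\<in>V. restrict h V (g x) = g' (restrict h V x)) \<or> (\<forall>x\<in>V. restrict h V (g x) = - g' (restrict h V x))"
        using h(2) gV by simp
      then show ?thesis using eq[OF hi] hi simps(1) by blast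
    qed
    have ng': "isometry V V (\<lambda>x. - g' x)" by (rule iso_uminus[OF g'(2) s])
    show "J g = J g' \<longleftrightarrow> (\<exists>h\<in>carrier (IsoGroup V). p (h \<otimes>\<^bsub>IsoGroup V\<^esub> g) = p (g' \<otimes>\<^bsub>IsoGroup V\<^esub> h))"
    proof
      assume JJ: "J g = J g'"
      show "\<exists>h\<in>carrier (IsoGroup V). p (h \<otimes>\<^bsub>IsoGroup V\<^esub> g) = p (g' \<otimes>\<^bsub>IsoGroup V\<^esub> h)"
      proof (cases "\<forall>x\<in>V. g (g x) = x")
        case True
        have True': "\<forall>x\<in>V. g' (g' x) = x"
        proof (rule ccontr)
          assume "\<not> ?thesis"
          then have "J g' = 0" unfolding J_def by (rule if_not_P)
          then show False using JJ prod(2,3)[OF g(2) True] True by (simp add: J_def)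
        qed
        have nn: "\<forall>x\<in>V. - g' (- g' x) = x" using True' gV iso_neg[OF g'(2)] by simp
        have m: "min (card (mneg V g)) (card (mfix V g)) = min (card (mneg V g')) (card (mfix V g'))"
          using JJ True True' by (simp add: J_def)
        note pr = prod[OF g(2) True] and pr' = prod[OF g'(2) True']
        \<comment> \<open>The two eigenspace sizes have the same product and the same minimum for g
          and g', so they agree up to order.\<close>
        have "card (mneg V g') = card (mneg V g) \<or> card (mfix V g') = card (mneg V g)"
        proof -
          have "card (mneg V g) * card (mfix V g) = card (mneg V g') * card (mfix V g')" using pr(1) pr'(1) by simp
          then show ?thesis using m pr(2,3) pr'(2,3) by (auto simp: min_def mult.commute split: if_splits)
        qed
        then show ?thesis
        proof
          assume "card (mneg V g') = card (mneg V g)"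
          from conj_involutions[OF V(1) g(2) True g'(2) True' this] show ?thesis using witness by metis
        next
          \<comment> \<open>Here g is conjugate to -g', which has the same image in the quotient as
            g'.\<close>
          assume "card (mfix V g') = card (mneg V g)"
          then have "card (mneg V (\<lambda>x. - g' x)) = card (mneg V g)" by (simp add: mfix_mneg)
          from conj_involutions[OF V(1) g(2) True ng' nn this] show ?thesis using witness by metis
        qed
      next
        case False
        have False': "\<not> (\<forall>x\<in>V. g' (g' x) = x)"
        proof
          assume a: "\<forall>x\<in>V. g' (g' x) = x"
          have "J g = 0" unfolding J_def by (rule if_not_P[OF False])
          then show False using JJ prod(2,3)[OF g'(2) a] a by (simp add: J_def)
        qed
        have n: "\<forall>x\<in>V. g (g x) = - x" "\<forall>x\<in>V. g' (g' x) = - x" using gP False False' unfolding P by blast+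
        from conj_complex[OF V(1) V(1) refl g(2) n(1) g'(2) n(2)] show ?thesis using witness by metis
      qed
    next
      assume "\<exists>h\<in>carrier (IsoGroup V). p (h \<otimes>\<^bsub>IsoGroup V\<^esub> g) = p (g' \<otimes>\<^bsub>IsoGroup V\<^esub> h)"
      then obtain h where hi: "h \<in> isometries V V"
        and h: "(\<forall>x\<in>V. h (g x) = g' (h x)) \<or> (\<forall>x\<in>V. h (g x) = - g' (h x))"
        using eq simps(1) by blast
      have ih: "isometry V V h" using hi by (simp add: isometries_def)
      have hV: "h x \<in> V" if "x \<in> V" for x using isoD(4)[OF ih that] .
      \<comment> \<open>The unknown sign disappears on squaring, so g and g' are of the same
        type.\<close>
      have sq: "h (g (g x)) = g' (g' (h x))" if "x \<in> V" for x
        using h gV[OF that] that hV iso_neg[OF g'(2) gV(2)[OF hV[OF that]]] by (elim disjE) simp_all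
      have "(\<forall>x\<in>V. g (g x) = x) \<longleftrightarrow> (\<forall>x\<in>V. g' (g' x) = x)"
      proof
        assume a: "\<forall>x\<in>V. g (g x) = x"
        show "\<forall>x\<in>V. g' (g' x) = x"
        proof
          fix y assume "y \<in> V"
          then obtain x where "x \<in> V" "y = h x" using isoD(3)[OF ih] by blast
          then show "g' (g' y) = y" using sq a by simp
        qed
      next
        assume a: "\<forall>x\<in>V. g' (g' x) = x"
        show "\<forall>x\<in>V. g (g x) = x"
        proof
          fix x assume x: "x \<in> V"
          then have "h (g (g x)) = h x" using sq a hV by simp
          then show "g (g x) = x" using iso_inj[OF ih V(1)] x gV by (auto dest: inj_onD)
        qed
      qed
      moreover have "min (card (mneg V g)) (card (mfix V g)) = min (card (mneg V g')) (card (mfix V g'))"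
      proof -
        have mm: "mfix V (\<lambda>x. - k x) = mneg V k" for k by (simp add: mfix_mneg)
        have ng: "isometry V V (\<lambda>x. - g x)" by (rule iso_uminus[OF g(2) s])
        have hn: "h (- g x) = - h (g x)" if "x \<in> V" for x using iso_neg[OF ih gV(1)[OF that]] .
        show ?thesis
        proof (rule disjE[OF h])
          assume a: "\<forall>x\<in>V. h (g x) = g' (h x)"
          then have a': "\<forall>x\<in>V. h (- g x) = - g' (h x)" using hn by simp
          show ?thesis using card_mneg_conj[OF ih V(1) g(2), of g'] a
              card_mneg_conj[OF ih V(1) ng, of "\<lambda>x. - g' x"] a' by (simp add: mfix_mneg)
        next
          assume a: "\<forall>x\<in>V. h (g x) = - g' (h x)"
          then have a': "\<forall>x\<in>V. h (- g x) = g' (h x)" using hn by simp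
          show ?thesis using card_mneg_conj[OF ih V(1) g(2), of "\<lambda>x. - g' x"] a
              card_mneg_conj[OF ih V(1) ng, of g'] a' by (simp add: mfix_mneg min.commute)
        qed
      qed
      ultimately show "J g = J g'" by (simp only: J_def)
    qed
  qed
  also have "J ` P = insert 0 ((\<lambda>k. CARD('a) ^ (2 * k)) ` {1..r div 2})"
  proof (intro equalityI subsetI)
    fix j assume "j \<in> J ` P"
    then obtain g where g: "g \<in> P" "j = J g" by blast
    show "j \<in> insert 0 ((\<lambda>k. CARD('a) ^ (2 * k)) ` {1..r div 2})"
    proof (cases "\<forall>x\<in>V. g (g x) = x")
      case True
      have ig: "isometry V V g" using g(1) unfolding P by (simp add: isometries_def)
      obtain k where k: "card (mneg V g) = CARD('a) ^ (2 * k)" using card_ndg[OF ndg_mneg[OF ig V(1) True]] .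
      obtain l where l: "card (mfix V g) = CARD('a) ^ (2 * l)" using card_ndg[OF ndg_mfix[OF ig V(1) True]] .
      have "CARD('a) ^ (2 * r) = CARD('a) ^ (2 * k + 2 * l)" using prod(1)[OF ig True] V(2) k l by (simp add: power_add)
      then have "2 * r = 2 * k + 2 * l" using q1 power_inject_exp by blast
      then have kl: "r = k + l" by simp
      have "k \<noteq> 0"
      proof
        assume "k = 0"
        then have "mneg V g = {0}" using card_1_zero[OF ndg_mneg[OF ig V(1) True]] k by simp
        then have "nproj g x = 0" if "x \<in> V" for x using nproj(1)[OF ig s True that] by simp
        then have "g x = x" if "x \<in> V" for x using nproj(2)[OF ig s True that] that by (simp add: mfix_def)
        then show False using g(1) unfolding P by blast
      qed
      moreover have "l \<noteq> 0"
      proof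
        assume "l = 0"
        then have "mfix V g = {0}" using card_1_zero[OF ndg_mfix[OF ig V(1) True]] l by simp
        then have "x - nproj g x = 0" if "x \<in> V" for x using nproj(2)[OF ig s True that] by simp
        then have "x \<in> mneg V g" if "x \<in> V" for x using nproj(1)[OF ig s True that] that by simp
        then show False using g(1) unfolding P mneg_def by blast
      qed
      moreover have "j = CARD('a) ^ (2 * min k l)"
        using g(2) True k l q1 by (simp add: J_def min_def)
      ultimately show ?thesis using kl by (intro insertI2 image_eqI[of _ _ "min k l"]) auto
    next
      case False
      then show ?thesis using g(2) unfolding J_def by (simp only: if_False) simp
    qed
  next
    fix j assume "j \<in> insert 0 ((\<lambda>k. CARD('a) ^ (2 * k)) ` {1..r div 2})"
    then show "j \<in> J ` P"
    proof
      assume j: "j = 0"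
      obtain g where g: "isometry V V g" "\<forall>x\<in>V. g (g x) = - x" using ex_complex_structure[OF V(1)] .
      let ?g = "restrict g V"
      have gi: "?g \<in> isometries V V" using g(1) iso_cong[OF _ s, of ?g g V] by (simp add: isometries_def)
      have gV: "g x \<in> V" if "x \<in> V" for x using isoD(4)[OF g(1) that] .
      have "V \<noteq> {0}"
      proof
        assume "V = {0}"
        then have "CARD('a) ^ (2 * r) = 1" using V(2) by simp
        then show False using one_less_power[OF q1, of "2 * r"] r by simp
      qed
      then obtain x where x: "x \<in> V" "x \<noteq> 0" using subspace_0[OF s] by blast
      have nx: "- x \<noteq> x" using two_cancel[of x] x(2) by metis
      have a: "\<not> (\<forall>x\<in>V. ?g (?g x) = x)" using g(2) gV x(1) nx by auto
      have b: "\<not> (\<forall>x\<in>V. ?g x = x)" "\<not> (\<forall>x\<in>V. ?g x = - x)"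
      proof -
        show "\<not> (\<forall>x\<in>V. ?g x = x)"
        proof
          assume *: "\<forall>x\<in>V. ?g x = x"
          have "\<forall>x\<in>V. ?g (?g x) = x"
          proof
            fix y assume y: "y \<in> V"
            have "?g y = y" using * y by blast
            then show "?g (?g y) = y" by (simp only:)
          qed
          then show False using a by blast
        qed
        show "\<not> (\<forall>x\<in>V. ?g x = - x)"
        proof
          assume *: "\<forall>x\<in>V. ?g x = - x"
          have "\<forall>x\<in>V. ?g (?g x) = x"
          proof
            fix y assume y: "y \<in> V"
            have "?g y = - y" "?g (- y) = - (- y)" using * y subspace_neg[OF s y] by blast+
            then show "?g (?g y) = y" by (simp only: minus_minus)
          qed
          then show False using a by blast
        qed
      qed
      have c: "\<forall>x\<in>V. ?g (?g x) = - x" using g(2) gV by simp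
      have "?g \<in> P" unfolding P using gi b c by blast
      moreover have "J ?g = 0" unfolding J_def by (rule if_not_P[OF a])
      ultimately show ?thesis using j by (intro image_eqI[of _ _ ?g]) simp_all
    next
      assume "j \<in> (\<lambda>k. CARD('a) ^ (2 * k)) ` {1..r div 2}"
      then obtain k where k: "1 \<le> k" "k \<le> r div 2" "j = CARD('a) ^ (2 * k)" by auto
      obtain g where g: "isometry V V g" "\<forall>x\<in>V. g (g x) = x" "card (mneg V g) = CARD('a) ^ (2 * k)"
        by (rule ex_involution[OF V, of k]) (use k in auto)
      let ?g = "restrict g V"
      have gi: "?g \<in> isometries V V" using g(1) iso_cong[OF _ s, of ?g g V] by (simp add: isometries_def)
      have gV: "g x \<in> V" if "x \<in> V" for x using isoD(4)[OF g(1) that] .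
      have c: "\<forall>x\<in>V. ?g (?g x) = x" using g(2) gV by simp
      have m: "mneg V ?g = mneg V g" "mfix V ?g = mfix V g" by (auto simp: mneg_def mfix_def)
      have e: "2 * k + 2 * (r - k) = 2 * r" using k by simp
      have "CARD('a) ^ (2 * k) * card (mfix V g) = CARD('a) ^ (2 * r)"
        using prod(1)[OF g(1,2)] g(3) V(2) by simp
      also have "\<dots> = CARD('a) ^ (2 * k) * CARD('a) ^ (2 * (r - k))"
        by (simp only: power_add[symmetric] e)
      finally have "CARD('a) ^ (2 * k) * card (mfix V g) = CARD('a) ^ (2 * k) * CARD('a) ^ (2 * (r - k))" .
      then have f: "card (mfix V g) = CARD('a) ^ (2 * (r - k))" using q1 by simp
      \<comment> \<open>Since k is at most r div 2, the -1-eigenspace is the smaller one and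
        \<open>J\<close> returns its size.\<close>
      have lt: "CARD('a) ^ (2 * k) \<le> CARD('a) ^ (2 * (r - k))" using k q1 by (intro power_increasing) auto
      have "CARD('a) ^ 0 < CARD('a) ^ (2 * k)" "CARD('a) ^ (2 * k) < CARD('a) ^ (2 * r)"
        using k q1 by (intro power_strict_increasing; simp)+
      then have cc: "card (mneg V g) \<noteq> 1" "card (mneg V g) \<noteq> card V" using g(3) V(2) k(1) by auto
      have b1: "\<not> (\<forall>x\<in>V. ?g x = x)"
      proof
        assume "\<forall>x\<in>V. ?g x = x"
        then have "mneg V g = {0}" using two_cancel subspace_0[OF s] iso_zero[OF g(1) s] by (auto simp: mneg_def)
        then show False using cc by simp
      qed
      have b2: "\<not> (\<forall>x\<in>V. ?g x = - x)"
      proof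
        assume "\<forall>x\<in>V. ?g x = - x"
        then have "mneg V g = V" by (auto simp: mneg_def)
        then show False using cc by simp
      qed
      have "?g \<in> P" unfolding P using gi b1 b2 c by blast
      moreover have "J ?g = j" using c m g(3) f lt k(3) by (simp add: J_def min_def)
      ultimately show ?thesis by (intro image_eqI[of _ _ ?g]) simp_all
    qed
  qed
  also have "card \<dots> = r div 2 + 1"
  proof -
    have "0 \<notin> (\<lambda>k. CARD('a) ^ (2 * k)) ` {1..r div 2}" using q1 by auto
    moreover have "card ((\<lambda>k. CARD('a) ^ (2 * k)) ` {1..r div 2}) = r div 2"
      by (subst card_image) (use q1 in \<open>auto simp: inj_on_def\<close>)
    ultimately show ?thesis by simp
  qed
  finally show ?thesis .
qed

lemma (in symp_space) center_IsoGroup: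
  assumes "ndg V" shows "group_center (IsoGroup V) = {\<lambda>x\<in>V. x, \<lambda>x\<in>V. - x}"
proof -
  note s = ndgD(1)[OF assms] and simps = IsoGroup_simps[OF assms]
  have negV: "(\<lambda>x\<in>V. - x) \<in> isometries V V"
    using iso_cong[OF _ s, of "\<lambda>x\<in>V. - x" "\<lambda>x. - x" V] iso_uminus[OF iso_ident(1) s] by (simp add: isometries_def)
  show ?thesis
  proof (intro equalityI subsetI)
    fix z assume "z \<in> group_center (IsoGroup V)"
    then have z: "z \<in> isometries V V" "\<And>g. g \<in> isometries V V \<Longrightarrow> compose V z g = compose V g z"
      using simps by (auto simp: group_center_def)
    have iz: "isometry V V z" using z(1) by (simp add: isometries_def)
    have "(\<forall>x\<in>V. z x = x) \<or> (\<forall>x\<in>V. z x = - x)"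
    proof (rule central_isometry[OF assms iz])
      fix g x assume g: "isometry V V g" "x \<in> V"
      have "restrict g V \<in> isometries V V" using g(1) iso_cong[OF _ s, of "restrict g V" g V] by (simp add: isometries_def)
      from fun_cong[OF z(2)[OF this], of x] show "z (g x) = g (z x)"
        using g isoD(4)[OF iz g(2)] by (simp add: compose_eq)
    qed
    moreover have "z \<in> extensional V" using z(1) by (simp add: isometries_def)
    ultimately have "z = (\<lambda>x\<in>V. x) \<or> z = (\<lambda>x\<in>V. - x)"
      by (auto simp: fun_eq_iff extensional_def)
    then show "z \<in> {\<lambda>x\<in>V. x, \<lambda>x\<in>V. - x}" by blast
  next
    fix z assume z: "z \<in> {\<lambda>x\<in>V. x, \<lambda>x\<in>V. - x}"
    then have zi: "z \<in> isometries V V" using negV id_isos[OF assms] by blast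
    have "compose V z g = compose V g z" if g: "g \<in> isometries V V" for g
    proof (rule extensionalityI[of _ V])
      fix x assume x: "x \<in> V"
      have ig: "isometry V V g" using g by (simp add: isometries_def)
      show "compose V z g x = compose V g z x"
        using z x isoD(4)[OF ig x] iso_neg[OF ig x] by (auto simp: compose_eq)
    qed simp_all
    then show "z \<in> group_center (IsoGroup V)" using zi simps by (simp add: group_center_def)
  qed
qed

lemma iso_center_iff:
  assumes "f \<in> iso G H" "x \<in> carrier G" "group G"
  shows "f x \<in> group_center H \<longleftrightarrow> x \<in> group_center G"
proof -
  interpret group G by fact
  have bij: "bij_betw f (carrier G) (carrier H)" and hom: "f \<in> hom G H" using assms(1) by (auto simp: iso_def)
  have im: "carrier H = f ` carrier G" using bij by (simp add: bij_betw_def)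
  have "f x \<otimes>\<^bsub>H\<^esub> f g = f g \<otimes>\<^bsub>H\<^esub> f x \<longleftrightarrow> x \<otimes>\<^bsub>G\<^esub> g = g \<otimes>\<^bsub>G\<^esub> x" if "g \<in> carrier G" for g
    using bij_betw_imp_inj_on[OF bij] assms(2) that
    by (auto simp: hom_mult[OF hom, symmetric] inj_on_def)
  then show ?thesis unfolding group_center_def im using assms(2) by auto
qed

subsection \<open>Coordinate vectors as functions\<close>

text \<open>The type of vectors contains all lengths and is not one additive group. Functions that
  vanish from index n on form subspaces of a single vector space, to which the locales apply;
  \<open>emb\<close> and \<open>tr\<close> carry vectors and transformations across.\<close>

definition scl :: "'a::field \<Rightarrow> (nat \<Rightarrow> 'a) \<Rightarrow> nat \<Rightarrow> 'a" where "scl c f = (\<lambda>i. c * f i)"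
definition fsp :: "nat \<Rightarrow> (nat \<Rightarrow> 'a::field) set" where "fsp n = {f. \<forall>i\<ge>n. f i = 0}"
definition emb :: "nat \<Rightarrow> 'a::field vec \<Rightarrow> nat \<Rightarrow> 'a" where "emb n v = (\<lambda>i. if i < n then v $ i else 0)"
definition tr :: "nat \<Rightarrow> ((nat \<Rightarrow> 'a::field) \<Rightarrow> nat \<Rightarrow> 'a) \<Rightarrow> 'a vec \<Rightarrow> 'a vec" where
  "tr n g = (\<lambda>x\<in>carrier_vec n. vec n (g (emb n x)))"

lemma vector_space_scl: "vector_space (scl :: 'a::field \<Rightarrow> _)"
  by unfold_locales (auto simp: scl_def fun_eq_iff algebra_simps)

lemma emb_fsp: "emb n v \<in> fsp n"
  by (simp add: emb_def fsp_def)

lemma emb_vec: "f \<in> fsp n \<Longrightarrow> emb n (vec n f) = f"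
  by (auto simp: emb_def fsp_def fun_eq_iff)

lemma vec_emb: "v \<in> carrier_vec n \<Longrightarrow> vec n (emb n v) = v"
  by (rule eq_vecI) (auto simp: emb_def)

lemma emb_inject: "u \<in> carrier_vec n \<Longrightarrow> v \<in> carrier_vec n \<Longrightarrow> emb n u = emb n v \<longleftrightarrow> u = v"
  using vec_emb by metis

lemma emb_add: "u \<in> carrier_vec n \<Longrightarrow> v \<in> carrier_vec n \<Longrightarrow> emb n (u + v) = emb n u + emb n v"
  by (auto simp: emb_def fun_eq_iff)

lemma emb_diff: "u \<in> carrier_vec n \<Longrightarrow> v \<in> carrier_vec n \<Longrightarrow> emb n (u - v) = emb n u - emb n v"
  by (auto simp: emb_def fun_eq_iff)

lemma emb_smult: "u \<in> carrier_vec n \<Longrightarrow> emb n (c \<cdot>\<^sub>v u) = scl c (emb n u)"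
  by (auto simp: emb_def scl_def fun_eq_iff)

lemma emb_zero: "emb n (0\<^sub>v n) = 0"
  by (auto simp: emb_def fun_eq_iff)

lemma bij_emb: "bij_betw (emb n) (carrier_vec n) (fsp n)"
  by (rule bij_betw_byWitness[where f' = "vec n"]) (auto simp: emb_vec vec_emb emb_fsp)

lemma bij_vec: "bij_betw (vec n) (fsp n) (carrier_vec n)"
  by (rule bij_betw_byWitness[where f' = "emb n"]) (auto simp: emb_vec vec_emb emb_fsp)

lemma tr_apply: "x \<in> carrier_vec n \<Longrightarrow> tr n g x = vec n (g (emb n x))"
  by (simp add: tr_def)

lemma emb_tr: "g \<in> fsp n \<rightarrow> fsp n \<Longrightarrow> x \<in> carrier_vec n \<Longrightarrow> emb n (tr n g x) = g (emb n x)"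
  using emb_fsp by (auto simp: tr_apply intro!: emb_vec)

lemma tr_Bij:
  assumes "g \<in> Bij (fsp n)" shows "tr n g \<in> Bij (carrier_vec n)"
proof -
  have "bij_betw g (fsp n) (fsp n)" using assms by (simp add: Bij_def)
  then have "bij_betw (vec n \<circ> (g \<circ> emb n)) (carrier_vec n) (carrier_vec n)"
    by (intro bij_betw_trans[OF _ bij_vec] bij_betw_trans[OF bij_emb])
  then have "bij_betw (tr n g) (carrier_vec n) (carrier_vec n)"
    by (rule bij_betw_cong[THEN iffD1, rotated]) (simp add: tr_def)
  then show ?thesis by (simp add: Bij_def tr_def)
qed

text \<open>With this isomorphism the group-theoretic results on function spaces carry over to the
  groups of the statement.\<close>

lemma tr_iso: "tr n \<in> iso (BijGroup (fsp n)) (BijGroup (carrier_vec n))"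
proof -
  have F: "g \<in> fsp n \<rightarrow> fsp n" if "g \<in> Bij (fsp n)" for g :: "(nat \<Rightarrow> 'a) \<Rightarrow> nat \<Rightarrow> 'a"
    using Bij_imp_funcset that by blast
  let ?t = "\<lambda>h. \<lambda>x\<in>fsp n. emb n (h (vec n x))"
  have t: "?t h \<in> Bij (fsp n)" if "h \<in> Bij (carrier_vec n)" for h :: "'a vec \<Rightarrow> 'a vec"
  proof -
    have "bij_betw h (carrier_vec n) (carrier_vec n)" using that by (simp add: Bij_def)
    then have "bij_betw (emb n \<circ> (h \<circ> vec n)) (fsp n) (fsp n)"
      by (intro bij_betw_trans[OF _ bij_emb] bij_betw_trans[OF bij_vec])
    then have "bij_betw (?t h) (fsp n) (fsp n)"
      by (rule bij_betw_cong[THEN iffD1, rotated]) simp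
    then show ?thesis by (simp add: Bij_def)
  qed
  have "bij_betw (tr n) (Bij (fsp n)) (Bij (carrier_vec n :: 'a vec set))"
  proof (rule bij_betw_byWitness[where f' = ?t])
    show "\<forall>g\<in>Bij (fsp n :: (nat \<Rightarrow> 'a) set). ?t (tr n g) = g"
    proof
      fix g :: "(nat \<Rightarrow> 'a) \<Rightarrow> nat \<Rightarrow> 'a" assume g: "g \<in> Bij (fsp n)"
      show "?t (tr n g) = g"
        by (rule extensionalityI[of _ "fsp n"]) (use g emb_tr[OF F[OF g]] in \<open>auto simp: Bij_def emb_vec\<close>)
    qed
    show "\<forall>h\<in>Bij (carrier_vec n :: 'a vec set). tr n (?t h) = h"
    proof
      fix h :: "'a vec \<Rightarrow> 'a vec" assume h: "h \<in> Bij (carrier_vec n)"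
      show "tr n (?t h) = h"
        by (rule extensionalityI[of _ "carrier_vec n"])
          (use h vec_emb[OF funcset_mem[OF Bij_imp_funcset[OF h]]] in \<open>auto simp: Bij_def tr_def vec_emb emb_fsp\<close>)
    qed
    show "tr n ` Bij (fsp n) \<subseteq> Bij (carrier_vec n :: 'a vec set)" using tr_Bij by blast
    show "?t ` Bij (carrier_vec n) \<subseteq> Bij (fsp n :: (nat \<Rightarrow> 'a) set)" using t by blast
  qed
  moreover have "tr n (compose (fsp n) g h) = compose (carrier_vec n) (tr n g) (tr n h)"
    if "g \<in> Bij (fsp n)" "h \<in> Bij (fsp n)" for g h :: "(nat \<Rightarrow> 'a) \<Rightarrow> nat \<Rightarrow> 'a"
  proof (rule extensionalityI[of _ "carrier_vec n"])
    fix x :: "'a vec" assume x: "x \<in> carrier_vec n"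
    have "h (emb n x) \<in> fsp n" using F[OF that(2)] emb_fsp by blast
    then show "tr n (compose (fsp n) g h) x = compose (carrier_vec n) (tr n g) (tr n h) x"
      using x emb_fsp by (auto simp: tr_def compose_def emb_vec)
  qed (simp_all add: tr_def)
  ultimately show ?thesis
    unfolding iso_def hom_def using tr_Bij compose_Bij by (auto simp: BijGroup_def)
qed

lemma iso_restrict_carrier:
  assumes "f \<in> iso G H" "X \<subseteq> carrier G" "Y = f ` X"
  shows "f \<in> iso (G\<lparr>carrier := X\<rparr>) (H\<lparr>carrier := Y\<rparr>)"
  using assms by (auto simp: iso_def hom_def bij_betw_def inj_on_def subset_iff)

lemma finite_fsp: "finite (fsp n :: (nat \<Rightarrow> 'a::{field,finite}) set)"
  and card_fsp: "card (fsp n :: (nat \<Rightarrow> 'a::{field,finite}) set) = CARD('a) ^ n"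
proof -
  have bij: "bij_betw (\<lambda>f. restrict f {..<n}) (fsp n :: (nat \<Rightarrow> 'a) set) ({..<n} \<rightarrow>\<^sub>E UNIV)"
    by (rule bij_betw_byWitness[where f' = "\<lambda>f i. if i < n then f i else 0"])
      (auto simp: fsp_def fun_eq_iff PiE_def extensional_def)
  show "finite (fsp n :: (nat \<Rightarrow> 'a) set)" using bij_betw_finite[OF bij] by (simp add: finite_PiE)
  show "card (fsp n :: (nat \<Rightarrow> 'a) set) = CARD('a) ^ n" using bij_betw_same_card[OF bij] by (simp add: card_PiE)
qed

definition unit :: "nat \<Rightarrow> nat \<Rightarrow> 'a::field" where "unit j = (\<lambda>i. if i = j then 1 else 0)"

definition b_symp :: "nat \<Rightarrow> (nat \<Rightarrow> 'a::field) \<Rightarrow> (nat \<Rightarrow> 'a) \<Rightarrow> 'a" where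
  "b_symp r x y = (\<Sum>i<r. x i * y (r + i) - x (r + i) * y i)"

text \<open>The polar form of Q_B; the square of the last coordinate polarizes with a factor
  2.\<close>

definition b_orth :: "nat \<Rightarrow> (nat \<Rightarrow> 'a::field) \<Rightarrow> (nat \<Rightarrow> 'a) \<Rightarrow> 'a" where
  "b_orth r x y = (\<Sum>i<r. x i * y (r + i) + x (r + i) * y i) + 2 * x (2 * r) * y (2 * r)"

lemma symp_space_std:
  assumes "(2::'a::{field,finite}) \<noteq> 0" shows "symp_space (scl :: 'a \<Rightarrow> _) (b_symp r)"
proof -
  interpret vector_space "scl :: 'a \<Rightarrow> _" by (rule vector_space_scl)
  have "b_symp r x y = - 1 * b_symp r y x" for x y :: "nat \<Rightarrow> 'a"
    by (simp add: b_symp_def mult.commute flip: sum_negf)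
  then show ?thesis
    by unfold_locales
      (auto simp: b_symp_def scl_def algebra_simps sum.distrib sum_subtractf sum_distrib_left assms)
qed

lemma orth_space_std:
  assumes "(2::'a::{field,finite}) \<noteq> 0" shows "orth_space (scl :: 'a \<Rightarrow> _) (b_orth r)"
proof -
  interpret vector_space "scl :: 'a \<Rightarrow> _" by (rule vector_space_scl)
  show ?thesis
    by unfold_locales
      (auto simp: b_orth_def scl_def algebra_simps sum.distrib sum_distrib_left assms)
qed

lemma b_symp_unit:
  "i < r \<Longrightarrow> b_symp r x (unit (r + i)) = x i" "i < r \<Longrightarrow> b_symp r x (unit i) = - x (r + i)"
  by (simp_all add: b_symp_def unit_def if_distrib[of "\<lambda>t. _ * t"] sum.delta sum_negf cong: if_cong)

lemma b_orth_unit: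
  "i < r \<Longrightarrow> b_orth r x (unit (r + i)) = x i" "i < r \<Longrightarrow> b_orth r x (unit i) = x (r + i)"
  "b_orth r x (unit (2 * r)) = 2 * x (2 * r)"
  by (simp_all add: b_orth_def unit_def if_distrib[of "\<lambda>t. _ * t"] sum.delta cong: if_cong)

lemma ndg_symp:
  assumes "(2::'a::{field,finite}) \<noteq> 0"
  shows "eps_space.ndg (scl :: 'a \<Rightarrow> _) (b_symp r) (fsp (2 * r))"
proof -
  interpret symp_space "scl :: 'a \<Rightarrow> _" "b_symp r" by (rule symp_space_std[OF assms])
  show ?thesis unfolding ndg_def
  proof (intro conjI ballI impI)
    show "subspace (fsp (2 * r) :: (nat \<Rightarrow> 'a) set)" by (rule subspaceI) (auto simp: fsp_def scl_def)
    show "finite (fsp (2 * r) :: (nat \<Rightarrow> 'a) set)" by (rule finite_fsp)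
    fix x :: "nat \<Rightarrow> 'a" assume x: "x \<in> fsp (2 * r)" "\<forall>y\<in>fsp (2 * r). b_symp r x y = 0"
    have "x i = 0" for i
    proof -
      consider "i < r" | j where "i = r + j" "j < r" | "i \<ge> 2 * r"
        by (metis add_diff_inverse_nat mult_2 nat_add_left_cancel_less not_le)
      then show ?thesis
      proof cases
        case 1
        then have "unit (r + i) \<in> (fsp (2 * r) :: (nat \<Rightarrow> 'a) set)" by (auto simp: fsp_def unit_def)
        then show ?thesis using x(2) b_symp_unit(1)[OF 1, of x] by metis
      next
        case 2
        then have "unit j \<in> (fsp (2 * r) :: (nat \<Rightarrow> 'a) set)" by (auto simp: fsp_def unit_def)
        then show ?thesis using x(2) b_symp_unit(2)[OF 2(2), of x] 2(1) by (metis neg_equal_0_iff_equal)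
      next
        case 3 then show ?thesis using x(1) by (simp add: fsp_def)
      qed
    qed
    then show "x = 0" by (simp add: fun_eq_iff)
  qed
qed

text \<open>The span of the first k hyperbolic pairs and the last coordinate. With r fixed and k
  growing from 0 to r this interpolates between the line and the whole space, so the decomposition
  can be built by induction on k without changing the form.\<close>

definition usp :: "nat \<Rightarrow> nat \<Rightarrow> (nat \<Rightarrow> 'a::field) set" where
  "usp r k = {x. \<forall>i. x i \<noteq> 0 \<longrightarrow> i < k \<or> (r \<le> i \<and> i < r + k) \<or> i = 2 * r}"

lemma usp_fsp: "usp r r = fsp (2 * r + 1)"
proof -
  have "(i < r \<or> (r \<le> i \<and> i < r + r) \<or> i = 2 * r) \<longleftrightarrow> \<not> 2 * r + 1 \<le> i" for i :: nat by auto
  then show ?thesis unfolding usp_def fsp_def by auto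
qed

lemma ndg_orth:
  assumes two: "(2::'a::{field,finite}) \<noteq> 0" and k: "k \<le> r"
  shows "eps_space.ndg (scl :: 'a \<Rightarrow> _) (b_orth r) (usp r k)"
proof -
  interpret orth_space "scl :: 'a \<Rightarrow> _" "b_orth r" by (rule orth_space_std[OF two])
  have sub: "usp r k \<subseteq> (fsp (2 * r + 1) :: (nat \<Rightarrow> 'a) set)"
    unfolding usp_fsp[symmetric] usp_def using k by fastforce
  show ?thesis unfolding ndg_def
  proof (intro conjI ballI impI)
    show "subspace (usp r k :: (nat \<Rightarrow> 'a) set)"
    proof (rule subspaceI)
      fix x y :: "nat \<Rightarrow> 'a" assume xy: "x \<in> usp r k" "y \<in> usp r k"
      show "x + y \<in> usp r k" unfolding usp_def
      proof (intro CollectI allI impI)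
        fix i assume "(x + y) i \<noteq> 0"
        then have "x i \<noteq> 0 \<or> y i \<noteq> 0" by auto
        then show "i < k \<or> (r \<le> i \<and> i < r + k) \<or> i = 2 * r" using xy unfolding usp_def by blast
      qed
    qed (auto simp: usp_def scl_def)
    show "finite (usp r k :: (nat \<Rightarrow> 'a) set)" using finite_subset[OF sub finite_fsp] .
    fix x :: "nat \<Rightarrow> 'a" assume x: "x \<in> usp r k" "\<forall>y\<in>usp r k. b_orth r x y = 0"
    have "x i = 0" for i
    proof (rule ccontr)
      assume nz: "x i \<noteq> 0"
      then have "i < k \<or> (r \<le> i \<and> i < r + k) \<or> i = 2 * r" using x(1) unfolding usp_def by blast
      then have "i < k \<or> (i = r + (i - r) \<and> i - r < k) \<or> i = 2 * r" by linarith
      then consider "i < k" | j where "i = r + j" "j < k" | "i = 2 * r" by blast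
      then show False
      proof cases
        case 1
        then have "unit (r + i) \<in> (usp r k :: (nat \<Rightarrow> 'a) set)" by (auto simp: usp_def unit_def)
        then show ?thesis using x(2) b_orth_unit(1)[of i r x] 1 k nz by force
      next
        case 2
        then have "unit j \<in> (usp r k :: (nat \<Rightarrow> 'a) set)" by (auto simp: usp_def unit_def)
        then show ?thesis using x(2) b_orth_unit(2)[of j r x] 2 k nz by force
      next
        case 3
        have "unit (2 * r) \<in> (usp r k :: (nat \<Rightarrow> 'a) set)" by (auto simp: usp_def unit_def)
        then show ?thesis using x(2) b_orth_unit(3)[of r x] 3 nz two by force
      qed
    qed
    then show "x = 0" by (simp add: fun_eq_iff)
  qed
qed

lemma hdec_std:
  assumes two: "(2::'a::{field,finite}) \<noteq> 0" and k: "k \<le> r"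
  shows "orth_space.hdec (scl :: 'a \<Rightarrow> _) (b_orth r) (usp r k) k"
proof -
  interpret orth_space "scl :: 'a \<Rightarrow> _" "b_orth r" by (rule orth_space_std[OF two])
  show ?thesis using k
  proof (induction k)
    case 0
    have "bij_betw (\<lambda>c. scl c (unit (2 * r))) (UNIV :: 'a set) (usp r 0)"
    proof (rule bij_betw_byWitness[where f' = "\<lambda>x. x (2 * r)"])
      show "\<forall>x\<in>(usp r 0 :: (nat \<Rightarrow> 'a) set). scl (x (2 * r)) (unit (2 * r)) = x"
        by (auto simp: usp_def scl_def unit_def fun_eq_iff)
    qed (auto simp: usp_def scl_def unit_def)
    then have "card (usp r 0 :: (nat \<Rightarrow> 'a) set) = CARD('a)" using bij_betw_same_card by fastforce
    moreover have "Q (unit (2 * r)) = 1"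
      unfolding Q_def b_orth_unit(3) using two by (simp add: unit_def)
    ultimately show ?case
      by (intro hdec_0[OF ndg_orth[OF two]]) (auto simp: usp_def unit_def)
  next
    case (Suc k)
    let ?e = "unit k :: nat \<Rightarrow> 'a" and ?f = "unit (r + k) :: nat \<Rightarrow> 'a"
    have kr: "k < r" using Suc.prems by simp
    have h: "hyp (usp r (Suc k)) ?e ?f"
      unfolding hyp_def using b_orth_unit(1)[OF kr, of ?e] b_orth_unit(1)[OF kr, of ?f] b_orth_unit(2)[OF kr, of ?e] kr
      by (auto simp: usp_def unit_def)
    have "perp2 (usp r (Suc k)) ?e ?f = usp r k"
    proof -
      have "perp2 (usp r (Suc k)) ?e ?f = {x \<in> usp r (Suc k). x (r + k) = 0 \<and> x k = 0}"
        unfolding perp2_def b_orth_unit(1)[OF kr] b_orth_unit(2)[OF kr] ..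
      also have "\<dots> = usp r k"
      proof (intro equalityI subsetI)
        fix x :: "nat \<Rightarrow> 'a" assume x: "x \<in> {x \<in> usp r (Suc k). x (r + k) = 0 \<and> x k = 0}"
        show "x \<in> usp r k" unfolding usp_def
        proof (intro CollectI allI impI)
          fix i assume i: "x i \<noteq> 0"
          then have "i < Suc k \<or> (r \<le> i \<and> i < r + Suc k) \<or> i = 2 * r" "i \<noteq> k" "i \<noteq> r + k"
            using x by (auto simp: usp_def)
          then show "i < k \<or> (r \<le> i \<and> i < r + k) \<or> i = 2 * r" by linarith
        qed
      next
        fix x :: "nat \<Rightarrow> 'a" assume x: "x \<in> usp r k"
        have "x k = 0" "x (r + k) = 0"
          using x kr unfolding usp_def by (auto dest: spec[of _ k] spec[of _ "r + k"])
        moreover have "x \<in> usp r (Suc k)" unfolding usp_def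
        proof (intro CollectI allI impI)
          fix i assume "x i \<noteq> 0"
          then have "i < k \<or> (r \<le> i \<and> i < r + k) \<or> i = 2 * r" using x by (auto simp: usp_def)
          then show "i < Suc k \<or> (r \<le> i \<and> i < r + Suc k) \<or> i = 2 * r" by linarith
        qed
        ultimately show "x \<in> {x \<in> usp r (Suc k). x (r + k) = 0 \<and> x k = 0}" by simp
      qed
      finally show ?thesis .
    qed
    then show ?case using hdec_Suc[OF ndg_orth[OF two Suc.prems] h] Suc.IH Suc.prems by simp
  qed
qed

subsection \<open>The symplectic groups\<close>

lemma alternating_form_emb:
  assumes "v \<in> carrier_vec (2 * r)" "w \<in> carrier_vec (2 * r)"
  shows "alternating_form r v w = b_symp r (emb (2 * r) v) (emb (2 * r) w)"
  unfolding alternating_form_def b_symp_def emb_def by (rule sum.cong) auto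

lemma carrier_Sp_group:
  assumes two: "(2::'a::{field,finite}) \<noteq> 0"
  shows "carrier (Sp_group (F :: 'a itself) r)
    = tr (2 * r) ` eps_space.isometries (scl :: 'a \<Rightarrow> _) (b_symp r) (fsp (2 * r)) (fsp (2 * r))"
proof -
  interpret symp_space "scl :: 'a \<Rightarrow> _" "b_symp r" by (rule symp_space_std[OF two])
  let ?n = "2 * r" and ?V = "fsp (2 * r) :: (nat \<Rightarrow> 'a) set" and ?A = "carrier_vec (2 * r) :: 'a vec set"
  note V = ndg_symp[OF two, of r] and s = ndgD(1)[OF ndg_symp[OF two, of r]]
  note addV = subspace_add[OF s] and sclV = subspace_scale[OF s]
  show ?thesis
  proof (intro equalityI subsetI)
    fix k assume "k \<in> carrier (Sp_group F r)"
    then have k: "k \<in> Bij ?A" "\<And>x y. x \<in> ?A \<Longrightarrow> y \<in> ?A \<Longrightarrow> k (x + y) = k x + k y"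
      "\<And>c x. x \<in> ?A \<Longrightarrow> k (c \<cdot>\<^sub>v x) = c \<cdot>\<^sub>v k x"
      "\<And>x y. x \<in> ?A \<Longrightarrow> y \<in> ?A \<Longrightarrow> alternating_form r (k x) (k y) = alternating_form r x y"
      by (auto simp: Sp_group_def linear_transformations_def)
    have "Bij ?A = tr ?n ` Bij ?V"
      using tr_iso[of ?n, where 'a = 'a] unfolding iso_def bij_betw_def by (simp add: BijGroup_def)
    then obtain g where g: "g \<in> Bij ?V" "k = tr ?n g" using k(1) by blast
    have gF: "g \<in> ?V \<rightarrow> ?V" using Bij_imp_funcset[OF g(1)] .
    have ek: "emb ?n (k x) = g (emb ?n x)" if "x \<in> ?A" for x
      using emb_tr[OF gF that] g(2) by simp
    have kA: "k x \<in> ?A" if "x \<in> ?A" for x using Bij_imp_funcset[OF k(1)] that by blast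
    have ex: "\<exists>x'\<in>?A. x = emb ?n x'" if "x \<in> ?V" for x
      using emb_vec[OF that] by (intro bexI[of _ "vec ?n x"]) auto
    have "isometry ?V ?V g"
      unfolding isometry_def
    proof (intro conjI ballI allI)
      show "g ` ?V = ?V" using g(1) by (simp add: Bij_def bij_betw_def)
      fix x y assume "x \<in> ?V" "y \<in> ?V"
      then obtain x' y' where x': "x' \<in> ?A" "x = emb ?n x'" "y' \<in> ?A" "y = emb ?n y'" using ex by blast
      show "g (x + y) = g x + g y"
        using ek[of "x' + y'"] x' k(2)[OF x'(1,3)] kA by (simp add: ek emb_add)
      show "b_symp r (g x) (g y) = b_symp r x y"
        using k(4)[OF x'(1,3)] x' kA by (simp add: alternating_form_emb ek)
    next
      fix c x assume "x \<in> ?V"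
      then obtain x' where x': "x' \<in> ?A" "x = emb ?n x'" using ex by blast
      show "g (scl c x) = scl c (g x)"
        using ek[of "c \<cdot>\<^sub>v x'"] x' k(3)[OF x'(1)] kA by (simp add: ek emb_smult)
    qed
    then show "k \<in> tr ?n ` isometries ?V ?V" using g by (auto simp: isometries_def Bij_def)
  next
    fix k assume "k \<in> tr ?n ` isometries ?V ?V"
    then obtain g where g: "g \<in> isometries ?V ?V" "k = tr ?n g" by blast
    have ig: "isometry ?V ?V g" using g(1) by (simp add: isometries_def)
    have gB: "g \<in> Bij ?V" using isos_Bij[OF V] g(1) by blast
    have kB: "k \<in> Bij ?A" using tr_Bij[OF gB] g(2) by simp
    have kA: "k x \<in> ?A" if "x \<in> ?A" for x using Bij_imp_funcset[OF kB] that by blast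
    have ek: "emb ?n (k x) = g (emb ?n x)" if "x \<in> ?A" for x
      using emb_tr[OF Bij_imp_funcset[OF gB] that] g(2) by simp
    have 1: "k (x + y) = k x + k y" if xy: "x \<in> ?A" "y \<in> ?A" for x y
    proof -
      have "emb ?n (k (x + y)) = emb ?n (k x + k y)"
        using xy kA ek isoD(1)[OF ig emb_fsp emb_fsp] by (simp add: emb_add)
      then show ?thesis using emb_inject[of "k (x + y)" ?n "k x + k y"] kA xy by simp
    qed
    have 2: "k (c \<cdot>\<^sub>v x) = c \<cdot>\<^sub>v k x" if x: "x \<in> ?A" for c x
    proof -
      have "emb ?n (k (c \<cdot>\<^sub>v x)) = emb ?n (c \<cdot>\<^sub>v k x)"
        using x kA ek isoD(2)[OF ig emb_fsp] by (simp add: emb_smult)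
      then show ?thesis using emb_inject[of "k (c \<cdot>\<^sub>v x)" ?n "c \<cdot>\<^sub>v k x"] kA x by simp
    qed
    have 3: "alternating_form r (k x) (k y) = alternating_form r x y" if "x \<in> ?A" "y \<in> ?A" for x y
      using that kA ek isoD(5)[OF ig emb_fsp emb_fsp] by (simp add: alternating_form_emb)
    show "k \<in> carrier (Sp_group F r)"
      using kB 1 2 3 by (simp add: Sp_group_def linear_transformations_def)
  qed
qed

text \<open>Presents a quotient of H as a surjective image of the isomorphic group G, in the shape
  required by \<open>k2_surj_hom\<close>.\<close>

lemma quotient_by_iso:
  assumes G: "group G" and f: "f \<in> iso G H" and H: "group H" and N: "N \<lhd> H"
  defines "p \<equiv> \<lambda>g. N #>\<^bsub>H\<^esub> f g"
  shows "group (H Mod N)" "p \<in> hom G (H Mod N)" "p ` carrier G = carrier (H Mod N)"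
    "kernel G (H Mod N) p = {g \<in> carrier G. f g \<in> N}"
proof -
  interpret N: normal N H by fact
  have hom: "f \<in> hom G H" and im: "f ` carrier G = carrier H" using f by (auto simp: iso_def bij_betw_def)
  show "group (H Mod N)" by (rule N.factorgroup_is_group)
  show "p \<in> hom G (H Mod N)"
    using hom_compose[OF hom N.r_coset_hom_Mod] by (simp add: p_def comp_def)
  show "p ` carrier G = carrier (H Mod N)"
    using FactGroup_surj[of H N] unfolding p_def im[symmetric] by (simp add: image_image)
  have "f g \<in> kernel H (H Mod N) (\<lambda>g. N #>\<^bsub>H\<^esub> g) \<longleftrightarrow> p g = \<one>\<^bsub>H Mod N\<^esub>" if "g \<in> carrier G" for g
    using that im by (auto simp: kernel_def p_def)
  then show "kernel G (H Mod N) p = {g \<in> carrier G. f g \<in> N}"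
    unfolding FactGroup_kernel[OF N] by (auto simp: kernel_def)
qed

theorem C_group_facts:
  fixes F :: "'a::{field,finite} itself"
  assumes two: "(2::'a) \<noteq> 0" and r: "r \<ge> 1"
  shows "group (C_group F r)" "k2 (C_group F r) = r div 2 + 1"
    "2 * order (C_group F r) = (\<Prod>i<r. (CARD('a) ^ (2 * i + 2) - 1) * CARD('a) ^ (2 * i + 1))"
proof -
  interpret symp_space "scl :: 'a \<Rightarrow> _" "b_symp r" by (rule symp_space_std[OF two])
  let ?V = "fsp (2 * r) :: (nat \<Rightarrow> 'a) set"
  note V = ndg_symp[OF two, of r] and s = ndgD(1)[OF ndg_symp[OF two, of r]]
  have cV: "card ?V = CARD('a) ^ (2 * r)" by (rule card_fsp)
  have Sp: "Sp_group F r = (BijGroup (carrier_vec (2 * r)))\<lparr>carrier := tr (2 * r) ` isometries ?V ?V\<rparr>"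
    using carrier_Sp_group[OF two, of F r] by (simp add: Sp_group_def)
  have f: "tr (2 * r) \<in> iso (IsoGroup ?V) (Sp_group F r)"
    unfolding IsoGroup_def Sp
    by (rule iso_restrict_carrier[OF tr_iso]) (use isos_Bij[OF V] in \<open>auto simp: BijGroup_def\<close>)
  have G: "group (IsoGroup ?V)" by (rule group_IsoGroup[OF V])
  have H: "group (Sp_group F r)"
  proof -
    \<comment> \<open>The image of a group under an isomorphism is a group whose unit is the image
      of the unit, which still has to be identified with the given one.\<close>
    have "group ((Sp_group F r)\<lparr>one := tr (2 * r) \<one>\<^bsub>IsoGroup ?V\<^esub>\<rparr>)"
      using group.iso_imp_img_group[OF G f] .
    moreover have "tr (2 * r) \<one>\<^bsub>IsoGroup ?V\<^esub> = \<one>\<^bsub>Sp_group F r\<^esub>"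
      by (auto simp: IsoGroup_simps[OF V] Sp BijGroup_def tr_def emb_fsp vec_emb fun_eq_iff)
    ultimately show ?thesis by simp
  qed
  note N = group.normal_center[OF H]
  note q = quotient_by_iso[OF G f H N, folded C_group_def]
  let ?p = "\<lambda>g. group_center (Sp_group F r) #>\<^bsub>Sp_group F r\<^esub> tr (2 * r) g"
  have "kernel (IsoGroup ?V) (C_group F r) ?p = group_center (IsoGroup ?V)"
    unfolding q(4) using iso_center_iff[OF f _ G] by (auto simp: group_center_def)
  then have ker: "kernel (IsoGroup ?V) (C_group F r) ?p = {\<lambda>x\<in>?V. x, \<lambda>x\<in>?V. - x}"
    using center_IsoGroup[OF V] by simp
  show "group (C_group F r)" by (rule q(1))
  show "k2 (C_group F r) = r div 2 + 1" by (rule k2_IsoGroup[OF V cV r q(1-3) ker])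
  have "(unit 0 :: nat \<Rightarrow> 'a) \<in> ?V" using r by (auto simp: fsp_def unit_def)
  \<comment> \<open>A nonzero vector shows that the identity and -1 differ, so the kernel has
    exactly two elements.\<close>
  moreover have "(unit 0 :: nat \<Rightarrow> 'a) \<noteq> - unit 0"
  proof
    assume "(unit 0 :: nat \<Rightarrow> 'a) = - unit 0"
    then have "(unit 0 :: nat \<Rightarrow> 'a) = 0" by (rule two_cancel)
    from fun_cong[OF this, of 0] show False by (simp add: unit_def)
  qed
  ultimately have "(\<lambda>x\<in>?V. x) \<noteq> (\<lambda>x\<in>?V. - x)" by (metis restrict_apply')
  then have "card (kernel (IsoGroup ?V) (C_group F r) ?p) = 2" unfolding ker by simp
  moreover have "order (IsoGroup ?V) = card (isometries ?V ?V)" by (simp add: order_def IsoGroup_simps(1)[OF V])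
  ultimately show "2 * order (C_group F r) = (\<Prod>i<r. (CARD('a) ^ (2 * i + 2) - 1) * CARD('a) ^ (2 * i + 1))"
    using order_surj_hom[OF G q(1-3)] card_isos[OF V V cV cV] by simp
qed

subsection \<open>The orthogonal groups\<close>

theorem B_group_facts:
  fixes F :: "'a::{field,finite} itself"
  assumes two: "(2::'a) \<noteq> 0" and r: "r \<ge> 1"
  shows "group (B_group F r)" "k2 (B_group F r) = r"
    "2 * order (B_group F r) = (\<Prod>i<r. (CARD('a) ^ (2 * i + 2) - 1) * CARD('a) ^ (2 * i + 1))"
proof -
  obtain d :: 'a where d: "d \<noteq> 0" "\<And>x. x\<^sup>2 \<noteq> d" using nonsquare_exists[OF two] by blast
  define n where n: "n = 2 * r + 1"
  let ?V = "fsp n :: (nat \<Rightarrow> 'a) set" and ?A = "carrier_vec n :: 'a vec set"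
  interpret orth_space "scl :: 'a \<Rightarrow> _" "b_orth r" by (rule orth_space_std[OF two])
  interpret omega_space "scl :: 'a \<Rightarrow> _" "b_orth r" ?V r d
    by unfold_locales (use hdec_std[OF two, of r r] r d in \<open>auto simp: usp_fsp n\<close>)
  have QB: "Q_B r v = Q (emb n v)" if "v \<in> ?A" for v :: "'a vec"
  proof -
    have "(\<Sum>i<r. v $ i * v $ (r + i) + v $ (r + i) * v $ i) = 2 * (\<Sum>i<r. v $ i * v $ (r + i))"
      by (simp add: sum_distrib_left mult.commute)
    moreover have "b_orth r (emb n v) (emb n v)
        = (\<Sum>i<r. v $ i * v $ (r + i) + v $ (r + i) * v $ i) + 2 * v $ (2 * r) * v $ (2 * r)"
      unfolding b_orth_def emb_def by (intro arg_cong2[where f = "(+)"] sum.cong) (auto simp: n)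
    ultimately show ?thesis using two by (simp add: Q_B_def Q_def power2_eq_square field_simps)
  qed
  have pf: "polar_form (Q_B r) u v = b_orth r (emb n u) (emb n v)" if "u \<in> ?A" "v \<in> ?A" for u v :: "'a vec"
    using that by (simp add: polar_form_def QB emb_add Q_add)
  \<comment> \<open>Once Q_B and its polar form are identified with \<open>Q\<close> and
    \<open>b_orth\<close>, the two formulas agree term by term under the embedding.\<close>
  have sg: "siegel n (Q_B r) u w = tr n (restrict (sieg (emb n u) (emb n w)) ?V)"
    if "u \<in> ?A" "w \<in> ?A" for u w :: "'a vec"
  proof (rule extensionalityI[of _ ?A])
    fix x assume x: "x \<in> ?A"
    let ?y = "x + polar_form (Q_B r) x u \<cdot>\<^sub>v w - polar_form (Q_B r) x w \<cdot>\<^sub>v u - (Q_B r w * polar_form (Q_B r) x u) \<cdot>\<^sub>v u"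
    have y: "?y \<in> ?A" using x that by simp
    have "emb n ?y = sieg (emb n u) (emb n w) (emb n x)"
      using x that by (simp add: emb_diff emb_add emb_smult pf QB sieg_def)
    then have "?y = vec n (sieg (emb n u) (emb n w) (emb n x))" using vec_emb[OF y] by simp
    then show "siegel n (Q_B r) u w x = tr n (restrict (sieg (emb n u) (emb n w)) ?V) x"
      using x by (simp add: siegel_def tr_def emb_fsp)
  qed (simp_all add: siegel_def tr_def)
  let ?S = "{restrict (sieg u w) ?V | u w. u \<in> ?V \<and> w \<in> ?V \<and> u \<noteq> 0 \<and> Q u = 0 \<and> b_orth r u w = 0}"
  have S: "siegel_transformations n (Q_B r) = tr n ` ?S"
  proof (intro equalityI subsetI)
    fix k :: "'a vec \<Rightarrow> 'a vec" assume "k \<in> siegel_transformations n (Q_B r)"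
    then obtain u w where u: "k = siegel n (Q_B r) u w" "u \<in> ?A" "w \<in> ?A" "u \<noteq> 0\<^sub>v n" "Q_B r u = 0"
      "polar_form (Q_B r) u w = 0" by (auto simp: siegel_transformations_def)
    have "emb n u \<noteq> 0" using u(2,4) emb_inject[of u n "0\<^sub>v n"] emb_zero[of n] by auto
    then have "restrict (sieg (emb n u) (emb n w)) ?V \<in> ?S"
      using u emb_fsp QB pf by fastforce
    then show "k \<in> tr n ` ?S" using u(1) sg[OF u(2,3)] by blast
  next
    fix k assume "k \<in> tr n ` ?S"
    then obtain u w where u: "k = tr n (restrict (sieg u w) ?V)" "u \<in> ?V" "w \<in> ?V" "u \<noteq> 0" "Q u = 0" "b_orth r u w = 0"
      by blast
    let ?u = "vec n u" and ?w = "vec n w"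
    have e: "emb n ?u = u" "emb n ?w = w" using emb_vec u by auto
    have c: "?u \<in> ?A" "?w \<in> ?A" by auto
    have "?u \<noteq> 0\<^sub>v n" using e(1) emb_zero[of n] u(4) by metis
    then show "k \<in> siegel_transformations n (Q_B r)"
      unfolding siegel_transformations_def using u c e sg[OF c] QB[OF c(1)] pf[OF c]
      by (intro CollectI exI[of _ ?u] exI[of _ ?w]) simp
  qed
  interpret t: group_hom "BijGroup ?V" "BijGroup ?A" "tr n"
    by (rule group_hom.intro[OF group_BijGroup group_BijGroup]) (use tr_iso[of n, where 'a = 'a] in \<open>simp add: group_hom_axioms_def iso_def\<close>)
  have "?S \<subseteq> K" unfolding K_eq_generate[symmetric] by (auto intro: generate.incl)
  then have SB: "?S \<subseteq> carrier (BijGroup ?V)" using K_isos isos_Bij[OF V] by (auto simp: BijGroup_def)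
  have gen: "generate (BijGroup ?A) (siegel_transformations n (Q_B r)) = tr n ` K"
    using t.generate_img[OF SB] unfolding S K_eq_generate .
  have siegel_prod: "Omega_group F r = (BijGroup ?A)\<lparr>carrier := tr n ` K\<rparr>"
    unfolding Omega_group_def Let_def n[symmetric] gen ..
  have f: "tr n \<in> iso KGroup (Omega_group F r)"
    unfolding KGroup_def siegel_prod
    by (rule iso_restrict_carrier[OF tr_iso]) (use K_isos isos_Bij[OF V] in \<open>auto simp: BijGroup_def\<close>)
  have G: "group KGroup" by (rule group_KGroup)
  have t1: "tr n \<one>\<^bsub>KGroup\<^esub> = \<one>\<^bsub>Omega_group F r\<^esub>"
    by (auto simp: KGroup_simps siegel_prod BijGroup_def tr_def emb_fsp vec_emb fun_eq_iff)
  have H: "group (Omega_group F r)"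
    using group.iso_imp_img_group[OF G f] unfolding t1 by simp
  let ?N = "carrier (Omega_group F r) \<inter> scalar_transformations n"
  \<comment> \<open>A scalar c that preserves a nonzero value of Q satisfies c^2 = 1, and c = -1 is
    excluded by the characters of -1.\<close>
  have inN: "tr n g \<in> scalar_transformations n \<longleftrightarrow> g = (\<lambda>x\<in>?V. x)" if g: "g \<in> K" for g
  proof
    assume "tr n g \<in> scalar_transformations n"
    then obtain c where c: "tr n g = (\<lambda>x\<in>?A. c \<cdot>\<^sub>v x)" by (auto simp: scalar_transformations_def)
    have gi: "isometry ?V ?V g" using g by (simp add: K_iff)
    have gF: "g \<in> ?V \<rightarrow> ?V" using isoD(4)[OF gi] by blast
    have gc: "g x = scl c x" if x: "x \<in> ?V" for x
    proof -
      have "emb n (tr n g (vec n x)) = g (emb n (vec n x))" by (rule emb_tr[OF gF]) simp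
      then show ?thesis unfolding c using emb_vec[OF x] by (simp add: emb_smult)
    qed
    obtain va where va: "va \<in> ?V" "Q va = 1" using ex_va by metis
    have "c\<^sup>2 = 1" using iso_Q[OF gi va(1)] gc[OF va(1)] va(2) by (simp add: Q_scale)
    then have "c = 1 \<or> c = - 1" by (simp add: power2_eq_1_iff)
    moreover have "c \<noteq> - 1"
    proof
      assume "c = - 1"
      then have "g x = - x" if "x \<in> ?V" for x using gc[OF that] by (simp add: scl_def fun_eq_iff)
      then have "theta ?V k g = theta ?V k uminus" for k by (intro theta_cong)
      then show False using uminus_not_siegel_prod g by (simp add: K_iff)
    qed
    ultimately have "g x = x" if "x \<in> ?V" for x using gc[OF that] by (simp add: scl_def)
    then show "g = (\<lambda>x\<in>?V. x)"
      using g by (intro extensionalityI[of _ ?V]) (auto simp: K_iff)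
  next
    assume g1: "g = (\<lambda>x\<in>?V. x)"
    have "tr n g = (\<lambda>x\<in>?A. 1 \<cdot>\<^sub>v x)"
      unfolding g1 by (rule ext) (simp add: tr_def emb_fsp vec_emb)
    then show "tr n g \<in> scalar_transformations n"
      unfolding scalar_transformations_def by (intro CollectI exI[of _ 1] conjI one_neq_zero) assumption
  qed
  have oneK: "(\<lambda>x\<in>?V. x) \<in> K" using monoid.one_closed[OF group.is_monoid[OF G]] by (simp add: KGroup_simps)
  have N1: "?N = {\<one>\<^bsub>Omega_group F r\<^esub>}"
  proof (intro equalityI subsetI)
    fix x assume x: "x \<in> ?N"
    then obtain g where "g \<in> K" "x = tr n g" by (auto simp: siegel_prod)
    then show "x \<in> {\<one>\<^bsub>Omega_group F r\<^esub>}" using inN[of g] x t1 unfolding KGroup_simps(2) by simp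
  next
    fix x assume "x \<in> {\<one>\<^bsub>Omega_group F r\<^esub>}"
    then have "x = tr n (\<lambda>x\<in>?V. x)" using t1 unfolding KGroup_simps(2) by simp
    then show "x \<in> ?N" using inN[OF oneK] oneK by (simp add: siegel_prod)
  qed
  have N: "?N \<lhd> Omega_group F r" unfolding N1 by (rule group.one_is_normal[OF H])
  have B: "B_group F r = Omega_group F r Mod ?N" unfolding B_group_def Let_def n[symmetric] ..
  note q = quotient_by_iso[OF G f H N, folded B]
  let ?p = "\<lambda>g. ?N #>\<^bsub>Omega_group F r\<^esub> tr n g"
  have ker: "kernel KGroup (B_group F r) ?p = {\<lambda>x\<in>?V. x}"
    unfolding q(4) using inN oneK by (auto simp: KGroup_simps(1) siegel_prod)
  show "group (B_group F r)" by (rule q(1))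
  show "k2 (B_group F r) = r" by (rule k2_KGroup[OF q(1-3) ker])
  have "order KGroup = card K" by (simp add: order_def KGroup_simps(1))
  then show "2 * order (B_group F r) = (\<Prod>i<r. (CARD('a) ^ (2 * i + 2) - 1) * CARD('a) ^ (2 * i + 1))"
    using order_surj_hom[OF G q(1-3)] card_K unfolding ker by simp
qed

theorem mainTheorem3:
  fixes F :: "'a :: {field, finite} itself"
  assumes "odd (card (UNIV :: 'a set))"
  shows "(\<forall>r \<ge> 1. k2 (B_group F r) = r \<and> k2 (C_group F r) = r div 2 + 1) \<and>
         (\<forall>r \<ge> 3. order (B_group F r) = order (C_group F r) \<and> \<not> B_group F r \<cong> C_group F r)"
proof -
  have two: "(2::'a) \<noteq> 0" by (rule two_nonzero[OF assms])
  note B = B_group_facts[OF two, of _ F] and C = C_group_facts[OF two, of _ F]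
  \<comment> \<open>The numbers r and r div 2 + 1 coincide for r = 1 and r = 2 and differ from r = 3
    on.\<close>
  have "\<not> B_group F r \<cong> C_group F r" if "r \<ge> 3" for r
    using k2_is_iso[OF B(1) C(1), of r r] B(2)[of r] C(2)[of r] that by auto
  moreover have "order (B_group F r) = order (C_group F r)" if "r \<ge> 3" for r
    using B(3)[of r] C(3)[of r] that by simp
  ultimately show ?thesis using B(2) C(2) by blast
qed

end
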